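(* Let $p$ be a prime, let $G$ be a finite $p$-group and let $r\ge 2$ be an integer. Suppose that either $\gamma_r(G)$ is cyclic, or $p$ is odd and $\gamma_r(G)$ can be generated by $2$ elements. Then there exist an integer $j$ with $1\le j\le r$ and elements $x_1,\ldots,x_{j-1},x_{j+1},\ldots,x_r\in G$ such that $$\gamma_r(G)=\{[x_1,\ldots,x_{j-1},g,x_{j+1},\ldots,x_r]\mid g\in G\}.$$
   Context: Commutators: $[x,y]=x^{-1}y^{-1}xy$, and longer commutators are left-normed: $[x_1,\ldots,x_r]=[[x_1,\ldots,x_{r-1}],x_r]$, with $[x_1]=x_1$. $\gamma_r(G)$ is the $r$-th term of the lower central series of $G$, i.e. the subgroup generated by all elements $[g_1,\ldots,g_r]$ with $g_i\in G$. *)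

theory Defs
  imports "HOL-Algebra.Elementary_Groups" "HOL-Computational_Algebra.Primes"
begin

text \<open>
  The convention is \<open>[x, y] = x\<inverse> y\<inverse> x y\<close>. It differs from the one behind \<^const>\<open>derived_set\<close>,
  which is \<open>x y x\<inverse> y\<inverse>\<close>.
\<close>

definition commutator :: "('a, 'b) monoid_scheme \<Rightarrow> 'a \<Rightarrow> 'a \<Rightarrow> 'a" where
  "commutator G x y = inv\<^bsub>G\<^esub> x \<otimes>\<^bsub>G\<^esub> inv\<^bsub>G\<^esub> y \<otimes>\<^bsub>G\<^esub> x \<otimes>\<^bsub>G\<^esub> y"

text \<open>
  The list \<open>[x\<^sub>1, \<dots>, x\<^sub>r]\<close> stands for the arguments of the commutator. Only nonempty lists matter;
  the value at the empty list is arbitrary.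
\<close>

fun left_normed_commutator :: "('a, 'b) monoid_scheme \<Rightarrow> 'a list \<Rightarrow> 'a" where
  "left_normed_commutator G [] = \<one>\<^bsub>G\<^esub>"
| "left_normed_commutator G (x # xs) = foldl (commutator G) x xs"

lemma left_normed_commutator_singleton: "left_normed_commutator G [x] = x"
  by simp

lemma left_normed_commutator_snoc:
  "xs \<noteq> [] \<Longrightarrow>
    left_normed_commutator G (xs @ [y]) = commutator G (left_normed_commutator G xs) y"
  by (cases xs) simp_all

text \<open>
  Indexing starts at \<open>1\<close>, where the term is the whole group.
\<close>

definition lower_central :: "('a, 'b) monoid_scheme \<Rightarrow> nat \<Rightarrow> 'a set" where
  "lower_central G r =
    generate G {left_normed_commutator G gs | gs. length gs = r \<and> set gs \<subseteq> carrier G}"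

end

theory Submission
  imports Defs "HOL-Algebra.Group_Action" "HOL-Algebra.Multiplicative_Group"
begin

text \<open>
  Put \<open>N\<^sub>0 = \<gamma>\<^sub>r(G)\<close>. The proof uses a chain of normal subgroups \<open>N\<^sub>0 \<ge> N\<^sub>1 \<ge> \<dots>\<close> ending in the
  trivial group, with \<open>[N\<^sub>i, G] \<le> N\<^sub>i\<^sub>+\<^sub>1\<close>, in which the \<open>p\<close>-th powers of \<open>N\<^sub>i\<close> cover
  \<open>N\<^sub>i\<^sub>+\<^sub>e\<close> modulo \<open>N\<^sub>i\<^sub>+\<^sub>e\<^sub>+\<^sub>1\<close>; here \<open>e = 1\<close> if \<open>[N\<^sub>0, G]\<close> is contained in
  \<open>N\<^sub>0\<^sup>p[N\<^sub>0, G, G]\<close>, and \<open>e = 2\<close> otherwise. Call \<open>h\<close> an element of level \<open>i\<close> if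
  \<open>h\<close> lies in the \<open>(r-1)\<close>-st term of the upper central series modulo \<open>N\<^sub>i\<close>. With all other
  entries fixed, the commutator with free entry \<open>h\<close> of level \<open>i\<close> takes values in \<open>N\<^sub>i\<close>, is
  multiplicative modulo \<open>N\<^sub>i\<^sub>+\<^sub>1\<close>, and turns \<open>h\<^sup>p\<close> into the \<open>p\<close>-th power of its value at \<open>h\<close>
  modulo \<open>N\<^sub>i\<^sub>+\<^sub>e\<^sub>+\<^sub>1\<close>, up to a correction \<open>[y, h, h, h, \<dots>]\<close> (or \<open>[y, h, h, \<dots>]\<close> if \<open>p = 2\<close>).
  If the values cover \<open>N\<^sub>i\<close> modulo \<open>N\<^sub>i\<^sub>+\<^sub>1\<close> for all \<open>i < e\<close> by elements whose correction
  vanishes, then repeated \<open>p\<close>-th powers cover every later quotient, and successive approximation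
  yields all of \<open>N\<^sub>0\<close>.

  If \<open>e = 1\<close> and \<open>p\<close> is odd, there is no correction, and a multilinear map spanning a space of
  dimension at most two is surjective in one of its entries. In the other cases \<open>N\<^sub>0/N\<^sub>1\<close> and
  \<open>N\<^sub>1/N\<^sub>2\<close> have order at most \<open>p\<close>. With \<open>C = C\<^sub>G(N\<^sub>0/N\<^sub>2)\<close>, the free entry is placed as far
  to the right as possible such that an element \<open>a\<close> of \<open>C\<close> there has a value outside \<open>N\<^sub>1\<close>; this
  maximality removes the correction for elements of \<open>C\<close>. For \<open>e = 2\<close> all later entries may be taken
  equal to some \<open>t\<close> outside \<open>C\<close>, and \<open>[a, t]\<close> then has a value in \<open>N\<^sub>1\<close> outside \<open>N\<^sub>2\<close>.
\<close>

section \<open>Commutator identities\<close>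

context group
begin

abbreviation cm :: "'a \<Rightarrow> 'a \<Rightarrow> 'a" where "cm \<equiv> commutator G"
abbreviation fc :: "'a \<Rightarrow> 'a list \<Rightarrow> 'a" where "fc \<equiv> foldl (commutator G)"

lemma mult_inv_cancel:
  assumes "x \<in> carrier G" "y \<in> carrier G"
  shows "x \<otimes> (inv x \<otimes> y) = y" and "inv x \<otimes> (x \<otimes> y) = y"
  using assms by (simp_all add: m_assoc[symmetric])

lemmas word_simps = m_assoc inv_mult_group mult_inv_cancel commutator_def

lemma commutator_closed [simp, intro]:
  "x \<in> carrier G \<Longrightarrow> y \<in> carrier G \<Longrightarrow> cm x y \<in> carrier G"
  by (simp add: commutator_def)

lemma foldl_commutator_closed [simp, intro]:
  "x \<in> carrier G \<Longrightarrow> set ys \<subseteq> carrier G \<Longrightarrow> fc x ys \<in> carrier G"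
  by (induction ys arbitrary: x) auto

lemma left_normed_commutator_closed [simp, intro]:
  "set xs \<subseteq> carrier G \<Longrightarrow> left_normed_commutator G xs \<in> carrier G"
  by (cases xs) auto

lemma inv_commutator:
  "x \<in> carrier G \<Longrightarrow> y \<in> carrier G \<Longrightarrow> inv (cm x y) = cm y x"
  by (simp add: word_simps)

lemma conj_eq_mult_commutator:
  "x \<in> carrier G \<Longrightarrow> y \<in> carrier G \<Longrightarrow> inv y \<otimes> x \<otimes> y = x \<otimes> cm x y"
  by (simp add: word_simps)

lemma commutator_mult_left:
  "\<lbrakk>x \<in> carrier G; y \<in> carrier G; z \<in> carrier G\<rbrakk> \<Longrightarrow>
    cm (x \<otimes> y) z = (inv y \<otimes> cm x z \<otimes> y) \<otimes> cm y z"
  by (simp add: word_simps)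

lemma commutator_mult_right:
  "\<lbrakk>x \<in> carrier G; y \<in> carrier G; z \<in> carrier G\<rbrakk> \<Longrightarrow>
    cm x (y \<otimes> z) = cm x z \<otimes> (inv z \<otimes> cm x y \<otimes> z)"
  by (simp add: word_simps)

text \<open>Conjugated last entries take the place of the usual inverses. Each later use chooses one
  of these conjugates to be a prescribed element.\<close>

lemma hall_witt:
  "\<lbrakk>x \<in> carrier G; y \<in> carrier G; z \<in> carrier G\<rbrakk> \<Longrightarrow>
    cm (cm x y) (inv x \<otimes> z \<otimes> x) \<otimes> cm (cm z x) (inv z \<otimes> y \<otimes> z)
      \<otimes> cm (cm y z) (inv y \<otimes> x \<otimes> y) = \<one>"
  by (simp add: word_simps)

lemma commutator_one [simp]:
  "x \<in> carrier G \<Longrightarrow> cm x \<one> = \<one>" "x \<in> carrier G \<Longrightarrow> cm \<one> x = \<one>"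
  "x \<in> carrier G \<Longrightarrow> cm x x = \<one>"
  by (simp_all add: word_simps)

lemma commutator_eq_one_iff:
  assumes "x \<in> carrier G" "y \<in> carrier G"
  shows "cm x y = \<one> \<longleftrightarrow> x \<otimes> y = y \<otimes> x"
proof
  have *: "y \<otimes> x \<otimes> cm x y = x \<otimes> y" using assms by (simp add: word_simps)
  show "x \<otimes> y = y \<otimes> x" if "cm x y = \<one>" using * that assms by simp
  have "cm x y = inv (y \<otimes> x) \<otimes> (x \<otimes> y)" using assms by (simp add: word_simps)
  then show "cm x y = \<one>" if "x \<otimes> y = y \<otimes> x" using that assms by simp
qed

lemma commute_pow_left:
  assumes "x \<in> carrier G" "y \<in> carrier G" "x \<otimes> y = y \<otimes> x"
  shows "x [^] (n::nat) \<otimes> y = y \<otimes> x [^] n"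
  using assms by (simp add: group_commutes_pow)

lemma commute_pow_pow:
  assumes "x \<in> carrier G" "y \<in> carrier G" "x \<otimes> y = y \<otimes> x"
  shows "x [^] (n::nat) \<otimes> y [^] (m::nat) = y [^] m \<otimes> x [^] n"
  using assms by (metis commute_pow_left nat_pow_closed)

text \<open>Collection in class two: moving \<open>v\<close> to the left past \<open>w [^] k\<close>
  leaves the factor \<open>cm w v [^] k\<close>, and these exponents add up to
  \<open>n choose 2\<close>.\<close>

lemma mult_pow_class_two:
  assumes c: "v \<in> carrier G" "w \<in> carrier G"
    and v: "cm w v \<otimes> v = v \<otimes> cm w v" and w: "cm w v \<otimes> w = w \<otimes> cm w v"
  shows "(v \<otimes> w) [^] (n::nat) = v [^] n \<otimes> w [^] n \<otimes> cm w v [^] (n choose 2)"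
proof (induction n)
  case (Suc n)
  let ?c = "cm w v"
  have cc: "?c \<in> carrier G" using c by simp
  have wv: "w [^] k \<otimes> v = v \<otimes> w [^] k \<otimes> ?c [^] k" for k :: nat
  proof (induction k)
    case (Suc k)
    have "w [^] Suc k \<otimes> v = w [^] k \<otimes> (w \<otimes> v)" using c by (simp add: m_assoc)
    also have "w \<otimes> v = v \<otimes> w \<otimes> ?c" using c by (simp add: word_simps)
    also have "w [^] k \<otimes> (v \<otimes> w \<otimes> ?c) = (w [^] k \<otimes> v) \<otimes> (w \<otimes> ?c)" using c by (simp add: m_assoc)
    also have "\<dots> = v \<otimes> w [^] k \<otimes> (?c [^] k \<otimes> w) \<otimes> ?c" using c cc by (simp add: Suc m_assoc)
    also have "?c [^] k \<otimes> w = w \<otimes> ?c [^] k" using c cc w by (rule_tac commute_pow_left) auto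
    finally show ?case using c cc by (simp add: m_assoc)
  qed (use c in simp)
  have vn: "?c [^] k \<otimes> v = v \<otimes> ?c [^] k" and wn: "?c [^] k \<otimes> w = w \<otimes> ?c [^] k" for k :: nat
    using c cc v w by (auto intro: commute_pow_left)
  have ch: "Suc n choose 2 = n + (n choose 2)"
    by (simp add: numeral_2_eq_2)
  have "(v \<otimes> w) [^] Suc n = v [^] n \<otimes> w [^] n \<otimes> (?c [^] (n choose 2) \<otimes> v) \<otimes> w"
    using c cc by (simp add: Suc m_assoc)
  also have "\<dots> = v [^] n \<otimes> (w [^] n \<otimes> v) \<otimes> (?c [^] (n choose 2) \<otimes> w)"
    using c cc by (simp add: vn m_assoc)
  also have "\<dots> = v [^] n \<otimes> v \<otimes> w [^] n \<otimes> (?c [^] n \<otimes> w) \<otimes> ?c [^] (n choose 2)"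
    unfolding wv wn[of "n choose 2"] using c cc by (simp add: m_assoc)
  also have "\<dots> = v [^] Suc n \<otimes> w [^] Suc n \<otimes> (?c [^] n \<otimes> ?c [^] (n choose 2))"
    using c cc by (simp add: wn m_assoc)
  finally show ?case using cc by (simp add: nat_pow_mult ch)
qed (use c in \<open>simp add: binomial_eq_0\<close>)

lemma conj_pow:
  assumes "x \<in> carrier G" "z \<in> carrier G"
  shows "inv z \<otimes> x [^] (n::nat) \<otimes> z = (x \<otimes> cm x z) [^] n"
proof (induction n)
  case (Suc n)
  have "inv z \<otimes> x [^] Suc n \<otimes> z = (inv z \<otimes> x [^] n \<otimes> z) \<otimes> (inv z \<otimes> x \<otimes> z)"
    using assms by (simp add: word_simps)
  then show ?case using Suc assms by (simp add: conj_eq_mult_commutator)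
qed (use assms in simp)

lemma commutator_pow_left:
  assumes "x \<in> carrier G" "z \<in> carrier G"
  shows "cm (x [^] (n::nat)) z = inv (x [^] n) \<otimes> (x \<otimes> cm x z) [^] n"
proof -
  have "cm (x [^] n) z = inv (x [^] n) \<otimes> (inv z \<otimes> x [^] n \<otimes> z)"
    using assms by (simp add: word_simps)
  then show ?thesis using assms by (simp add: conj_pow)
qed

lemma choose_Suc: "Suc n choose 2 = n + (n choose 2)" "Suc n choose 3 = (n choose 2) + (n choose 3)"
  by (simp_all add: numeral_2_eq_2 numeral_3_eq_3)

text \<open>The commutator \<open>cm y (h [^] Suc n)\<close> is \<open>u1\<close> times the
  conjugate of \<open>cm y (h [^] n)\<close> by \<open>h\<close>. This conjugation multiplies
  \<open>u1\<close> by \<open>u2\<close> and \<open>u2\<close> by \<open>u3\<close> and fixes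
  \<open>u3\<close>, so the exponents obey Pascal's rule.\<close>

lemma commutator_pow_right:
  assumes c: "y \<in> carrier G" "h \<in> carrier G"
    and u: "u1 = cm y h" "u2 = cm u1 h" "u3 = cm u2 h" "cm u3 h = \<one>"
    and comm: "u1 \<otimes> u2 = u2 \<otimes> u1" "u1 \<otimes> u3 = u3 \<otimes> u1" "u2 \<otimes> u3 = u3 \<otimes> u2"
  shows "cm y (h [^] (n::nat)) = u1 [^] n \<otimes> u2 [^] (n choose 2) \<otimes> u3 [^] (n choose 3)"
proof (induction n)
  case (Suc n)
  have uc [simp]: "u1 \<in> carrier G" "u2 \<in> carrier G" "u3 \<in> carrier G"
    using c u by simp_all
  let ?b = "n choose 2" and ?t = "n choose 3"
  have d1: "(u1 \<otimes> u2) [^] n = u1 [^] n \<otimes> u2 [^] n"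
    and d2: "(u2 \<otimes> u3) [^] ?b = u2 [^] ?b \<otimes> u3 [^] ?b"
    by (intro pow_mult_distrib comm uc)+
  have "inv h \<otimes> (u1 [^] n \<otimes> u2 [^] ?b \<otimes> u3 [^] ?t) \<otimes> h
    = (inv h \<otimes> u1 [^] n \<otimes> h) \<otimes> (inv h \<otimes> u2 [^] ?b \<otimes> h) \<otimes> (inv h \<otimes> u3 [^] ?t \<otimes> h)"
    using c by (simp add: word_simps)
  also have "\<dots> = (u1 \<otimes> u2) [^] n \<otimes> (u2 \<otimes> u3) [^] ?b \<otimes> u3 [^] ?t"
    using c by (simp add: conj_pow u(2,3)[symmetric] u(4))
  also have "\<dots> = u1 [^] n \<otimes> (u2 [^] n \<otimes> u2 [^] ?b) \<otimes> (u3 [^] ?b \<otimes> u3 [^] ?t)"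
    by (simp only: d1 d2) (simp add: m_assoc)
  also have "\<dots> = u1 [^] n \<otimes> u2 [^] (Suc n choose 2) \<otimes> u3 [^] (Suc n choose 3)"
    by (simp add: nat_pow_mult choose_Suc)
  finally have *: "inv h \<otimes> cm y (h [^] n) \<otimes> h = u1 [^] n \<otimes> u2 [^] (Suc n choose 2) \<otimes> u3 [^] (Suc n choose 3)"
    by (simp add: Suc)
  have "cm y (h [^] Suc n) = u1 \<otimes> (inv h \<otimes> cm y (h [^] n) \<otimes> h)"
    using c by (simp add: commutator_mult_right u)
  also have "\<dots> = (u1 \<otimes> u1 [^] n) \<otimes> u2 [^] (Suc n choose 2) \<otimes> u3 [^] (Suc n choose 3)"
    unfolding * by (simp add: m_assoc)
  finally show ?case by (simp only: nat_pow_Suc2[symmetric] uc)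
qed (use c u in \<open>simp add: binomial_eq_0\<close>)

end

section \<open>Congruences modulo normal subgroups\<close>

context group
begin

lemma normal_mem_carrier: "R \<lhd> G \<Longrightarrow> x \<in> R \<Longrightarrow> x \<in> carrier G"
  using normal_imp_subgroup subgroup.mem_carrier by metis

lemma coset_group_hom:
  assumes "R \<lhd> G" shows "group_hom G (G Mod R) ((#>) R)"
  using assms by (simp add: group_hom_def group_hom_axioms_def normal.factorgroup_is_group
      normal.r_coset_hom_Mod group_axioms)

text \<open>Equality of cosets serves throughout as congruence modulo \<open>R\<close>; normality
  turns the quotient \<open>x \<otimes> inv y\<close> belonging to right cosets into
  \<open>inv y \<otimes> x\<close>.\<close>

lemma coset_eq_iff:
  assumes "R \<lhd> G" "x \<in> carrier G" "y \<in> carrier G"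
  shows "R #> x = R #> y \<longleftrightarrow> inv y \<otimes> x \<in> R"
proof -
  interpret normal R G by fact
  have "R #> x = R #> y \<longleftrightarrow> x \<otimes> inv y \<in> R"
    using assms(2,3) by (metis group.coset_join1 group.repr_independence is_group is_subgroup rcos_module rcos_self subset coset_mult_inv1 coset_mult_inv2 coset_join2 inv_closed m_closed)
  also have "\<dots> \<longleftrightarrow> inv y \<otimes> x \<in> R"
    using assms(2,3) inv_op_closed1[of y "x \<otimes> inv y"] inv_op_closed2[of y "inv y \<otimes> x"]
    by (auto simp: word_simps)
  finally show ?thesis .
qed

lemma coset_eq_one_iff:
  "R \<lhd> G \<Longrightarrow> x \<in> carrier G \<Longrightarrow> R #> x = \<one>\<^bsub>G Mod R\<^esub> \<longleftrightarrow> x \<in> R"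
  using coset_eq_iff[of R x \<one>] by (simp add: normal_imp_subgroup subgroup.subset)

lemma coset_eqE:
  assumes "R \<lhd> G" "x \<in> carrier G" "y \<in> carrier G" "R #> x = R #> y"
  obtains z where "z \<in> R" "x = y \<otimes> z"
proof
  show "inv y \<otimes> x \<in> R" using assms coset_eq_iff by blast
  show "x = y \<otimes> (inv y \<otimes> x)" using assms by (simp add: word_simps)
qed

lemma coset_commutator:
  assumes "R \<lhd> G" "x \<in> carrier G" "y \<in> carrier G"
  shows "R #> cm x y = commutator (G Mod R) (R #> x) (R #> y)"
proof -
  interpret h: group_hom G "G Mod R" "(#>) R" by (rule coset_group_hom) fact
  show ?thesis using assms by (simp only: commutator_def h.hom_mult h.hom_inv m_closed inv_closed)
qed

lemma coset_mult:
  assumes "R \<lhd> G" "x \<in> carrier G" "y \<in> carrier G"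
  shows "R #> (x \<otimes> y) = (R #> x) \<otimes>\<^bsub>G Mod R\<^esub> (R #> y)"
proof -
  interpret h: group_hom G "G Mod R" "(#>) R" by (rule coset_group_hom) fact
  show ?thesis using assms by (simp only: h.hom_mult)
qed

lemma coset_inv:
  assumes "R \<lhd> G" "x \<in> carrier G"
  shows "R #> inv x = inv\<^bsub>G Mod R\<^esub> (R #> x)"
proof -
  interpret h: group_hom G "G Mod R" "(#>) R" by (rule coset_group_hom) fact
  show ?thesis using assms by (simp only: h.hom_inv)
qed

lemma coset_pow:
  assumes "R \<lhd> G" "x \<in> carrier G"
  shows "R #> (x [^] (n::nat)) = (R #> x) [^]\<^bsub>G Mod R\<^esub> n"
proof -
  interpret h: group_hom G "G Mod R" "(#>) R" by (rule coset_group_hom) fact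
  show ?thesis using assms by (simp only: h.hom_nat_pow)
qed

lemma coset_mult_cong:
  "\<lbrakk>R \<lhd> G; x \<in> carrier G; y \<in> carrier G; x' \<in> carrier G; y' \<in> carrier G;
    R #> x = R #> x'; R #> y = R #> y'\<rbrakk> \<Longrightarrow> R #> (x \<otimes> y) = R #> (x' \<otimes> y')"
  by (simp only: coset_mult)

lemma coset_inv_cong:
  "\<lbrakk>R \<lhd> G; x \<in> carrier G; x' \<in> carrier G; R #> x = R #> x'\<rbrakk> \<Longrightarrow> R #> inv x = R #> inv x'"
  by (simp only: coset_inv)

lemma coset_absorb_right:
  "\<lbrakk>R \<lhd> G; x \<in> carrier G; z \<in> R\<rbrakk> \<Longrightarrow> R #> (x \<otimes> z) = R #> x"
  by (subst coset_eq_iff) (auto simp: word_simps normal_mem_carrier)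

lemma coset_absorb_left:
  assumes "R \<lhd> G" "x \<in> carrier G" "z \<in> R"
  shows "R #> (z \<otimes> x) = R #> x"
proof -
  have z: "z \<in> carrier G" using assms normal_imp_subgroup subgroup.mem_carrier by metis
  show ?thesis using assms z normal.inv_op_closed1[OF assms(1,2,3)]
    by (subst coset_eq_iff) (auto simp: word_simps)
qed

lemma coset_mono:
  "\<lbrakk>R \<lhd> G; S \<lhd> G; R \<subseteq> S; x \<in> carrier G; y \<in> carrier G; R #> x = R #> y\<rbrakk> \<Longrightarrow> S #> x = S #> y"
  by (auto simp: coset_eq_iff)

lemma coset_mem_subgroup:
  assumes "R \<lhd> G" "subgroup S G" "R \<subseteq> S" "x \<in> carrier G" "R #> x = R #> y" "y \<in> S"
  shows "x \<in> S"
proof -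
  have y: "y \<in> carrier G" using assms subgroup.mem_carrier by metis
  obtain z where "z \<in> R" "x = y \<otimes> z" using coset_eqE[OF assms(1,4) y assms(5)] .
  then show ?thesis using assms subgroup.m_closed by (metis subsetD)
qed

lemma normal_conj_closed:
  "\<lbrakk>R \<lhd> G; x \<in> R; g \<in> carrier G\<rbrakk> \<Longrightarrow> inv g \<otimes> x \<otimes> g \<in> R"
  by (rule normal.inv_op_closed1)

lemma normal_mult_closed: "R \<lhd> G \<Longrightarrow> x \<in> R \<Longrightarrow> y \<in> R \<Longrightarrow> x \<otimes> y \<in> R"
  using normal_imp_subgroup subgroup.m_closed by metis

lemma normal_inv_closed: "R \<lhd> G \<Longrightarrow> x \<in> R \<Longrightarrow> inv x \<in> R"
  using normal_imp_subgroup subgroup.m_inv_closed by metis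

lemma normal_one_closed: "R \<lhd> G \<Longrightarrow> \<one> \<in> R"
  using normal_imp_subgroup subgroup.one_closed by metis

lemma subgroup_pow_closed: "subgroup R G \<Longrightarrow> x \<in> R \<Longrightarrow> x [^] (n::nat) \<in> R"
  by (induction n) (auto simp: subgroup.one_closed subgroup.m_closed)

lemma normal_commutator_sym:
  assumes "R \<lhd> G" "x \<in> carrier G" "y \<in> carrier G" "cm x y \<in> R" shows "cm y x \<in> R"
  using assms by (metis inv_commutator normal_inv_closed)

lemma normal_commutator_closed:
  assumes "R \<lhd> G" "x \<in> R" "y \<in> carrier G" shows "cm x y \<in> R"
proof -
  have x: "x \<in> carrier G" using assms normal_mem_carrier by blast
  have "cm x y = inv x \<otimes> (inv y \<otimes> x \<otimes> y)" using x assms by (simp add: word_simps)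
  then show ?thesis using assms normal_mult_closed normal_inv_closed normal_conj_closed by metis
qed

lemma coset_conj:
  assumes "R \<lhd> G" "x \<in> carrier G" "g \<in> carrier G" "cm x g \<in> R"
  shows "R #> (inv g \<otimes> x \<otimes> g) = R #> x"
  using assms by (simp add: conj_eq_mult_commutator coset_absorb_right)

lemma coset_commute:
  assumes "R \<lhd> G" "x \<in> carrier G" "y \<in> carrier G" "cm x y \<in> R"
  shows "R #> (x \<otimes> y) = R #> (y \<otimes> x)"
proof -
  have "x \<otimes> y = (y \<otimes> x) \<otimes> cm x y" using assms by (simp add: word_simps)
  then show ?thesis using assms by (metis coset_absorb_right m_closed)
qed

lemma coset_commute_Mod:
  assumes "R \<lhd> G" "x \<in> carrier G" "y \<in> carrier G" "cm x y \<in> R"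
  shows "(R #> x) \<otimes>\<^bsub>G Mod R\<^esub> (R #> y) = (R #> y) \<otimes>\<^bsub>G Mod R\<^esub> (R #> x)"
  using coset_commute[OF assms] assms coset_mult by simp

lemma coset_carrier: "x \<in> carrier G \<Longrightarrow> R #> x \<in> carrier (G Mod R)"
  by (auto simp: carrier_FactGroup)

text \<open>The exact identity is applied in \<open>G Mod R\<close>, where a commutator in
  \<open>R\<close> becomes a commutation relation.\<close>

lemma coset_mult_pow_class_two:
  assumes R: "R \<lhd> G" and c: "v \<in> carrier G" "w \<in> carrier G"
    and "cm (cm w v) v \<in> R" "cm (cm w v) w \<in> R"
  shows "R #> ((v \<otimes> w) [^] (n::nat)) = R #> (v [^] n \<otimes> w [^] n \<otimes> cm w v [^] (n choose 2))"
proof -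
  interpret Q: group "G Mod R" by (rule normal.factorgroup_is_group) fact
  show ?thesis
    using Q.mult_pow_class_two[of "R #> v" "R #> w" n] coset_commute_Mod[OF R _ _ assms(4)]
      coset_commute_Mod[OF R _ _ assms(5)] R c
    by (simp only: coset_mult coset_pow coset_commutator coset_carrier m_closed nat_pow_closed commutator_closed)
qed

lemma coset_commutator_pow_right:
  assumes R: "R \<lhd> G" and c: "y \<in> carrier G" "h \<in> carrier G"
    and u: "u1 = cm y h" "u2 = cm u1 h" "u3 = cm u2 h" "cm u3 h \<in> R"
    and comm: "cm u1 u2 \<in> R" "cm u1 u3 \<in> R" "cm u2 u3 \<in> R"
  shows "R #> cm y (h [^] (n::nat)) = R #> (u1 [^] n \<otimes> u2 [^] (n choose 2) \<otimes> u3 [^] (n choose 3))"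
proof -
  interpret Q: group "G Mod R" by (rule normal.factorgroup_is_group) fact
  have uc: "u1 \<in> carrier G" "u2 \<in> carrier G" "u3 \<in> carrier G"
    using c u by simp_all
  have "commutator (G Mod R) (R #> u3) (R #> h) = \<one>\<^bsub>G Mod R\<^esub>"
    using R c uc u(4) by (metis coset_commutator coset_eq_one_iff commutator_closed)
  then show ?thesis
    using Q.commutator_pow_right[of "R #> y" "R #> h" "R #> u1" "R #> u2" "R #> u3" n]
      coset_commute_Mod[OF R _ _ comm(1)] coset_commute_Mod[OF R _ _ comm(2)]
      coset_commute_Mod[OF R _ _ comm(3)] R c uc u(1-3)
    by (simp only: coset_mult coset_pow coset_commutator coset_carrier m_closed nat_pow_closed
        commutator_closed)
qed

lemma subgroup_commutator_right:
  assumes "R \<lhd> G" "A \<subseteq> carrier G"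
  shows "subgroup {w \<in> carrier G. \<forall>a\<in>A. cm a w \<in> R} G"
proof (rule subgroupI)
  fix w assume w: "w \<in> {w \<in> carrier G. \<forall>a\<in>A. cm a w \<in> R}"
  have "cm a (inv w) \<in> R" if "a \<in> A" for a
  proof -
    have a: "a \<in> carrier G" using that assms by auto
    have "cm a (inv w) = inv (inv (inv w) \<otimes> cm a w \<otimes> inv w)"
      using a w by (simp add: word_simps)
    then show ?thesis using w that assms normal_inv_closed normal_conj_closed inv_closed
      by (metis (no_types, lifting) mem_Collect_eq)
  qed
  then show "inv w \<in> {w \<in> carrier G. \<forall>a\<in>A. cm a w \<in> R}" using w by simp
next
  fix w v assume w: "w \<in> {w \<in> carrier G. \<forall>a\<in>A. cm a w \<in> R}" and v: "v \<in> {w \<in> carrier G. \<forall>a\<in>A. cm a w \<in> R}"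
  have "cm a (w \<otimes> v) \<in> R" if "a \<in> A" for a
  proof -
    have "a \<in> carrier G" using that assms by auto
    then have "cm a (w \<otimes> v) = cm a v \<otimes> (inv v \<otimes> cm a w \<otimes> v)"
      using w v by (intro commutator_mult_right) auto
    then show ?thesis using w v that assms normal_mult_closed normal_conj_closed
      by (metis (no_types, lifting) mem_Collect_eq)
  qed
  then show "w \<otimes> v \<in> {w \<in> carrier G. \<forall>a\<in>A. cm a w \<in> R}" using w v by simp
next
  show "{w \<in> carrier G. \<forall>a\<in>A. cm a w \<in> R} \<noteq> {}"
    using assms normal_one_closed by (auto intro!: exI[of _ \<one>] simp: subset_iff)
qed auto

text \<open>This set is the preimage of the centre of \<open>G Mod R\<close>.\<close>

lemma normal_commutator_left:
  assumes "R \<lhd> G"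
  shows "{g \<in> carrier G. \<forall>x\<in>carrier G. cm g x \<in> R} \<lhd> G"
proof -
  have eq: "{g \<in> carrier G. \<forall>x\<in>carrier G. cm g x \<in> R} = {w \<in> carrier G. \<forall>a\<in>carrier G. cm a w \<in> R}"
    using normal_commutator_sym[OF assms] by auto
  show ?thesis
  proof (subst normal_inv_iff, intro conjI ballI)
    show "subgroup {g \<in> carrier G. \<forall>x\<in>carrier G. cm g x \<in> R} G"
      unfolding eq by (rule subgroup_commutator_right) (use assms in auto)
    fix x h assume x: "x \<in> carrier G" and h: "h \<in> {g \<in> carrier G. \<forall>x\<in>carrier G. cm g x \<in> R}"
    have "cm (x \<otimes> h \<otimes> inv x) z \<in> R" if z: "z \<in> carrier G" for z
    proof -
      have "cm (x \<otimes> h \<otimes> inv x) z = x \<otimes> cm h (inv x \<otimes> z \<otimes> x) \<otimes> inv x"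
        using x h z by (simp add: word_simps)
      then show ?thesis using x h z normal.inv_op_closed2[OF assms x] by auto
    qed
    then show "x \<otimes> h \<otimes> inv x \<in> {g \<in> carrier G. \<forall>x\<in>carrier G. cm g x \<in> R}" using x h by auto
  qed
qed

text \<open>An instance of the three subgroups lemma, from \<open>[A, G, G] \<le> R\<close> to
  \<open>[A, [G, G]] \<le> R\<close>: two of the three Hall-Witt factors lie in \<open>R\<close>,
  hence so does the third.\<close>

lemma commutator_commutator_closed:
  assumes R: "R \<lhd> G" and A: "A \<lhd> G" and B: "B \<lhd> G"
    and AB: "\<And>x g. x \<in> A \<Longrightarrow> g \<in> carrier G \<Longrightarrow> cm x g \<in> B"
    and BR: "\<And>x g. x \<in> B \<Longrightarrow> g \<in> carrier G \<Longrightarrow> cm x g \<in> R"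
    and a: "a \<in> A" and x: "x \<in> carrier G" and y: "y \<in> carrier G"
  shows "cm a (cm x y) \<in> R"
proof -
  \<comment> \<open>Chosen so that the conjugated entry \<open>inv x \<otimes> z \<otimes> x\<close>
    of the Hall-Witt identity is \<open>a\<close>.\<close>
  define z where "z = x \<otimes> a \<otimes> inv x"
  have ac: "a \<in> carrier G" using A a normal_mem_carrier by blast
  have z: "z \<in> A" unfolding z_def using normal.inv_op_closed2[OF A x a] .
  have zc: "z \<in> carrier G" using A z normal_mem_carrier by blast
  have "inv x \<otimes> z \<otimes> x = a" unfolding z_def using ac x by (simp add: word_simps)
  with hall_witt[OF x y zc] have hw: "cm (cm x y) a \<otimes> (cm (cm z x) (inv z \<otimes> y \<otimes> z)
      \<otimes> cm (cm y z) (inv y \<otimes> x \<otimes> y)) = \<one>"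
    using ac x y zc by (simp add: m_assoc)
  have "cm y z \<in> B" using normal_commutator_sym[OF B zc y] AB z y by blast
  then have "cm (cm z x) (inv z \<otimes> y \<otimes> z) \<otimes> cm (cm y z) (inv y \<otimes> x \<otimes> y) \<in> R" (is "?r \<in> R")
    using AB BR z zc x y normal_mult_closed[OF R] by simp
  moreover have "cm (cm x y) a = inv ?r"
    using inv_equality[OF hw] ac x y zc by (simp add: word_simps)
  ultimately have "cm (cm x y) a \<in> R" using normal_inv_closed[OF R] by simp
  then show ?thesis using normal_commutator_sym[OF R] ac x y by simp
qed

section \<open>The lower central series and commutation with its second term\<close>

lemma lower_central_subgroup: "subgroup (lower_central G r) G"
  unfolding lower_central_def by (rule generate_is_subgroup) auto

lemma left_normed_commutator_in_lower_central:
  "length xs = r \<Longrightarrow> set xs \<subseteq> carrier G \<Longrightarrow> left_normed_commutator G xs \<in> lower_central G r"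
  unfolding lower_central_def by (auto intro: generate.incl)

lemma lower_central_subset:
  assumes "subgroup H G"
    and "\<And>xs. length xs = r \<Longrightarrow> set xs \<subseteq> carrier G \<Longrightarrow> left_normed_commutator G xs \<in> H"
  shows "lower_central G r \<subseteq> H"
  unfolding lower_central_def using assms by (intro generate_subgroup_incl) auto

lemma lower_central_2_subset:
  assumes "subgroup H G" and "\<And>x y. x \<in> carrier G \<Longrightarrow> y \<in> carrier G \<Longrightarrow> cm x y \<in> H"
  shows "lower_central G 2 \<subseteq> H"
proof (rule lower_central_subset[OF assms(1)])
  fix xs assume "length xs = 2" "set xs \<subseteq> carrier G"
  then show "left_normed_commutator G xs \<in> H" using assms(2)
    by (auto simp: length_Suc_conv numeral_2_eq_2)
qed

lemma commutator_in_lower_central_2: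
  "x \<in> carrier G \<Longrightarrow> y \<in> carrier G \<Longrightarrow> cm x y \<in> lower_central G 2"
  using left_normed_commutator_in_lower_central[of "[x, y]" 2] by simp

lemma lower_central_subset_2:
  assumes "r \<ge> 2" shows "lower_central G r \<subseteq> lower_central G 2"
proof (rule lower_central_subset[OF lower_central_subgroup])
  fix xs assume xs: "length xs = r" "set xs \<subseteq> carrier G"
  then have "xs \<noteq> []" "butlast xs \<noteq> []" using assms by (cases xs rule: rev_cases; force)+
  then have "left_normed_commutator G xs = cm (left_normed_commutator G (butlast xs)) (last xs)"
    by (metis append_butlast_last_id left_normed_commutator_snoc)
  then show "left_normed_commutator G xs \<in> lower_central G 2"
    using xs \<open>xs \<noteq> []\<close> in_set_butlastD[of _ xs]
    by (auto intro!: commutator_in_lower_central_2 simp: subset_iff)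
qed

text \<open>The elements \<open>w\<close> with \<open>[A, w]\<close> inside \<open>R\<close> form a
  subgroup, so it is enough to treat the generating commutators.\<close>

lemma commutator_lower_central_2_closed:
  assumes R: "R \<lhd> G" and A: "A \<lhd> G" and B: "B \<lhd> G"
    and AB: "\<And>x g. x \<in> A \<Longrightarrow> g \<in> carrier G \<Longrightarrow> cm x g \<in> B"
    and BR: "\<And>x g. x \<in> B \<Longrightarrow> g \<in> carrier G \<Longrightarrow> cm x g \<in> R"
    and a: "a \<in> A" and w: "w \<in> lower_central G 2"
  shows "cm a w \<in> R"
proof -
  have "A \<subseteq> carrier G" using A normal_mem_carrier by blast
  from subgroup_commutator_right[OF R this]
  have "lower_central G 2 \<subseteq> {w \<in> carrier G. \<forall>a\<in>A. cm a w \<in> R}"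
    by (rule lower_central_2_subset) (use commutator_commutator_closed[OF R A B AB BR] in auto)
  then show ?thesis using a w by blast
qed

end

section \<open>Central chains and their upper central preimages\<close>

text \<open>The number \<open>e\<close> counts the steps that a \<open>p\<close>-th power descends.
  The last assumption makes elements of the chain derived elements, and commutation with those
  descends two steps instead of one.\<close>

locale central_chain = group G for G :: "('a, 'b) monoid_scheme" (structure) +
  fixes N :: "nat \<Rightarrow> 'a set" and p e :: nat
  assumes normal_chain: "N i \<lhd> G"
    and commutator_chain: "x \<in> N i \<Longrightarrow> g \<in> carrier G \<Longrightarrow> commutator G x g \<in> N (Suc i)"
    and chain_Suc_subset: "N (Suc i) \<subseteq> N i"
    and pow_chain: "x \<in> N i \<Longrightarrow> x [^] p \<in> N (i + e)"
    and prime_p: "Factorial_Ring.prime p"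
    and exponent_step: "e = 1 \<or> e = 2 \<and> odd p"
    and chain_derived: "N 0 \<subseteq> lower_central G 2"
begin

text \<open>The preimage in \<open>G\<close> of the \<open>s\<close>-th term of the upper central series of \<open>G / N i\<close>.\<close>

primrec upper :: "nat \<Rightarrow> nat \<Rightarrow> 'a set" where
  "upper i 0 = N i"
| "upper i (Suc s) = {g \<in> carrier G. \<forall>x\<in>carrier G. cm g x \<in> upper i s}"

lemma upper_normal: "upper i s \<lhd> G"
  by (induction s) (simp_all add: normal_chain normal_commutator_left)

lemma upper_subgroup: "subgroup (upper i s) G"
  using upper_normal normal_imp_subgroup by blast

lemma upper_carrier: "x \<in> upper i s \<Longrightarrow> x \<in> carrier G"
  using upper_normal normal_mem_carrier by blast

lemmas upper_mult = normal_mult_closed[OF upper_normal]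
lemmas upper_inv = normal_inv_closed[OF upper_normal]
lemmas upper_pow = subgroup_pow_closed[OF upper_subgroup]

lemma upper_SucD: "x \<in> upper i (Suc s) \<Longrightarrow> g \<in> carrier G \<Longrightarrow> cm x g \<in> upper i s"
  by simp

text \<open>One more centralising step absorbs one more step down the chain, since
  \<open>[N i, G]\<close> lies in \<open>N (Suc i)\<close>.\<close>

lemma upper_subset_Suc_Suc: "upper i s \<subseteq> upper (Suc i) (Suc s)"
proof (induction s)
  case 0
  then show ?case using commutator_chain normal_mem_carrier[OF normal_chain] by auto
qed auto

lemma upper_Suc_subset: "upper (Suc i) s \<subseteq> upper i s"
  by (induction s) (use chain_Suc_subset in auto)

lemma upper_antimono: "i \<le> j \<Longrightarrow> upper j s \<subseteq> upper i s"
  by (induction rule: dec_induct) (use upper_Suc_subset in auto)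

lemma chain_antimono: "i \<le> j \<Longrightarrow> N j \<subseteq> N i"
  using upper_antimono[of i j 0] by simp

text \<open>For fixed \<open>s\<close> the subgroups \<open>upper i s\<close> therefore form a
  central chain in \<open>i\<close> again.\<close>

lemma upper_commutator: "x \<in> upper i s \<Longrightarrow> g \<in> carrier G \<Longrightarrow> cm x g \<in> upper (Suc i) s"
  using upper_subset_Suc_Suc upper_SucD by blast

lemma upper_commutator_sym:
  "x \<in> carrier G \<Longrightarrow> y \<in> carrier G \<Longrightarrow> cm x y \<in> upper i s \<Longrightarrow> cm y x \<in> upper i s"
  using normal_commutator_sym[OF upper_normal] .

lemma derived_carrier: "w \<in> lower_central G k \<Longrightarrow> w \<in> carrier G"
  using lower_central_subgroup subgroup.mem_carrier by metis

text \<open>Two descents by one step combine, through the three subgroups lemma, into one descent by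
  two.\<close>

lemma upper_commutator_derived:
  assumes "x \<in> upper i s" "w \<in> lower_central G 2"
  shows "cm x w \<in> upper (i + 2) s"
  by (rule commutator_lower_central_2_closed[OF upper_normal upper_normal upper_normal _ _ assms])
    (use upper_commutator in simp_all)

lemma upper_Suc_commutator_derived:
  assumes "x \<in> upper i (Suc s)" "w \<in> lower_central G 2"
  shows "cm x w \<in> upper (Suc i) s"
  by (rule commutator_lower_central_2_closed[OF upper_normal upper_normal upper_normal _ _ assms])
    (use upper_commutator in auto)

text \<open>The analogue in \<open>G / N i\<close> of the inclusion of
  \<open>[gamma_k, Z_(s+k)]\<close> in \<open>Z_s\<close>. The last entry of \<open>ys\<close> is
  split off with the Hall-Witt identity.\<close>

lemma commutator_left_normed_upper:
  assumes "set ys \<subseteq> carrier G" "ys \<noteq> []" "h \<in> upper i (s + length ys)"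
  shows "cm (left_normed_commutator G ys) h \<in> upper i s"
  using assms
proof (induction ys arbitrary: s h rule: rev_induct)
  case (snoc x ys)
  have hc: "h \<in> carrier G" using snoc.prems upper_carrier by blast
  have x: "x \<in> carrier G" using snoc.prems by simp
  show ?case
  proof (cases "ys = []")
    case True
    then have "cm h x \<in> upper i s" using snoc.prems by simp
    then show ?thesis using True upper_commutator_sym hc x by simp
  next
    case False
    define y where "y = left_normed_commutator G ys"
    have y: "y \<in> carrier G" unfolding y_def using snoc.prems by auto
    \<comment> \<open>Conjugated in advance, so that \<open>inv y \<otimes> z \<otimes> y\<close> is
      \<open>h\<close>.\<close>
    define z where "z = y \<otimes> h \<otimes> inv y"
    have z: "z \<in> upper i (Suc s + length ys)" unfolding z_def
      using normal.inv_op_closed2[OF upper_normal y] snoc.prems by (simp del: upper.simps)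
    have zc: "z \<in> carrier G" using z upper_carrier by blast
    have IH: "cm y k \<in> upper i t" if "k \<in> upper i (t + length ys)" for k t
      unfolding y_def using snoc that False by auto
    have zy: "inv y \<otimes> z \<otimes> y = h" unfolding z_def using y hc by (simp add: word_simps)
    have 1: "cm (cm z y) (inv z \<otimes> x \<otimes> z) \<in> upper i s"
      using upper_SucD[OF upper_commutator_sym[OF y zc IH[OF z]]] x zc by simp
    \<comment> \<open>This takes the conjugation by \<open>x\<close> off the entry \<open>y\<close>,
      so that the induction hypothesis applies to \<open>k\<close>.\<close>
    define k where "k = x \<otimes> cm x z \<otimes> inv x"
    have "cm x z \<in> upper i (s + length ys)"
      using upper_commutator_sym[OF zc x] upper_SucD[of z i "s + length ys" x] z x by (simp del: upper.simps)
    then have k: "k \<in> upper i (s + length ys)" unfolding k_def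
      using normal.inv_op_closed2[OF upper_normal x] by blast
    have kc: "k \<in> carrier G" using k upper_carrier by blast
    have "cm (cm x z) (inv x \<otimes> y \<otimes> x) = inv x \<otimes> cm k y \<otimes> x"
      unfolding k_def using x zc y by (simp add: word_simps)
    moreover have "cm k y \<in> upper i s" using IH[OF k] upper_commutator_sym y kc by blast
    ultimately have 2: "cm (cm x z) (inv x \<otimes> y \<otimes> x) \<in> upper i s"
      using normal_conj_closed[OF upper_normal] x by simp
    have "cm (cm y x) h \<otimes> (cm (cm z y) (inv z \<otimes> x \<otimes> z) \<otimes> cm (cm x z) (inv x \<otimes> y \<otimes> x)) = \<one>"
      using hall_witt[OF y x zc] y x zc hc by (simp add: zy m_assoc)
    from inv_equality[OF this] have "cm (cm y x) h
        = inv (cm (cm z y) (inv z \<otimes> x \<otimes> z) \<otimes> cm (cm x z) (inv x \<otimes> y \<otimes> x))"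
      using x y zc hc by simp
    then have "cm (cm y x) h \<in> upper i s" using upper_inv upper_mult 1 2 by metis
    then show ?thesis using False by (simp add: left_normed_commutator_snoc y_def)
  qed
qed simp

lemma foldl_commutator_upper:
  "x \<in> upper i s \<Longrightarrow> set zs \<subseteq> carrier G \<Longrightarrow> length zs = s \<Longrightarrow> fc x zs \<in> N i"
proof (induction zs arbitrary: x s)
  case (Cons z zs)
  then show ?case using Cons.IH[OF upper_SucD[of x i "length zs" z]] by (simp del: upper.simps)
qed simp

text \<open>For \<open>e = 2\<close> the prime is odd and divides \<open>p choose 2\<close>; for
  \<open>e = 1\<close> no step has to be gained. The premise \<open>pow\<close> is
  \<open>upper_pow_prime\<close> at the same \<open>s\<close>, whose induction calls this
  lemma.\<close>

lemma binomial_pow_upper: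
  assumes "c \<in> upper i s"
    and pow: "\<And>j x. x \<in> upper j s \<Longrightarrow> x [^] p \<in> upper (j + e) s"
  shows "c [^] (p choose 2) \<in> upper (i + e - 1) s"
proof (cases "e = 1")
  case False
  then have e: "e = 2" "odd p" using exponent_step by auto
  then have k: "p choose 2 = p * ((p - 1) div 2)"
    using e by (simp add: choose_two div_mult_swap)
  let ?k = "(p - 1) div 2"
  have "(c [^] p) [^] ?k \<in> upper (i + e) s"
    using upper_pow pow assms(1) by blast
  then show ?thesis using upper_antimono[of "i + e - 1" "i + e" s] assms upper_carrier[OF assms(1)]
    by (auto simp: k nat_pow_pow)
qed (use assms upper_pow in simp)

text \<open>With \<open>w = cm x z\<close>, the commutator \<open>cm (x [^] p) z\<close> is
  congruent to \<open>w [^] p\<close> times the power of \<open>cm w x\<close> with exponent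
  \<open>p choose 2\<close>; both factors lie in \<open>upper (i + e) s\<close>.\<close>

lemma upper_pow_prime: "x \<in> upper i s \<Longrightarrow> x [^] p \<in> upper (i + e) s"
proof (induction s arbitrary: i x)
  case 0
  then show ?case by (simp add: pow_chain)
next
  case (Suc s)
  have xc: "x \<in> carrier G" using Suc.prems upper_carrier by blast
  have "cm (x [^] p) z \<in> upper (i + e) s" if z: "z \<in> carrier G" for z
  proof -
    define w where "w = cm x z"
    have w: "w \<in> upper i s" unfolding w_def using Suc.prems z by (rule upper_SucD)
    have wc: "w \<in> carrier G" using w upper_carrier by blast
    let ?R = "upper (i + e) s"
    have c: "cm w x \<in> upper (Suc i) s" using upper_commutator w xc by blast
    have cc: "cm (cm w x) v \<in> ?R" if "v \<in> carrier G" for v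
      using upper_commutator[OF c that] upper_antimono[of "i + e" "Suc (Suc i)" s] exponent_step by auto
    have cp: "cm w x [^] (p choose 2) \<in> ?R"
      using binomial_pow_upper[OF c] Suc.IH by simp
    have cpc: "cm w x [^] (p choose 2) \<in> carrier G" using wc xc by simp
    have "cm (x [^] p) z = inv (x [^] p) \<otimes> (x \<otimes> w) [^] p"
      unfolding w_def using xc z by (rule commutator_pow_left)
    moreover have "?R #> ((x \<otimes> w) [^] p) = ?R #> (x [^] p \<otimes> w [^] p \<otimes> cm w x [^] (p choose 2))"
      by (rule coset_mult_pow_class_two[OF upper_normal xc wc cc[OF xc] cc[OF wc]])
    moreover have "?R #> (x [^] p \<otimes> w [^] p \<otimes> cm w x [^] (p choose 2)) = ?R #> (x [^] p)"
      using coset_absorb_right[OF upper_normal] Suc.IH[OF w] cp xc wc cpc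
      by (metis m_closed nat_pow_closed)
    ultimately show ?thesis
      using coset_eq_iff[OF upper_normal] xc wc by simp
  qed
  then show ?case using xc by simp
qed

end

section \<open>Commutators with one free entry\<close>

context central_chain
begin

lemmas derived_pow = subgroup_pow_closed[OF lower_central_subgroup]
lemmas derived_inv = subgroup.m_inv_closed[OF lower_central_subgroup]

text \<open>If \<open>a = b \<otimes> r\<close>, then \<open>r\<close> changes \<open>cm a z\<close>
  only by an element with one centralising step less, and the remaining entries of \<open>zs\<close>
  use up the remaining steps.\<close>

lemma foldl_commutator_cong:
  assumes "a \<in> carrier G" "b \<in> carrier G" "set zs \<subseteq> carrier G"
    and "upper i (length zs) #> a = upper i (length zs) #> b"
  shows "N i #> fc a zs = N i #> fc b zs"
  using assms
proof (induction zs arbitrary: a b)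
  case (Cons z zs)
  let ?R = "upper i (length zs)"
  have z: "z \<in> carrier G" using Cons.prems by simp
  have "upper i (Suc (length zs)) #> a = upper i (Suc (length zs)) #> b"
    using Cons.prems by (simp del: upper.simps)
  then obtain r where r: "r \<in> upper i (Suc (length zs))" "a = b \<otimes> r"
    using coset_eqE[OF upper_normal Cons.prems(1,2)] by metis
  have rc: "r \<in> carrier G" using r upper_carrier by blast
  let ?u = "cm b z"
  have u: "?u \<in> carrier G" using z Cons.prems by simp
  have "cm ?u r \<in> ?R" using upper_SucD[OF r(1) u] upper_commutator_sym rc u by blast
  then have "?R #> (inv r \<otimes> ?u \<otimes> r) = ?R #> ?u"
    using coset_conj[OF upper_normal] rc u by blast
  moreover have "cm a z = (inv r \<otimes> ?u \<otimes> r) \<otimes> cm r z"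
    using commutator_mult_left r rc z Cons.prems by metis
  ultimately have "?R #> cm a z = ?R #> ?u"
    using coset_absorb_right[OF upper_normal _ upper_SucD[OF r(1) z]] rc u by simp
  then show ?case using Cons z by simp
qed simp

lemma foldl_commutator_one [simp]: "set zs \<subseteq> carrier G \<Longrightarrow> fc \<one> zs = \<one>"
  by (induction zs) auto

text \<open>Expanding \<open>cm (w \<otimes> x) z\<close> conjugates \<open>cm w z\<close> by
  \<open>x\<close>. As \<open>cm w z\<close> is a derived element, the conjugation is invisible
  modulo \<open>upper (Suc i)\<close>.\<close>

lemma foldl_commutator_mult:
  assumes "w \<in> lower_central G 2" "x \<in> upper i (length zs)" "set zs \<subseteq> carrier G"
  shows "N (Suc i) #> fc (w \<otimes> x) zs = N (Suc i) #> (fc w zs \<otimes> fc x zs)"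
  using assms
proof (induction zs arbitrary: w x)
  case (Cons z zs)
  let ?R = "upper (Suc i) (length zs)"
  have z: "z \<in> carrier G" and zs: "set zs \<subseteq> carrier G" using Cons.prems by auto
  have wc: "w \<in> carrier G" using Cons.prems derived_carrier by blast
  have x: "x \<in> upper i (Suc (length zs))" using Cons.prems by (simp del: upper.simps)
  have xc: "x \<in> carrier G" using x upper_carrier by blast
  let ?u = "cm w z"
  have u: "?u \<in> lower_central G 2" using commutator_in_lower_central_2 wc z by blast
  have uc: "?u \<in> carrier G" using wc z by simp
  have "cm ?u x \<in> ?R" using upper_Suc_commutator_derived[OF x u] upper_commutator_sym xc uc by blast
  then have "?R #> (inv x \<otimes> ?u \<otimes> x) = ?R #> ?u"
    using coset_conj[OF upper_normal] xc uc by blast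
  then have "?R #> cm (w \<otimes> x) z = ?R #> (?u \<otimes> cm x z)"
    unfolding commutator_mult_left[OF wc xc z]
    using xc uc z by (intro coset_mult_cong[OF upper_normal]) auto
  then have "N (Suc i) #> fc (cm (w \<otimes> x) z) zs = N (Suc i) #> fc (?u \<otimes> cm x z) zs"
    using wc xc z uc zs by (intro foldl_commutator_cong) auto
  also have "\<dots> = N (Suc i) #> (fc ?u zs \<otimes> fc (cm x z) zs)"
    using Cons.IH[OF u upper_SucD[OF x z] zs] .
  finally show ?case by simp
qed simp

lemma foldl_commutator_inv:
  assumes "x \<in> lower_central G 2" "x \<in> upper i (length zs)" "set zs \<subseteq> carrier G"
  shows "N (Suc i) #> fc (inv x) zs = N (Suc i) #> inv (fc x zs)"
proof -
  have xc: "x \<in> carrier G" using assms derived_carrier by blast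
  have "N (Suc i) #> \<one> = N (Suc i) #> (fc (inv x) zs \<otimes> fc x zs)"
    using foldl_commutator_mult[OF derived_inv[OF assms(1)] assms(2,3)] xc assms(3) by simp
  then have "N (Suc i) #> (\<one> \<otimes> inv (fc x zs)) = N (Suc i) #> ((fc (inv x) zs \<otimes> fc x zs) \<otimes> inv (fc x zs))"
    using xc assms(3) by (intro coset_mult_cong[OF normal_chain]) auto
  then show ?thesis using xc assms(3) by (simp add: m_assoc)
qed

lemma foldl_commutator_nat_pow:
  assumes "x \<in> lower_central G 2" "x \<in> upper i (length zs)" "set zs \<subseteq> carrier G"
  shows "N (Suc i) #> fc (x [^] (n::nat)) zs = N (Suc i) #> (fc x zs [^] n)"
proof (induction n)
  case (Suc n)
  have xc: "x \<in> carrier G" using assms derived_carrier by blast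
  have "N (Suc i) #> fc (x [^] Suc n) zs = N (Suc i) #> (fc (x [^] n) zs \<otimes> fc x zs)"
    using foldl_commutator_mult[OF derived_pow[OF assms(1)] assms(2,3)] by simp
  also have "\<dots> = N (Suc i) #> (fc x zs [^] n \<otimes> fc x zs)"
    using Suc xc assms(3) by (intro coset_mult_cong[OF normal_chain]) auto
  finally show ?case by simp
qed (use assms in simp)

text \<open>Both sides lie in \<open>N (i + e)\<close>, and the congruence is one step finer. The
  gain comes from \<open>v\<close> being derived: \<open>cm w v\<close> descends two steps, which
  makes its binomial power vanish.\<close>

lemma foldl_commutator_prime_pow:
  assumes "v \<in> lower_central G 2" "v \<in> upper i (length zs)" "set zs \<subseteq> carrier G"
  shows "N (i + e + 1) #> fc (v [^] p) zs = N (i + e + 1) #> (fc v zs [^] p)"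
  using assms
proof (induction zs arbitrary: v)
  case (Cons z zs)
  let ?R = "upper (i + e + 1) (length zs)"
  have z: "z \<in> carrier G" and zs: "set zs \<subseteq> carrier G" using Cons.prems by auto
  have vc: "v \<in> carrier G" using Cons.prems derived_carrier by blast
  have v: "v \<in> upper i (Suc (length zs))" using Cons.prems by (simp del: upper.simps)
  define w where "w = cm v z"
  have w: "w \<in> upper i (length zs)" unfolding w_def using v z by (rule upper_SucD)
  have wc: "w \<in> carrier G" using w upper_carrier by blast
  have wd: "w \<in> lower_central G 2" unfolding w_def using commutator_in_lower_central_2 vc z by blast
  have c: "cm w v \<in> upper (i + 2) (length zs)" using upper_commutator_derived[OF w Cons.prems(1)] .
  have cc: "cm (cm w v) g \<in> ?R" if "g \<in> carrier G" for g
    using upper_commutator[OF c that] upper_antimono[of "i + e + 1" "Suc (i + 2)" "length zs"]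
      exponent_step by auto
  have cp: "cm w v [^] (p choose 2) \<in> ?R"
    using binomial_pow_upper[OF c] upper_pow_prime by simp
  have cpc: "cm w v [^] (p choose 2) \<in> carrier G" using wc vc by simp
  have "cm (v [^] p) z = inv (v [^] p) \<otimes> (v \<otimes> w) [^] p"
    unfolding w_def using vc z by (rule commutator_pow_left)
  moreover have "?R #> ((v \<otimes> w) [^] p) = ?R #> (v [^] p \<otimes> w [^] p \<otimes> cm w v [^] (p choose 2))"
    by (rule coset_mult_pow_class_two[OF upper_normal vc wc cc[OF vc] cc[OF wc]])
  moreover have "\<dots> = ?R #> (v [^] p \<otimes> w [^] p)"
    using coset_absorb_right[OF upper_normal _ cp] vc wc by simp
  ultimately have "?R #> cm (v [^] p) z = ?R #> (inv (v [^] p) \<otimes> (v [^] p \<otimes> w [^] p))"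
    using vc wc coset_mult_cong[OF upper_normal, of "inv (v [^] p)" "(v \<otimes> w) [^] p"
        "inv (v [^] p)" "v [^] p \<otimes> w [^] p"] by simp
  also have "inv (v [^] p) \<otimes> (v [^] p \<otimes> w [^] p) = w [^] p"
    using vc wc by (simp add: mult_inv_cancel)
  finally have "N (i + e + 1) #> fc (cm (v [^] p) z) zs = N (i + e + 1) #> fc (w [^] p) zs"
    using vc wc z zs by (intro foldl_commutator_cong) auto
  also have "\<dots> = N (i + e + 1) #> (fc w zs [^] p)" using Cons.IH[OF wd w zs] .
  finally show ?case by (simp add: w_def)
qed simp

text \<open>A \<open>p\<close>-th power as right entry descends two steps instead of one:
  \<open>u1\<close> lies one step down and its \<open>p\<close>-th power at least one more, while
  \<open>u2\<close> and \<open>u3\<close> are deep enough already.\<close>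

lemma commutator_prime_pow_upper:
  assumes w: "w \<in> upper i s" and k: "k \<in> carrier G"
  shows "cm w (k [^] p) \<in> upper (i + 2) s"
proof -
  let ?R = "upper (i + 2) s"
  define u1 u2 u3 where u: "u1 = cm w k" "u2 = cm u1 k" "u3 = cm u2 k"
  have u1: "u1 \<in> upper (Suc i) s" unfolding u using upper_commutator w k by blast
  have u2: "u2 \<in> ?R" unfolding u using upper_commutator[OF u1 k] by (simp add: u)
  have u3: "u3 \<in> ?R" unfolding u(3) by (rule normal_commutator_closed[OF upper_normal u2 k])
  note uc = u1[THEN upper_carrier] u2[THEN upper_carrier] u3[THEN upper_carrier]
  have n: "cm x y \<in> ?R" "cm y x \<in> ?R" if "x \<in> ?R" "y \<in> carrier G" for x y
    using that normal_commutator_closed[OF upper_normal] upper_commutator_sym upper_carrier by metis+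
  have "?R #> cm w (k [^] p) = ?R #> (u1 [^] p \<otimes> u2 [^] (p choose 2) \<otimes> u3 [^] (p choose 3))"
    by (rule coset_commutator_pow_right[OF upper_normal upper_carrier[OF w] k u])
      (use n u2 u3 uc k in auto)
  moreover have "u1 [^] p \<in> ?R"
    using upper_pow_prime[OF u1] upper_antimono[of "i + 2" "Suc i + e" s] exponent_step by auto
  then have "u1 [^] p \<otimes> u2 [^] (p choose 2) \<otimes> u3 [^] (p choose 3) \<in> ?R"
    using upper_mult upper_pow u2 u3 by metis
  ultimately show ?thesis
    using coset_mem_subgroup[OF upper_normal upper_subgroup] upper_carrier[OF w] k
    by (metis commutator_closed nat_pow_closed order_refl)
qed

end

text \<open>With \<open>ys\<close> nonempty the free entry is always the right argument of a
  commutator. A free first entry is reduced to this case later by swapping the first two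
  entries.\<close>

locale central_chain_slot = central_chain +
  fixes ys zs :: "'a list"
  assumes ys: "set ys \<subseteq> carrier G" "ys \<noteq> []" and zs: "set zs \<subseteq> carrier G"
begin

definition slot :: "'a \<Rightarrow> 'a" where
  "slot g = fc (cm (left_normed_commutator G ys) g) zs"

abbreviation (input) "y \<equiv> left_normed_commutator G ys"
abbreviation (input) "s \<equiv> length zs"
abbreviation (input) "level i \<equiv> upper i (length zs + length ys)"

lemma left_normed_commutator_append:
  "left_normed_commutator G (ys @ g # us) = fc (cm y g) us"
  using ys(2) by (cases ys) auto

lemma slot_eq: "left_normed_commutator G (ys @ g # zs) = slot g"
  by (simp add: slot_def left_normed_commutator_append)

lemma y_closed: "y \<in> carrier G" using ys by auto

lemma slot_closed: "g \<in> carrier G \<Longrightarrow> slot g \<in> carrier G"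
  unfolding slot_def using y_closed zs by auto

lemma commutator_level: "h \<in> level i \<Longrightarrow> cm y h \<in> upper i s"
  using commutator_left_normed_upper[OF ys] .

lemma slot_in_chain: "h \<in> level i \<Longrightarrow> slot h \<in> N i"
  unfolding slot_def using foldl_commutator_upper[OF commutator_level zs] by simp

text \<open>Only \<open>h\<close> has a level while \<open>g\<close> is arbitrary; this lets an
  approximate solution \<open>g\<close> be corrected by \<open>h\<close>. The list
  \<open>ys @ [g]\<close> is one entry longer and \<open>h\<close> has one more centralising step
  modulo \<open>N (Suc i)\<close>, so \<open>cm (cm y g) h\<close> is negligible.\<close>

lemma slot_mult:
  assumes g: "g \<in> carrier G" and h: "h \<in> level i"
  shows "N (Suc i) #> slot (g \<otimes> h) = N (Suc i) #> (slot g \<otimes> slot h)"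
proof -
  let ?R = "upper (Suc i) s"
  have hc: "h \<in> carrier G" using h upper_carrier by blast
  let ?g = "cm y g" and ?h = "cm y h"
  have gc: "?g \<in> carrier G" "?h \<in> carrier G" using g hc y_closed by auto
  have h': "?h \<in> upper i s" using commutator_level[OF h] .
  have "cm (left_normed_commutator G (ys @ [g])) h \<in> ?R"
    by (rule commutator_left_normed_upper)
      (use g ys(1) upper_subset_Suc_Suc h in \<open>auto simp del: upper.simps\<close>)
  then have "cm ?g h \<in> ?R" using ys(2) by (simp add: left_normed_commutator_snoc)
  then have "?R #> (inv h \<otimes> ?g \<otimes> h) = ?R #> ?g"
    using coset_conj[OF upper_normal] gc hc by blast
  then have "?R #> cm y (g \<otimes> h) = ?R #> (?h \<otimes> ?g)"
    unfolding commutator_mult_right[OF y_closed g hc]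
    using gc hc by (intro coset_mult_cong[OF upper_normal]) auto
  also have "\<dots> = ?R #> (?g \<otimes> ?h)"
    by (rule coset_commute[OF upper_normal gc(2,1) upper_commutator[OF h' gc(1)]])
  finally have "N (Suc i) #> slot (g \<otimes> h) = N (Suc i) #> fc (?g \<otimes> ?h) zs"
    unfolding slot_def using g hc y_closed zs gc by (intro foldl_commutator_cong) auto
  also have "\<dots> = N (Suc i) #> (fc ?g zs \<otimes> fc ?h zs)"
    by (rule foldl_commutator_mult[OF commutator_in_lower_central_2[OF y_closed g] h' zs])
  finally show ?thesis by (simp add: slot_def)
qed

lemma slot_one [simp]: "slot \<one> = \<one>"
  unfolding slot_def using y_closed zs by simp

text \<open>The \<open>p\<close>-th power of the entry matches the \<open>p\<close>-th power of the
  value, precisely enough to carry a covering of \<open>N i\<close> modulo \<open>N (Suc i)\<close>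
  over to \<open>N (i + e)\<close> modulo \<open>N (i + e + 1)\<close>.\<close>

definition good :: "nat \<Rightarrow> 'a \<Rightarrow> bool" where
  "good i h \<longleftrightarrow> N (i + e + 1) #> slot (h [^] p) = N (i + e + 1) #> (slot h [^] p)"

text \<open>Here \<open>x\<close> is the correction left over in \<open>cm y (h [^] p)\<close>; once
  the entries of \<open>zs\<close> kill it, only the \<open>p\<close>-th power of
  \<open>cm y h\<close> contributes.\<close>

lemma goodI:
  assumes h: "h \<in> level i" and x: "x \<in> lower_central G 2" "x \<in> upper (i + e) s"
    and eq: "upper (i + e + 1) s #> cm y (h [^] p) = upper (i + e + 1) s #> (cm y h [^] p \<otimes> x)"
    and fx: "fc x zs \<in> N (i + e + 1)"
  shows "good i h"
proof -
  have hc: "h \<in> carrier G" using h upper_carrier by blast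
  have xc: "x \<in> carrier G" using x upper_carrier by blast
  have u: "cm y h \<in> lower_central G 2" using commutator_in_lower_central_2 y_closed hc by blast
  have uc: "cm y h \<in> carrier G" using y_closed hc by simp
  let ?M = "N (i + e + 1)"
  have "?M #> slot (h [^] p) = ?M #> fc (cm y h [^] p \<otimes> x) zs"
    unfolding slot_def using eq hc y_closed zs xc by (intro foldl_commutator_cong) auto
  also have "\<dots> = ?M #> (fc (cm y h [^] p) zs \<otimes> fc x zs)"
    using foldl_commutator_mult[OF derived_pow[OF u] x(2) zs] by simp
  also have "\<dots> = ?M #> fc (cm y h [^] p) zs"
    using coset_absorb_right[OF normal_chain _ fx] uc zs by auto
  also have "\<dots> = ?M #> (slot h [^] p)"
    unfolding slot_def by (rule foldl_commutator_prime_pow[OF u commutator_level[OF h] zs])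
  finally show ?thesis by (simp add: good_def)
qed

text \<open>Each commutation with \<open>h\<close> descends one step and
  \<open>e + 1 \<le> 3\<close>, so the expansion may stop after \<open>u3\<close>. The factors
  commute modulo this subgroup since they are derived elements.\<close>

lemma slot_expansion:
  assumes h: "h \<in> level i" and u: "u1 = cm y h" "u2 = cm u1 h" "u3 = cm u2 h"
  shows "upper (i + e + 1) s #> cm y (h [^] (n::nat))
      = upper (i + e + 1) s #> (u1 [^] n \<otimes> u2 [^] (n choose 2) \<otimes> u3 [^] (n choose 3))"
    and "u1 \<in> upper i s" "u2 \<in> upper (i + 1) s" "u3 \<in> upper (i + 2) s"
    and "u1 \<in> lower_central G 2" "u2 \<in> lower_central G 2" "u3 \<in> lower_central G 2"
proof -
  let ?R = "upper (i + e + 1) s"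
  have hc: "h \<in> carrier G" using h upper_carrier by blast
  show u1: "u1 \<in> upper i s" unfolding u using commutator_level[OF h] .
  show u2: "u2 \<in> upper (i + 1) s" unfolding u(2) using upper_commutator[OF u1 hc] by simp
  show u3: "u3 \<in> upper (i + 2) s" unfolding u(3) using upper_commutator[OF u2 hc] by simp
  note uc = u1[THEN upper_carrier] u2[THEN upper_carrier] u3[THEN upper_carrier]
  show d: "u1 \<in> lower_central G 2" "u2 \<in> lower_central G 2" "u3 \<in> lower_central G 2"
    using u uc hc y_closed commutator_in_lower_central_2 by auto
  have le: "upper j s \<subseteq> ?R" if "j \<ge> i + 3" for j
    using upper_antimono[of "i + e + 1" j s] that exponent_step by auto
  have "cm u3 h \<in> ?R" using upper_commutator[OF u3 hc] le[of "Suc (i + 2)"] by auto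
  moreover have "cm u2 u1 \<in> ?R" "cm u3 u1 \<in> ?R" "cm u3 u2 \<in> ?R"
    using upper_commutator_derived[OF u2 d(1)] upper_commutator_derived[OF u3 d(1)]
      upper_commutator_derived[OF u3 d(2)] le[of "i + 1 + 2"] le[of "i + 2 + 2"] by auto
  ultimately show "?R #> cm y (h [^] (n::nat))
      = ?R #> (u1 [^] n \<otimes> u2 [^] (n choose 2) \<otimes> u3 [^] (n choose 3))"
    using uc upper_commutator_sym
    by (intro coset_commutator_pow_right[OF upper_normal y_closed hc u]) auto
qed

text \<open>An odd \<open>p\<close> divides \<open>p choose 2\<close>, which removes
  \<open>u2\<close>. As \<open>p choose 3\<close> is \<open>1\<close> for \<open>p = 3\<close>, the
  contribution of \<open>u3\<close> is removed by \<open>fu\<close>, uniformly in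
  \<open>p\<close>.\<close>

lemma good_odd:
  assumes p: "odd p" and h: "h \<in> level i"
    and fu: "fc (cm (cm (cm y h) h) h) zs \<in> N (i + e + 1)"
  shows "good i h"
proof -
  define u1 u2 u3 where u: "u1 = cm y h" "u2 = cm u1 h" "u3 = cm u2 h"
  note X = slot_expansion[OF h u]
  let ?R = "upper (i + e + 1) s"
  note uc = X(2-4)[THEN upper_carrier]
  have k: "p choose 2 = p * ((p - 1) div 2)"
    using p by (simp add: choose_two div_mult_swap)
  have "u2 [^] p \<in> ?R" using upper_pow_prime[OF X(3)] by simp
  then have u2R: "u2 [^] (p choose 2) \<in> ?R"
    unfolding k using upper_pow uc by (metis nat_pow_pow)
  have u3e: "u3 \<in> upper (i + e) s"
    using X(4) upper_antimono[of "i + e" "i + 2" s] exponent_step by auto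
  let ?x = "u3 [^] (p choose 3)"
  have eq: "?R #> cm y (h [^] p) = ?R #> (u1 [^] p \<otimes> ?x)"
  proof -
    have "?R #> (u1 [^] p \<otimes> u2 [^] (p choose 2)) = ?R #> (u1 [^] p)"
      using coset_absorb_right[OF upper_normal _ u2R] uc by simp
    then have "?R #> (u1 [^] p \<otimes> u2 [^] (p choose 2) \<otimes> ?x) = ?R #> (u1 [^] p \<otimes> ?x)"
      using uc by (intro coset_mult_cong[OF upper_normal]) auto
    then show ?thesis using X(1) by simp
  qed
  have "N (i + e + 1) #> fc ?x zs = N (i + e + 1) #> (fc u3 zs [^] (p choose 3))"
    using foldl_commutator_nat_pow[OF X(7) u3e zs] by simp
  moreover have "fc u3 zs [^] (p choose 3) \<in> N (i + e + 1)"
    using fu subgroup_pow_closed[OF normal_imp_subgroup[OF normal_chain]] by (simp add: u)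
  ultimately have "fc ?x zs \<in> N (i + e + 1)"
    using coset_mem_subgroup[OF normal_chain normal_imp_subgroup[OF normal_chain]] uc zs
    by (metis foldl_commutator_closed nat_pow_closed order_refl)
  then show ?thesis
    using goodI[OF h derived_pow[OF X(7)] upper_pow[OF u3e]] eq by (simp add: u)
qed

text \<open>For \<open>p = 2\<close> the exponents of \<open>u2\<close> and \<open>u3\<close> are
  \<open>1\<close> and \<open>0\<close>, and \<open>e\<close> is \<open>1\<close>.\<close>

lemma good_two:
  assumes p: "p = 2" and h: "h \<in> level i"
    and fu: "fc (cm (cm y h) h) zs \<in> N (i + 2)"
  shows "good i h"
proof -
  define u1 u2 u3 where u: "u1 = cm y h" "u2 = cm u1 h" "u3 = cm u2 h"
  note X = slot_expansion[OF h u]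
  have e: "e = 1" using exponent_step p by auto
  note uc = X(2-4)[THEN upper_carrier]
  have "upper (i + e + 1) s #> cm y (h [^] p) = upper (i + e + 1) s #> (u1 [^] p \<otimes> u2)"
    using X(1)[of 2] uc by (simp add: p binomial_eq_0)
  then show ?thesis
    using goodI[OF h X(6)] X(3) fu e by (simp add: u)
qed

text \<open>Commutation with a \<open>p\<close>-th power descends two steps, which kills the
  correction. Hence goodness has to be arranged only on the first \<open>e\<close> levels.\<close>

lemma good_prime_pow:
  assumes h: "k [^] p \<in> level i" and k: "k \<in> carrier G"
  shows "good i (k [^] p)"
proof -
  let ?h = "k [^] p"
  have hc: "?h \<in> carrier G" using k by simp
  note u1 = commutator_level[OF h]
  show ?thesis
  proof (cases "odd p")
    case True
    have "cm (cm (cm y ?h) ?h) ?h \<in> upper (Suc i + 2) s"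
      by (intro commutator_prime_pow_upper upper_commutator u1 hc k)
    then have "fc (cm (cm (cm y ?h) ?h) ?h) zs \<in> N (Suc i + 2)"
      using foldl_commutator_upper zs by blast
    moreover have "N (Suc i + 2) \<subseteq> N (i + e + 1)"
      by (rule chain_antimono) (use exponent_step in auto)
    ultimately show ?thesis using good_odd[OF True h] by blast
  next
    case False
    then have p: "p = 2" using prime_p primes_dvd_imp_eq two_is_prime_nat by metis
    have "cm (cm y ?h) ?h \<in> upper (i + 2) s"
      by (intro commutator_prime_pow_upper u1 k)
    then show ?thesis using good_two[OF p h] foldl_commutator_upper zs by blast
  qed
qed

text \<open>The second and the third commutation with \<open>h\<close> descend two steps
  each.\<close>

lemma good_derived:
  assumes p: "odd p" and h: "h \<in> level i" "h \<in> lower_central G 2"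
  shows "good i h"
proof (rule good_odd[OF p h(1)])
  have "cm (cm (cm y h) h) h \<in> upper (i + 2 + 2) s"
    by (intro upper_commutator_derived commutator_level h)
  then have "fc (cm (cm (cm y h) h) h) zs \<in> N (i + 2 + 2)"
    using foldl_commutator_upper zs by blast
  moreover have "N (i + 2 + 2) \<subseteq> N (i + e + 1)"
    by (rule chain_antimono) (use exponent_step in auto)
  ultimately show "fc (cm (cm (cm y h) h) h) zs \<in> N (i + e + 1)" by blast
qed

lemma good_odd_step_one:
  assumes p: "odd p" and e: "e = 1" and h: "h \<in> level i"
  shows "good i h"
proof (rule good_odd[OF p h])
  have hc: "h \<in> carrier G" using h upper_carrier by blast
  have "cm (cm (cm y h) h) h \<in> upper (Suc (Suc i)) s"
    by (intro upper_commutator commutator_level h hc)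
  then show "fc (cm (cm (cm y h) h) h) zs \<in> N (i + e + 1)"
    using foldl_commutator_upper[of _ "Suc (Suc i)", OF _ zs] by (simp add: e)
qed

text \<open>With \<open>a = b \<otimes> t\<close>, both \<open>t [^] p\<close> and
  \<open>cm t b\<close> lie in \<open>N (i + e + 1)\<close>, the latter because \<open>b\<close> is
  a derived element.\<close>

lemma chain_pow_cong:
  assumes a: "a \<in> N i" and b: "b \<in> N i" and eq: "N (Suc i) #> a = N (Suc i) #> b"
  shows "N (i + e + 1) #> (a [^] p) = N (i + e + 1) #> (b [^] p)"
proof -
  let ?M = "N (i + e + 1)"
  have c: "a \<in> carrier G" "b \<in> carrier G"
    using a b normal_mem_carrier[OF normal_chain] by auto
  obtain t where t: "t \<in> N (Suc i)" "a = b \<otimes> t" using coset_eqE[OF normal_chain c eq] .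
  have tc: "t \<in> carrier G" using t normal_mem_carrier[OF normal_chain] by auto
  have "b \<in> lower_central G 2" using b chain_antimono[of 0 i] chain_derived by auto
  then have "cm t b \<in> N (Suc i + 2)"
    using upper_commutator_derived[of t "Suc i" 0 b] t(1) by simp
  then have tb: "cm t b \<in> ?M" using chain_antimono[of "i + e + 1" "Suc i + 2"] exponent_step by auto
  note n = normal_commutator_closed[OF normal_chain tb]
  have tp: "t [^] p \<in> ?M" using pow_chain[OF t(1)] by simp
  have "?M #> (a [^] p) = ?M #> (b [^] p \<otimes> t [^] p \<otimes> cm t b [^] (p choose 2))"
    unfolding t(2) by (rule coset_mult_pow_class_two[OF normal_chain c(2) tc n[OF c(2)] n[OF tc]])
  also have "\<dots> = ?M #> (b [^] p \<otimes> t [^] p)"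
    using coset_absorb_right[OF normal_chain] subgroup_pow_closed[OF normal_imp_subgroup[OF normal_chain] tb] c tc
    by simp
  also have "\<dots> = ?M #> (b [^] p)"
    using coset_absorb_right[OF normal_chain _ tp] c by simp
  finally show ?thesis .
qed

text \<open>First every quotient of the chain is covered: an element of \<open>N (j + e)\<close> is
  congruent to some \<open>m [^] p\<close>, and if \<open>h\<close> has value \<open>m\<close>
  modulo \<open>N (Suc j)\<close> and is good, then \<open>h [^] p\<close> takes the required value.
  Then \<open>n\<close> is approximated modulo \<open>N k\<close> for growing \<open>k\<close>, up
  to the trivial term.\<close>

theorem slot_surjective:
  assumes base: "\<And>i n. i < e \<Longrightarrow> n \<in> N i \<Longrightarrow> \<exists>h\<in>level i. N (Suc i) #> slot h = N (Suc i) #> n \<and> good i h"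
    and pow: "\<And>i n. n \<in> N (i + e) \<Longrightarrow> \<exists>m\<in>N i. N (i + e + 1) #> n = N (i + e + 1) #> (m [^] p)"
    and triv: "N l = {\<one>}" and n: "n \<in> N 0"
  shows "\<exists>g\<in>carrier G. slot g = n"
proof -
  have step: "\<exists>h\<in>level i. N (Suc i) #> slot h = N (Suc i) #> n \<and> good i h" if "n \<in> N i" for i n
    using that
  proof (induction i arbitrary: n rule: less_induct)
    case (less i)
    show ?case
    proof (cases "i < e")
      case False
      define j where "j = i - e"
      have i: "i = j + e" and "j < i" using False exponent_step by (auto simp: j_def)
      obtain m where m: "m \<in> N j" "N (j + e + 1) #> n = N (j + e + 1) #> (m [^] p)"
        using pow less.prems unfolding i by blast
      obtain h where h: "h \<in> level j" "N (Suc j) #> slot h = N (Suc j) #> m" "good j h"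
        using less.IH[OF \<open>j < i\<close> m(1)] by blast
      have "N (j + e + 1) #> slot (h [^] p) = N (j + e + 1) #> (slot h [^] p)"
        using h(3) by (simp add: good_def)
      also have "\<dots> = N (j + e + 1) #> (m [^] p)"
        by (rule chain_pow_cong[OF slot_in_chain[OF h(1)] m(1) h(2)])
      finally have "N (Suc i) #> slot (h [^] p) = N (Suc i) #> n" using m by (simp add: i)
      moreover have "h [^] p \<in> level i" unfolding i using upper_pow_prime[OF h(1)] .
      ultimately show ?thesis using good_prime_pow upper_carrier[OF h(1)] by blast
    qed (use base less.prems in blast)
  qed
  have "\<exists>g\<in>carrier G. N k #> slot g = N k #> n" for k
  proof (induction k)
    case 0
    have "N 0 #> slot \<one> = N 0 #> n"
      using n normal_mem_carrier[OF normal_chain n] coset_eq_iff[OF normal_chain, of \<one> n]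
        normal_inv_closed[OF normal_chain n] by simp
    then show ?case by blast
  next
    case (Suc k)
    then obtain g where g: "g \<in> carrier G" "N k #> slot g = N k #> n" by blast
    have c: "slot g \<in> carrier G" "n \<in> carrier G"
      using g slot_closed n normal_mem_carrier[OF normal_chain] by auto
    \<comment> \<open>The error lies in \<open>N k\<close>, so an entry of level \<open>k\<close>
      has it as value modulo \<open>N (Suc k)\<close>; multiplying \<open>g\<close> by that entry
      improves the approximation by one step.\<close>
    have "inv (slot g) \<otimes> n \<in> N k" using g(2) coset_eq_iff[OF normal_chain c(2,1)] by metis
    then obtain h where h: "h \<in> level k" "N (Suc k) #> slot h = N (Suc k) #> (inv (slot g) \<otimes> n)"
      using step by blast
    have hc: "h \<in> carrier G" using h upper_carrier by blast
    have "N (Suc k) #> slot (g \<otimes> h) = N (Suc k) #> (slot g \<otimes> slot h)"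
      by (rule slot_mult[OF g(1) h(1)])
    also have "\<dots> = N (Suc k) #> (slot g \<otimes> (inv (slot g) \<otimes> n))"
      using h c hc slot_closed by (intro coset_mult_cong[OF normal_chain]) auto
    also have "slot g \<otimes> (inv (slot g) \<otimes> n) = n" using c by (simp add: mult_inv_cancel)
    finally show ?case using g hc by (intro bexI[of _ "g \<otimes> h"]) auto
  qed
  then obtain g where g: "g \<in> carrier G" "N l #> slot g = N l #> n" by blast
  have c: "slot g \<in> carrier G" "n \<in> carrier G"
    using g slot_closed n normal_mem_carrier[OF normal_chain] by auto
  have "inv n \<otimes> slot g = \<one>" using coset_eq_iff[OF normal_chain c] g(2) triv by (metis singletonD)
  then have "slot g = n" using c by (metis inv_closed inv_inv inv_equality)
  then show ?thesis using g by blast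
qed

end

section \<open>Maximal positions for the free entry\<close>

text \<open>For subgroups \<open>B \<le> A\<close> of a finite \<open>p\<close>-group this means
  index at most \<open>p\<close>. Stated through subgroups, it transfers easily along
  homomorphisms.\<close>

definition (in group) no_intermediate :: "'a set \<Rightarrow> 'a set \<Rightarrow> bool" where
  "no_intermediate B A \<longleftrightarrow> (\<forall>K. subgroup K G \<longrightarrow> B \<subseteq> K \<longrightarrow> K \<subseteq> A \<longrightarrow> K = B \<or> K = A)"

context central_chain
begin

lemma chain_carrier: "x \<in> N i \<Longrightarrow> x \<in> carrier G"
  using normal_mem_carrier[OF normal_chain] .

lemmas chain_subgroup = normal_imp_subgroup[OF normal_chain]

lemma upperI:
  assumes "g \<in> carrier G"
    and "\<And>zs. length zs = s \<Longrightarrow> set zs \<subseteq> carrier G \<Longrightarrow> fc g zs \<in> N i"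
  shows "g \<in> upper i s"
  using assms
proof (induction s arbitrary: g)
  case (Suc s)
  have "cm g x \<in> upper i s" if x: "x \<in> carrier G" for x
  proof (rule Suc.IH)
    show "fc (cm g x) zs \<in> N i" if "length zs = s" "set zs \<subseteq> carrier G" for zs
      using Suc.prems(2)[of "x # zs"] that x by simp
  qed (use x Suc.prems in simp)
  then show ?case using Suc.prems by simp
qed (use assms(2)[of "[]"] in simp)

lemma coset_chain_mem_iff:
  assumes "x \<in> carrier G" "y \<in> carrier G" "N i #> x = N i #> y"
  shows "x \<in> N i \<longleftrightarrow> y \<in> N i"
  using assms coset_mem_subgroup[OF normal_chain chain_subgroup order_refl] by metis

end

context central_chain_slot
begin

lemma slot_inv:
  assumes h: "h \<in> level i"
  shows "N (Suc i) #> slot (inv h) = N (Suc i) #> inv (slot h)"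
proof -
  have c: "h \<in> carrier G" using h upper_carrier by blast
  have "N (Suc i) #> \<one> = N (Suc i) #> (slot (inv h) \<otimes> slot h)"
    using slot_mult[OF inv_closed[OF c] h] c by simp
  then have "N (Suc i) #> (\<one> \<otimes> inv (slot h)) = N (Suc i) #> ((slot (inv h) \<otimes> slot h) \<otimes> inv (slot h))"
    using c slot_closed by (intro coset_mult_cong[OF normal_chain]) auto
  then show ?thesis using c slot_closed by (simp add: m_assoc)
qed

lemma slot_image_subgroup:
  assumes H: "subgroup H G" "H \<subseteq> level i"
  shows "subgroup {n \<in> N i. \<exists>h\<in>H. N (Suc i) #> slot h = N (Suc i) #> n} G" (is "subgroup ?K G")
proof (rule subgroupI)
  show "?K \<subseteq> carrier G" using chain_carrier by auto
  show "?K \<noteq> {}" using subgroup.one_closed[OF H(1)] normal_one_closed[OF normal_chain] slot_one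
    by (metis (mono_tags, lifting) empty_iff mem_Collect_eq)
next
  fix n assume "n \<in> ?K"
  then obtain h where h: "n \<in> N i" "h \<in> H" "N (Suc i) #> slot h = N (Suc i) #> n" by blast
  have c: "h \<in> carrier G" "n \<in> carrier G" using h H upper_carrier chain_carrier by blast+
  have "N (Suc i) #> slot (inv h) = N (Suc i) #> inv n"
    using slot_inv h H(2) coset_inv_cong[OF normal_chain] c slot_closed by (metis subsetD)
  then show "inv n \<in> ?K"
    using h subgroup.m_inv_closed[OF H(1)] normal_inv_closed[OF normal_chain] by blast
next
  fix n m assume "n \<in> ?K" "m \<in> ?K"
  then obtain h k where h: "n \<in> N i" "h \<in> H" "N (Suc i) #> slot h = N (Suc i) #> n"
    and k: "m \<in> N i" "k \<in> H" "N (Suc i) #> slot k = N (Suc i) #> m" by blast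
  have c: "h \<in> carrier G" "n \<in> carrier G" "k \<in> carrier G" "m \<in> carrier G"
    using h k H upper_carrier chain_carrier by blast+
  have "N (Suc i) #> slot (h \<otimes> k) = N (Suc i) #> (slot h \<otimes> slot k)"
    using slot_mult c k H(2) by blast
  also have "\<dots> = N (Suc i) #> (n \<otimes> m)"
    using h k c slot_closed by (intro coset_mult_cong[OF normal_chain]) auto
  finally show "n \<otimes> m \<in> ?K"
    using h k subgroup.m_closed[OF H(1)] normal_mult_closed[OF normal_chain] by blast
qed

text \<open>The values on \<open>H\<close> form a subgroup modulo \<open>N (Suc i)\<close>, so a
  single value outside \<open>N (Suc i)\<close> forces all of \<open>N i\<close>.\<close>

lemma slot_cover:
  assumes H: "subgroup H G" "H \<subseteq> level i" and min: "no_intermediate (N (Suc i)) (N i)"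
    and h: "h \<in> H" "slot h \<notin> N (Suc i)" and n: "n \<in> N i"
  shows "\<exists>h\<in>H. N (Suc i) #> slot h = N (Suc i) #> n"
proof -
  let ?K = "{n \<in> N i. \<exists>h\<in>H. N (Suc i) #> slot h = N (Suc i) #> n}"
  have "N (Suc i) \<subseteq> ?K"
  proof
    fix m assume m: "m \<in> N (Suc i)"
    have "N (Suc i) #> slot \<one> = N (Suc i) #> m"
      using m chain_carrier coset_eq_iff[OF normal_chain, of \<one> m] normal_inv_closed[OF normal_chain m] by simp
    then show "m \<in> ?K" using m chain_Suc_subset subgroup.one_closed[OF H(1)] by blast
  qed
  moreover have "slot h \<in> ?K" using h(1) H(2) slot_in_chain by blast
  moreover have "subgroup ?K G" by (rule slot_image_subgroup[OF H])
  ultimately have "?K = N i" using min h(2) unfolding no_intermediate_def by blast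
  then show ?thesis using n by blast
qed

end

section \<open>Commutators with \<open>r\<close> entries modulo \<open>N 1\<close>\<close>

locale central_chain_commutators = central_chain +
  fixes r :: nat
  assumes r: "r \<ge> 2" and chain_0: "N 0 = lower_central G r"
begin

lemma value_in_chain: "length ws = r \<Longrightarrow> set ws \<subseteq> carrier G \<Longrightarrow> left_normed_commutator G ws \<in> N 0"
  using left_normed_commutator_in_lower_central chain_0 by auto

text \<open>Consequently every element of \<open>G\<close> has level \<open>0\<close> as soon as the
  other entries number \<open>r - 1\<close>.\<close>

lemma carrier_upper: "g \<in> carrier G \<Longrightarrow> g \<in> upper 0 (r - 1)"
proof (rule upperI)
  fix zs assume "g \<in> carrier G" "length zs = r - 1" "set zs \<subseteq> carrier G"
  then show "fc g zs \<in> N 0" using value_in_chain[of "g # zs"] r by simp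
qed

text \<open>The kernel of the homomorphism from \<open>G\<close> to \<open>N 0 / N 1\<close> given
  by one free entry.\<close>

lemma value_subgroup:
  assumes "set ys \<subseteq> carrier G" "ys \<noteq> []" "set zs \<subseteq> carrier G" "length ys + length zs + 1 = r"
  shows "subgroup {g \<in> carrier G. left_normed_commutator G (ys @ g # zs) \<in> N 1} G"
proof -
  interpret central_chain_slot G N p e ys zs by unfold_locales (use assms in auto)
  have level: "g \<in> level 0" if "g \<in> carrier G" for g
    using carrier_upper[OF that] assms(4) by (simp add: add.commute flip: assms(4))
  show ?thesis unfolding slot_eq
  proof (rule subgroupI)
    show "{g \<in> carrier G. slot g \<in> N 1} \<noteq> {}"
      using normal_one_closed[OF normal_chain] slot_one one_closed by (metis (mono_tags, lifting) empty_iff mem_Collect_eq)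
    fix g assume g: "g \<in> {g \<in> carrier G. slot g \<in> N 1}"
    have "slot (inv g) \<in> N 1 \<longleftrightarrow> inv (slot g) \<in> N 1"
      by (rule coset_chain_mem_iff) (use g slot_inv[OF level] slot_closed in auto)
    then show "inv g \<in> {g \<in> carrier G. slot g \<in> N 1}" using g normal_inv_closed[OF normal_chain] by auto
    fix h assume h: "h \<in> {g \<in> carrier G. slot g \<in> N 1}"
    have "slot (g \<otimes> h) \<in> N 1 \<longleftrightarrow> slot g \<otimes> slot h \<in> N 1"
      by (rule coset_chain_mem_iff) (use g h slot_mult[OF _ level] slot_closed in auto)
    then show "g \<otimes> h \<in> {g \<in> carrier G. slot g \<in> N 1}" using g h normal_mult_closed[OF normal_chain] by auto
  qed auto
qed

text \<open>Inverting the inner commutator \<open>cm y x\<close> inverts the whole value modulo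
  \<open>N 1\<close>.\<close>

lemma value_swap:
  assumes "x \<in> carrier G" "y \<in> carrier G" "set zs \<subseteq> carrier G" "length zs + 2 = r"
  shows "N 1 #> left_normed_commutator G (x # y # zs) = N 1 #> inv (left_normed_commutator G (y # x # zs))"
proof -
  have d: "cm y x \<in> lower_central G 2" using assms commutator_in_lower_central_2 by blast
  have "cm y x \<in> upper 0 (length zs)"
    using carrier_upper[OF assms(2)] assms(1,4) upper_SucD[of y 0 "length zs" x] r
    by (simp add: assms(4)[symmetric] del: upper.simps)
  from foldl_commutator_inv[OF d this assms(3)] show ?thesis using assms by (simp add: inv_commutator)
qed

lemma value_swap_mem:
  assumes "x \<in> carrier G" "y \<in> carrier G" "set zs \<subseteq> carrier G" "length zs + 2 = r"
  shows "left_normed_commutator G (x # y # zs) \<in> N 1 \<longleftrightarrow> left_normed_commutator G (y # x # zs) \<in> N 1"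
proof -
  have "left_normed_commutator G (x # y # zs) \<in> N 1 \<longleftrightarrow> inv (left_normed_commutator G (y # x # zs)) \<in> N 1"
    by (rule coset_chain_mem_iff[OF _ _ value_swap[OF assms]]) (use assms in auto)
  also have "\<dots> \<longleftrightarrow> left_normed_commutator G (y # x # zs) \<in> N 1"
    using normal_inv_closed[OF normal_chain] assms
    by (metis foldl_commutator_closed inv_inv left_normed_commutator.simps(2) set_ConsD subsetI insert_subset list.simps(15))
  finally show ?thesis .
qed

end

section \<open>The centralizer of \<open>N 0 / N 2\<close> and entries taken from it\<close>

locale central_chain_position = central_chain_commutators +
  assumes chain_1: "N 1 \<noteq> N 0"
    and min_0: "no_intermediate (N 1) (N 0)" and min_1: "no_intermediate (N 2) (N 1)"
begin

definition C :: "'a set" where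
  "C = {g \<in> carrier G. \<forall>n\<in>N 0. cm n g \<in> N 2}"

lemma C_subgroup: "subgroup C G"
  unfolding C_def by (rule subgroup_commutator_right[OF normal_chain]) (use chain_carrier in auto)

lemma C_carrier: "g \<in> C \<Longrightarrow> g \<in> carrier G"
  unfolding C_def by simp

lemma commutator_C: "n \<in> N 0 \<Longrightarrow> g \<in> C \<Longrightarrow> cm n g \<in> N 2"
  unfolding C_def by simp

lemma commutator_0: "n \<in> N 0 \<Longrightarrow> g \<in> carrier G \<Longrightarrow> cm n g \<in> N 1"
  and commutator_1: "n \<in> N 1 \<Longrightarrow> g \<in> carrier G \<Longrightarrow> cm n g \<in> N 2"
  using commutator_chain[of n 0 g] commutator_chain[of n 1 g] by (simp_all add: numeral_2_eq_2)

text \<open>\<open>N 0\<close> is generated by \<open>N 1\<close> and any \<open>n\<close> outside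
  it, and \<open>[N 1, G]\<close> lies in \<open>N 2\<close>, so one such \<open>n\<close> decides
  membership.\<close>

lemma mem_C_iff:
  assumes n: "n \<in> N 0" "n \<notin> N 1" and g: "g \<in> carrier G"
  shows "g \<in> C \<longleftrightarrow> cm n g \<in> N 2"
proof
  assume ng: "cm n g \<in> N 2"
  let ?K = "N 0 \<inter> {w \<in> carrier G. \<forall>a\<in>{g}. cm a w \<in> N 2}"
  have "subgroup {w \<in> carrier G. \<forall>a\<in>{g}. cm a w \<in> N 2} G"
    using subgroup_commutator_right[OF normal_chain, of "{g}" 2] g by simp
  then have "subgroup ?K G" using subgroups_Inter_pair[OF chain_subgroup] by blast
  moreover have "N 1 \<subseteq> ?K"
    using commutator_1 chain_carrier chain_Suc_subset[of 0] normal_commutator_sym[OF normal_chain] g by auto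
  moreover have "n \<in> ?K" using n ng normal_commutator_sym[OF normal_chain] chain_carrier g by auto
  ultimately have "?K = N 0" using min_0 n unfolding no_intermediate_def by blast
  then have "cm g m \<in> N 2" if "m \<in> N 0" for m using that by auto
  then show "g \<in> C" unfolding C_def
    using g chain_carrier normal_commutator_sym[OF normal_chain g] by blast
qed (use n commutator_C in blast)

text \<open>For \<open>n\<close> outside \<open>N 1\<close>, sending \<open>g\<close> to
  \<open>cm n g\<close> is a homomorphism from \<open>G\<close> to \<open>N 1 / N 2\<close> with
  kernel \<open>C\<close>. The target has no proper nontrivial subgroup, so nothing lies strictly
  between \<open>C\<close> and \<open>G\<close>.\<close>

lemma C_maximal:
  assumes K: "subgroup K G" "C \<subseteq> K" and t: "t \<in> K" "t \<notin> C"
  shows "K = carrier G"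
proof -
  have Kc: "K \<subseteq> carrier G" using K subgroup.subset by blast
  obtain n where n: "n \<in> N 0" "n \<notin> N 1" using chain_1 chain_Suc_subset[of 0] by auto
  have nc: "n \<in> carrier G" using n chain_carrier by blast
  have hom: "N 2 #> cm n (k \<otimes> l) = N 2 #> (cm n l \<otimes> cm n k)"
    if "k \<in> carrier G" "l \<in> carrier G" for k l
  proof -
    have "cm (cm n k) l \<in> N 2" using commutator_0 commutator_1 n that by blast
    then have "N 2 #> (inv l \<otimes> cm n k \<otimes> l) = N 2 #> cm n k"
      using coset_conj[OF normal_chain] nc that by simp
    then show ?thesis unfolding commutator_mult_right[OF nc that]
      using nc that by (intro coset_mult_cong[OF normal_chain]) auto
  qed
  have hinv: "N 2 #> cm n (inv k) = N 2 #> inv (cm n k)" if k: "k \<in> carrier G" for k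
  proof -
    have "N 2 #> (cm n (inv k) \<otimes> cm n k) = N 2 #> \<one>"
      using hom[of k "inv k"] k nc by simp
    then have "N 2 #> ((cm n (inv k) \<otimes> cm n k) \<otimes> inv (cm n k)) = N 2 #> (\<one> \<otimes> inv (cm n k))"
      using k nc by (intro coset_mult_cong[OF normal_chain]) auto
    then show ?thesis using k nc by (simp add: m_assoc)
  qed
  \<comment> \<open>The image of \<open>K\<close> under this homomorphism, as a subgroup of
    \<open>N 1\<close> containing \<open>N 2\<close>.\<close>
  let ?J = "{m \<in> N 1. \<exists>k\<in>K. N 2 #> cm n k = N 2 #> m}"
  have "subgroup ?J G"
  proof (rule subgroupI)
    show "?J \<subseteq> carrier G" using chain_carrier by auto
    have "\<one> \<in> ?J" using subgroup.one_closed[OF K(1)] normal_one_closed[OF normal_chain] commutator_one(1)[OF nc]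
      by (metis (mono_tags, lifting) mem_Collect_eq)
    then show "?J \<noteq> {}" by blast
  next
    fix m assume "m \<in> ?J"
    then obtain k where k: "m \<in> N 1" "k \<in> K" "N 2 #> cm n k = N 2 #> m" by blast
    then have "N 2 #> cm n (inv k) = N 2 #> inv m"
      using hinv[of k] Kc coset_inv_cong[OF normal_chain, of "cm n k" m 2] chain_carrier nc by auto
    then show "inv m \<in> ?J"
      using k subgroup.m_inv_closed[OF K(1)] normal_inv_closed[OF normal_chain] by blast
  next
    fix m l assume "m \<in> ?J" "l \<in> ?J"
    then obtain k j where k: "m \<in> N 1" "k \<in> K" "N 2 #> cm n k = N 2 #> m"
      and j: "l \<in> N 1" "j \<in> K" "N 2 #> cm n j = N 2 #> l" by blast
    have "N 2 #> cm n (j \<otimes> k) = N 2 #> (cm n k \<otimes> cm n j)" using hom k j Kc by blast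
    also have "\<dots> = N 2 #> (m \<otimes> l)"
      using k j Kc nc chain_carrier by (intro coset_mult_cong[OF normal_chain]) auto
    finally show "m \<otimes> l \<in> ?J"
      using k j subgroup.m_closed[OF K(1)] normal_mult_closed[OF normal_chain] by blast
  qed
  moreover have "N 2 \<subseteq> ?J"
  proof
    fix m assume m: "m \<in> N 2"
    have "N 2 #> cm n \<one> = N 2 #> m"
      using m nc chain_carrier coset_eq_iff[OF normal_chain, of \<one> m] normal_inv_closed[OF normal_chain m] by simp
    then show "m \<in> ?J" using m chain_antimono[of 1 2] subgroup.one_closed[OF K(1)] by auto
  qed
  moreover have "cm n t \<in> ?J" using t Kc commutator_0 n by blast
  moreover have "cm n t \<notin> N 2" using t Kc mem_C_iff[OF n] by blast
  ultimately have J: "?J = N 1" using min_1 unfolding no_intermediate_def by blast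
  have "g \<in> K" if g: "g \<in> carrier G" for g
  proof -
    have "cm n g \<in> ?J" unfolding J using commutator_0 n g by blast
    \<comment> \<open>Since \<open>k\<close> and \<open>g\<close> have the same image,
      \<open>g \<otimes> inv k\<close> lies in the kernel \<open>C\<close> and therefore in
      \<open>K\<close>.\<close>
    then obtain k where k: "k \<in> K" "N 2 #> cm n k = N 2 #> cm n g" by blast
    have kc: "k \<in> carrier G" using k Kc by blast
    have "N 2 #> cm n (g \<otimes> inv k) = N 2 #> (cm n (inv k) \<otimes> cm n g)"
      using hom g kc by simp
    also have "\<dots> = N 2 #> (inv (cm n g) \<otimes> cm n g)"
    proof (rule coset_mult_cong[OF normal_chain])
      show "N 2 #> cm n (inv k) = N 2 #> inv (cm n g)"
        using hinv[OF kc] coset_inv_cong[OF normal_chain _ _ k(2)] nc kc g by simp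
    qed (use nc kc g in auto)
    also have "inv (cm n g) \<otimes> cm n g = \<one>" using nc g by simp
    finally have "cm n (g \<otimes> inv k) \<in> N 2"
      using coset_chain_mem_iff[of _ \<one> 2] nc g kc normal_one_closed[OF normal_chain] by simp
    then have "g \<otimes> inv k \<in> K" using mem_C_iff[OF n] g kc K(2) by auto
    then have "(g \<otimes> inv k) \<otimes> k \<in> K" using k subgroup.m_closed[OF K(1)] by blast
    then show ?thesis using g kc by (simp add: m_assoc)
  qed
  then show ?thesis using Kc by blast
qed

text \<open>The index \<open>j\<close> counts the entries in front of the one from \<open>C\<close>,
  so \<open>j \<ge> 1\<close> says that it is not the first entry.\<close>

definition position :: "nat \<Rightarrow> bool" where
  "position j \<longleftrightarrow> (\<exists>ys a zs. length ys = j \<and> length ys + length zs + 1 = r \<and> set ys \<subseteq> carrier G \<and>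
    set zs \<subseteq> carrier G \<and> a \<in> C \<and> left_normed_commutator G (ys @ a # zs) \<notin> N 1)"

lemma value_not_in_chain_1: obtains ws where "length ws = r" "set ws \<subseteq> carrier G"
  "left_normed_commutator G ws \<notin> N 1"
proof -
  have "\<not> lower_central G r \<subseteq> N 1" using chain_1 chain_0 chain_Suc_subset[of 0] by auto
  then show ?thesis using lower_central_subset[OF chain_subgroup] that by blast
qed

lemma position_exists: "\<exists>j\<ge>1. position j"
proof -
  obtain ws where ws: "length ws = r" "set ws \<subseteq> carrier G" "left_normed_commutator G ws \<notin> N 1"
    using value_not_in_chain_1 .
  obtain x1 x2 us where w: "ws = x1 # x2 # us"
    using ws(1) r by (cases ws rule: list.exhaust; cases "tl ws") auto
  have c: "x1 \<in> carrier G" "x2 \<in> carrier G" "set us \<subseteq> carrier G" "length us + 2 = r"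
    using ws w by auto
  show ?thesis
  proof (cases "x2 \<in> C")
    case True
    then have "position 1" unfolding position_def
      using ws w c by (intro exI[of _ "[x1]"] exI[of _ x2] exI[of _ us]) auto
    then show ?thesis by blast
  next
    case False
    \<comment> \<open>This kernel contains \<open>x2\<close>, as \<open>cm x2 x2 = \<one>\<close>,
      but not \<open>x1\<close>. If it contained \<open>C\<close> as well, \<open>C_maximal\<close>
      would make it all of \<open>G\<close>.\<close>
    let ?K = "{g \<in> carrier G. left_normed_commutator G ([x2] @ g # us) \<in> N 1}"
    have K: "subgroup ?K G" by (rule value_subgroup) (use c in auto)
    have "x2 \<in> ?K" using c normal_one_closed[OF normal_chain] by simp
    moreover have "x1 \<notin> ?K" using value_swap_mem[OF c(1,2,3,4)] ws w by simp
    ultimately have "\<not> C \<subseteq> ?K" using C_maximal[OF K] False c by blast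
    then obtain a where "a \<in> C" "left_normed_commutator G ([x2] @ a # us) \<notin> N 1"
      using C_carrier by blast
    then have "position 1" unfolding position_def
      using c by (intro exI[of _ "[x2]"] exI[of _ a] exI[of _ us]) auto
    then show ?thesis by blast
  qed
qed

lemma maximal_position: "\<exists>j\<ge>1. position j \<and> (\<forall>k>j. \<not> position k)"
proof -
  have b: "\<forall>k. position k \<longrightarrow> k \<le> r" unfolding position_def by auto
  obtain i where "i \<ge> 1" "position i" using position_exists by blast
  then have "position (Greatest position)" "i \<le> Greatest position"
    using b GreatestI_nat[of position i r] Greatest_le_nat[of position i r] by auto
  moreover have "\<not> position k" if "k > Greatest position" for k
    using Greatest_le_nat[of position k r] b that by auto
  ultimately show ?thesis using \<open>i \<ge> 1\<close> by (intro exI[of _ "Greatest position"]) auto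
qed

end

section \<open>An entry from \<open>C\<close> placed as far to the right as possible\<close>

locale central_chain_maximal = central_chain_position + central_chain_slot +
  fixes a
  assumes len: "length ys + length zs + 1 = r"
    and a: "a \<in> C" "slot a \<notin> N 1"
    and maximal: "\<And>ys' b zs'. \<lbrakk>set ys' \<subseteq> carrier G; set zs' \<subseteq> carrier G; length ys' + length zs' + 1 = r;
      length ys' > length ys; b \<in> C\<rbrakk> \<Longrightarrow> left_normed_commutator G (ys' @ b # zs') \<in> N 1"
begin

lemma level_0: "g \<in> carrier G \<Longrightarrow> g \<in> level 0"
  using carrier_upper[of g] by (simp add: add.commute flip: len)

lemma commutator_y: "g \<in> carrier G \<Longrightarrow> cm y g \<in> upper 0 s"
  using commutator_level level_0 by blast

lemma foldl_maximal:
  assumes "g \<in> carrier G" "b \<in> C" "set us \<subseteq> carrier G" "length us + 1 = s"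
  shows "fc (cm (cm y g) b) us \<in> N 1"
proof -
  have "left_normed_commutator G ((ys @ [g]) @ b # us) \<in> N 1"
    by (rule maximal) (use assms ys len in auto)
  then show ?thesis using ys(2) by (simp add: left_normed_commutator_append)
qed

lemma foldl_maximal_twice:
  assumes "g \<in> carrier G" "b \<in> C" "h \<in> carrier G" "set us \<subseteq> carrier G" "length us + 2 = s"
  shows "fc (cm (cm (cm y g) h) b) us \<in> N 1"
proof -
  have "left_normed_commutator G ((ys @ [g, h]) @ b # us) \<in> N 1"
    by (rule maximal) (use assms ys len in auto)
  then show ?thesis using ys(2) by (simp add: left_normed_commutator_append)
qed

text \<open>This commutator has one entry too many. Without the last one, \<open>b\<close> stands to
  the right of the maximal position, which gives \<open>N 1\<close>; the last entry then gives
  \<open>N 2\<close>. If \<open>zs\<close> is empty, \<open>b\<close> itself takes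
  \<open>N 0\<close> to \<open>N 2\<close>.\<close>

lemma foldl_commutator_C:
  assumes g: "g \<in> carrier G" and b: "b \<in> C"
  shows "fc (cm (cm y g) b) zs \<in> N 2"
proof (cases zs rule: rev_cases)
  case Nil
  then show ?thesis using commutator_C[OF _ b] commutator_y[OF g] by simp
next
  case (snoc us z)
  then show ?thesis using foldl_maximal[OF g b, of us] commutator_1 zs by simp
qed

lemma good_two_C:
  assumes p: "p = 2" and h: "h \<in> C"
  shows "good 0 h"
proof (rule good_two[OF p level_0])
  show hc: "h \<in> carrier G" using h C_carrier by blast
  show "fc (cm (cm y h) h) zs \<in> N (0 + 2)" using foldl_commutator_C[OF hc h] by (simp only: add_0)
qed

text \<open>The correction has two entries too many. If \<open>zs\<close> has at most one entry, an
  \<open>h\<close> takes \<open>N 0\<close> to \<open>N 2\<close> and one more entry reaches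
  \<open>N 3\<close>; otherwise maximality gives \<open>N 1\<close> before the last two
  entries.\<close>

lemma good_odd_C:
  assumes p: "odd p" and e: "e = 2" and h: "h \<in> C"
  shows "good 0 h"
proof (rule good_odd[OF p level_0])
  show hc: "h \<in> carrier G" using h C_carrier by blast
  let ?u = "cm (cm (cm y h) h) h"
  have "fc ?u zs \<in> N 3"
  proof (cases zs rule: rev_cases)
    case Nil
    then have "cm (cm y h) h \<in> N 2" using commutator_C[OF _ h] commutator_y[OF hc] by simp
    then show ?thesis using commutator_chain[of _ 2 h] hc Nil by simp
  next
    case (snoc us z)
    have z: "z \<in> carrier G" using snoc zs by simp
    have "fc ?u us \<in> N 2"
    proof (cases us rule: rev_cases)
      case Nil
      then have "s = Suc 0" using snoc by simp
      then have "cm (cm y h) h \<in> N 0" using commutator_y[OF hc] hc by simp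
      then show ?thesis using commutator_C h Nil by simp
    next
      case (snoc vs x)
      then have "fc ?u vs \<in> N 1" using foldl_maximal_twice[OF hc h hc, of vs] \<open>zs = us @ [z]\<close> zs by simp
      then show ?thesis using snoc commutator_1 \<open>zs = us @ [z]\<close> zs by simp
    qed
    then show ?thesis using commutator_chain[of _ 2 z] z snoc by simp
  qed
  then show "fc ?u zs \<in> N (0 + e + 1)" using e by (simp add: eval_nat_numeral)
qed

lemma cover_0:
  assumes "n \<in> N 0"
  shows "\<exists>h\<in>C. N (Suc 0) #> slot h = N (Suc 0) #> n"
  by (rule slot_cover[OF C_subgroup])
    (use a assms min_0 level_0 C_carrier in auto)

lemma surjective_two:
  assumes p: "p = 2"
    and pow: "\<And>i n. n \<in> N (i + e) \<Longrightarrow> \<exists>m\<in>N i. N (i + e + 1) #> n = N (i + e + 1) #> (m [^] p)"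
    and triv: "N l = {\<one>}" and n: "n \<in> N 0"
  shows "\<exists>g\<in>carrier G. slot g = n"
proof (rule slot_surjective[OF _ pow triv n])
  fix i n assume "i < e" and n: "n \<in> N i"
  then have i: "i = 0" using exponent_step p by auto
  show "\<exists>h\<in>level i. N (Suc i) #> slot h = N (Suc i) #> n \<and> good i h"
    using cover_0 n good_two_C[OF p] level_0 C_carrier unfolding i by blast
qed

text \<open>The entries of \<open>zs\<close> are exchanged for \<open>t\<close> one by one. At each
  place the kernel contains \<open>C\<close> by maximality but not the old entry, so by
  \<open>C_maximal\<close> it does not contain \<open>t\<close> either.\<close>

lemma value_replicate:
  assumes t: "t \<in> carrier G" "t \<notin> C"
  shows "k \<le> s \<Longrightarrow> left_normed_commutator G (ys @ a # replicate k t @ drop k zs) \<notin> N 1"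
proof (induction k)
  case 0
  then show ?case using a slot_eq by simp
next
  case (Suc k)
  let ?ys = "ys @ a # replicate k t" and ?zs = "drop (Suc k) zs"
  have ac: "a \<in> carrier G" using a C_carrier by blast
  have zsc: "set ?zs \<subseteq> carrier G" by (rule order_trans[OF set_drop_subset zs])
  have ysc: "set ?ys \<subseteq> carrier G" using ys ac t by auto
  let ?K = "{g \<in> carrier G. left_normed_commutator G (?ys @ g # ?zs) \<in> N 1}"
  have K: "subgroup ?K G"
    by (rule value_subgroup[OF ysc _ zsc]) (use len Suc.prems in auto)
  have CK: "C \<subseteq> ?K"
  proof
    fix b assume b: "b \<in> C"
    have "left_normed_commutator G (?ys @ b # ?zs) \<in> N 1"
      by (rule maximal[OF ysc zsc]) (use len Suc.prems b in auto)
    then show "b \<in> ?K" using b C_carrier by blast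
  qed
  have "drop k zs = zs ! k # ?zs" using Suc.prems by (simp add: Cons_nth_drop_Suc)
  then have "zs ! k \<notin> ?K" using Suc by simp
  moreover have "zs ! k \<in> carrier G" using Suc.prems zs by auto
  ultimately have "t \<notin> ?K" using C_maximal[OF K CK _ t(2)] by blast
  then show ?case using t by (simp add: replicate_app_Cons_same)
qed

text \<open>By Hall-Witt, \<open>[y, [a, t]]\<close> is congruent to
  \<open>[y, a, t] [t, y, a]\<close> modulo \<open>upper 2 s\<close>. After appending
  \<open>zs\<close>, maximality kills the second factor, while the first becomes
  \<open>cm (slot a) t\<close>, which is outside \<open>N 2\<close> by
  \<open>mem_C_iff\<close>.\<close>

lemma slot_commutator_not_in_chain_2:
  assumes t: "t \<in> carrier G" "t \<notin> C" and zs_t: "zs = replicate s t"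
  shows "slot (cm a t) \<notin> N 2"
proof -
  let ?R = "upper 2 s"
  have ac: "a \<in> carrier G" using a C_carrier by blast
  define u v b where uvb: "u = cm y a" "v = cm t y" "b = cm a t"
  have uc: "u \<in> carrier G" "v \<in> carrier G" "b \<in> carrier G"
    using uvb ac t y_closed by auto
  have D: "u \<in> lower_central G 2" "v \<in> lower_central G 2" "b \<in> lower_central G 2"
    using uvb ac t y_closed commutator_in_lower_central_2 by auto
  have u0: "u \<in> upper 0 s" unfolding uvb using commutator_y ac by blast
  have yt: "cm y t \<in> upper 0 s" using commutator_y t by blast
  have v0: "v \<in> upper 0 s" unfolding uvb using upper_commutator_sym[OF y_closed t(1) yt] .
  have b1: "b \<in> level 1" unfolding uvb using upper_commutator[OF level_0[OF ac] t(1)] by simp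
  have by1: "cm b y \<in> upper 1 s"
    using upper_commutator_sym[OF y_closed uc(3) commutator_level[OF b1]] .
  have two: "cm x g \<in> ?R" "cm g x \<in> ?R" if "x \<in> upper 1 s" "g \<in> carrier G" for x g
    using upper_commutator[OF that] upper_commutator_sym upper_carrier that
    by (simp_all add: numeral_2_eq_2)
  have der: "cm x w \<in> ?R" "cm w x \<in> ?R" if "x \<in> upper 0 s" "w \<in> lower_central G 2" for x w
  proof -
    show "cm x w \<in> ?R" using upper_commutator_derived[OF that] by (simp only: add_0)
    then show "cm w x \<in> ?R" using upper_commutator_sym upper_carrier derived_carrier that by blast
  qed
  have one: "cm x g \<in> upper 1 s" if "x \<in> upper 0 s" "g \<in> carrier G" for x g
    using upper_commutator[OF that] by simp
  \<comment> \<open>The conjugated entries in the Hall-Witt identity have the form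
    \<open>k \<otimes> w\<close>; this removes the factor \<open>w\<close>, which commutes with
    \<open>g\<close> modulo \<open>?R\<close>.\<close>
  have drop: "?R #> cm g (k \<otimes> w) = ?R #> cm g k"
    if "g \<in> carrier G" "k \<in> carrier G" "w \<in> carrier G" "cm g w \<in> ?R" "cm g k \<in> upper 1 s" for g k w
  proof -
    have "?R #> (inv w \<otimes> cm g k \<otimes> w) = ?R #> cm g k"
      using that two by (intro coset_conj[OF upper_normal]) auto
    then show ?thesis unfolding commutator_mult_right[OF that(1-3)]
      using that coset_absorb_left[OF upper_normal] by simp
  qed
  have "?R #> (cm b (inv a \<otimes> y \<otimes> a) \<otimes> cm u (inv y \<otimes> t \<otimes> y) \<otimes> cm v (inv t \<otimes> a \<otimes> t))
      = ?R #> (cm b y \<otimes> cm u t \<otimes> cm v a)"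
    unfolding conj_eq_mult_commutator[OF y_closed ac] conj_eq_mult_commutator[OF t(1) y_closed]
      conj_eq_mult_commutator[OF ac t(1)] uvb[symmetric]
    by (intro coset_mult_cong[OF upper_normal] drop)
      (use uc ac t y_closed der u0 v0 D by1 one in auto)
  moreover have "cm b (inv a \<otimes> y \<otimes> a) \<otimes> cm u (inv y \<otimes> t \<otimes> y) \<otimes> cm v (inv t \<otimes> a \<otimes> t) = \<one>"
    using hall_witt[OF ac t(1) y_closed] by (simp add: uvb)
  ultimately have "?R #> (cm b y \<otimes> (cm u t \<otimes> cm v a)) = ?R #> \<one>"
    using uc ac t y_closed by (simp add: m_assoc)
  then have "?R #> (inv (cm b y) \<otimes> (cm b y \<otimes> (cm u t \<otimes> cm v a))) = ?R #> (inv (cm b y) \<otimes> \<one>)"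
    using uc ac t y_closed by (intro coset_mult_cong[OF upper_normal]) auto
  moreover have "inv (cm b y) \<otimes> (cm b y \<otimes> (cm u t \<otimes> cm v a)) = cm u t \<otimes> cm v a"
    using uc ac t y_closed by (intro mult_inv_cancel) auto
  moreover have "inv (cm b y) \<otimes> \<one> = cm y b"
    using uc y_closed by (simp add: inv_commutator)
  ultimately have yb: "?R #> cm y b = ?R #> (cm u t \<otimes> cm v a)" by simp
  have ut: "cm u t \<in> lower_central G 2" using uc t commutator_in_lower_central_2 by blast
  have "N 2 #> slot b = N 2 #> fc (cm u t \<otimes> cm v a) zs"
    unfolding slot_def using yb uc ac t y_closed zs by (intro foldl_commutator_cong) auto
  also have "\<dots> = N 2 #> (fc (cm u t) zs \<otimes> fc (cm v a) zs)"
    using foldl_commutator_mult[OF ut one[OF v0 ac] zs] by (simp add: numeral_2_eq_2)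
  finally have eq: "N 2 #> slot b = N 2 #> (fc (cm u t) zs \<otimes> fc (cm v a) zs)" .
  \<comment> \<open>As \<open>v\<close> is the inverse of \<open>cm y t\<close>, the commutator of
    \<open>v\<close> and \<open>a\<close> may be replaced by the inverse of
    \<open>cm (cm y t) a\<close>, where \<open>a\<close> stands to the right of the maximal
    position.\<close>
  have va: "fc (cm v a) zs \<in> N 2"
  proof (cases zs rule: rev_cases)
    case Nil
    then show ?thesis using v0 a commutator_C by simp
  next
    case (snoc us z)
    have us: "set us \<subseteq> carrier G" "z \<in> carrier G" using snoc zs by auto
    let ?w = "cm y t" and ?S = "upper 1 (length us)"
    have wc: "?w \<in> carrier G" using t y_closed by simp
    have w: "?w \<in> upper 0 (Suc (length us))" using yt snoc by simp
    have va': "cm v a \<in> upper 0 (length us)" using upper_SucD[of v 0 "length us" a] v0 snoc ac by simp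
    have vac: "cm v a \<in> carrier G" using uc ac by simp
    have wac: "cm ?w a \<in> carrier G" using wc ac by simp
    have "v \<otimes> ?w = \<one>" unfolding uvb using t y_closed by (simp add: inv_commutator[OF t(1) y_closed, symmetric])
    then have "(inv ?w \<otimes> cm v a \<otimes> ?w) \<otimes> cm ?w a = \<one>"
      using commutator_mult_left[OF uc(2) wc ac] ac by simp
    moreover have "?S #> (inv ?w \<otimes> cm v a \<otimes> ?w) = ?S #> cm v a"
      using upper_commutator[OF va' wc] vac wc by (intro coset_conj[OF upper_normal]) auto
    ultimately have "?S #> (cm v a \<otimes> cm ?w a) = ?S #> \<one>"
      using coset_mult_cong[OF upper_normal, of "inv ?w \<otimes> cm v a \<otimes> ?w" "cm ?w a" "cm v a" "cm ?w a" 1 "length us"]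
        vac wac wc by simp
    then have "?S #> ((cm v a \<otimes> cm ?w a) \<otimes> inv (cm ?w a)) = ?S #> (\<one> \<otimes> inv (cm ?w a))"
      using vac wac by (intro coset_mult_cong[OF upper_normal]) auto
    then have "?S #> cm v a = ?S #> inv (cm ?w a)" using vac wac by (simp add: m_assoc)
    then have "N 1 #> fc (cm v a) us = N 1 #> fc (inv (cm ?w a)) us"
      using vac wac us by (intro foldl_commutator_cong) auto
    also have "\<dots> = N 1 #> inv (fc (cm ?w a) us)"
      using foldl_commutator_inv[of "cm ?w a" 0 us] upper_SucD[OF w ac] wc ac us
        commutator_in_lower_central_2 by simp
    finally have "N 1 #> fc (cm v a) us = N 1 #> inv (fc (cm ?w a) us)" .
    moreover have "fc (cm ?w a) us \<in> N 1" using foldl_maximal[OF t(1) a(1) us(1)] snoc by simp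
    ultimately have "fc (cm v a) us \<in> N 1"
      using coset_chain_mem_iff[of "fc (cm v a) us" "inv (fc (cm ?w a) us)" 1] vac wac us
        normal_inv_closed[OF normal_chain] by simp
    then show ?thesis using snoc commutator_1 us by simp
  qed
  have "fc (cm u t) zs = fc u (t # zs)" by simp
  \<comment> \<open>All entries are equal to \<open>t\<close>, so the additional one may be moved
    from the front to the end.\<close>
  also have "t # zs = zs @ [t]" by (metis zs_t replicate_Suc replicate_append_same)
  also have "fc u (zs @ [t]) = cm (slot a) t" by (simp add: slot_def uvb)
  finally have "fc (cm u t) zs \<notin> N 2"
    using mem_C_iff[of "slot a" t] a slot_in_chain[OF level_0[OF ac]] t by simp
  moreover have "fc (cm u t) zs = (fc (cm u t) zs \<otimes> fc (cm v a) zs) \<otimes> inv (fc (cm v a) zs)"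
    using uc ac t zs by (simp add: m_assoc)
  ultimately have "fc (cm u t) zs \<otimes> fc (cm v a) zs \<notin> N 2"
    using normal_mult_closed[OF normal_chain _ normal_inv_closed[OF normal_chain va]] by metis
  then show ?thesis using coset_chain_mem_iff[OF _ _ eq] uc ac t zs slot_closed by (auto simp: uvb)
qed

text \<open>Level \<open>0\<close> is covered by elements of \<open>C\<close>, level
  \<open>1\<close> by derived elements, among which \<open>cm a t\<close> has a value outside
  \<open>N 2\<close>.\<close>

lemma surjective_odd:
  assumes p: "odd p" and e: "e = 2"
    and t: "t \<in> carrier G" "t \<notin> C" and zs_t: "zs = replicate s t"
    and pow: "\<And>i n. n \<in> N (i + e) \<Longrightarrow> \<exists>m\<in>N i. N (i + e + 1) #> n = N (i + e + 1) #> (m [^] p)"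
    and triv: "N l = {\<one>}" and n: "n \<in> N 0"
  shows "\<exists>g\<in>carrier G. slot g = n"
proof (rule slot_surjective[OF _ pow triv n])
  fix i n assume "i < e" and n: "n \<in> N i"
  then consider "i = 0" | "i = 1" using e by linarith
  then show "\<exists>h\<in>level i. N (Suc i) #> slot h = N (Suc i) #> n \<and> good i h"
  proof cases
    case 1
    then show ?thesis using cover_0 n good_odd_C[OF p e] level_0 C_carrier by blast
  next
    case 2
    let ?H = "lower_central G 2 \<inter> level 1"
    have ac: "a \<in> carrier G" using a C_carrier by blast
    have H: "subgroup ?H G" using subgroups_Inter_pair[OF lower_central_subgroup upper_subgroup] .
    have b: "cm a t \<in> ?H"
      using upper_commutator[OF level_0[OF ac] t(1)] commutator_in_lower_central_2[OF ac t(1)] by simp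
    have "\<exists>h\<in>?H. N (Suc 1) #> slot h = N (Suc 1) #> n"
    proof (rule slot_cover[OF H _ _ b])
      show "slot (cm a t) \<notin> N (Suc 1)"
        using slot_commutator_not_in_chain_2[OF t zs_t] by (simp add: numeral_2_eq_2)
      show "no_intermediate (N (Suc 1)) (N 1)" using min_1 by (simp add: numeral_2_eq_2)
    qed (use n 2 in auto)
    then show ?thesis using good_derived[OF p] 2 by blast
  qed
qed

end

context central_chain_position
begin

lemma obtain_maximal:
  obtains ys a zs where "central_chain_maximal G N p e r ys zs a"
proof -
  obtain j where j: "j \<ge> 1" "position j" "\<forall>k>j. \<not> position k"
    using maximal_position by blast
  obtain ys a zs where w: "length ys = j" "length ys + length zs + 1 = r" "set ys \<subseteq> carrier G"
    "set zs \<subseteq> carrier G" "a \<in> C" "left_normed_commutator G (ys @ a # zs) \<notin> N 1"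
    using j(2) unfolding position_def by blast
  interpret S: central_chain_slot G N p e ys zs
    by unfold_locales (use w j(1) in auto)
  have "central_chain_maximal G N p e r ys zs a"
    by unfold_locales (use w j(3) in \<open>auto simp: S.slot_eq position_def\<close>)
  then show ?thesis using that by blast
qed

theorem surjective_two:
  assumes p: "p = 2"
    and pow: "\<And>i n. n \<in> N (i + e) \<Longrightarrow> \<exists>m\<in>N i. N (i + e + 1) #> n = N (i + e + 1) #> (m [^] p)"
    and triv: "N l = {\<one>}"
  shows "\<exists>ys zs. set ys \<subseteq> carrier G \<and> set zs \<subseteq> carrier G \<and> length ys + length zs + 1 = r \<and>
    (\<forall>n\<in>N 0. \<exists>g\<in>carrier G. left_normed_commutator G (ys @ g # zs) = n)"
proof -
  obtain ys a zs where "central_chain_maximal G N p e r ys zs a" by (rule obtain_maximal)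
  then interpret M: central_chain_maximal G N p e r ys zs a .
  show ?thesis using M.surjective_two[OF p pow triv] M.ys M.zs M.len unfolding M.slot_eq[symmetric]
    by blast
qed

theorem surjective_odd:
  assumes p: "odd p" and e: "e = 2"
    and nt: "n \<in> N 0" "t \<in> carrier G" "cm n t \<notin> N 2"
    and pow: "\<And>i n. n \<in> N (i + e) \<Longrightarrow> \<exists>m\<in>N i. N (i + e + 1) #> n = N (i + e + 1) #> (m [^] p)"
    and triv: "N l = {\<one>}"
  shows "\<exists>ys zs. set ys \<subseteq> carrier G \<and> set zs \<subseteq> carrier G \<and> length ys + length zs + 1 = r \<and>
    (\<forall>n\<in>N 0. \<exists>g\<in>carrier G. left_normed_commutator G (ys @ g # zs) = n)"
proof -
  obtain ys a zs where "central_chain_maximal G N p e r ys zs a" by (rule obtain_maximal)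
  then interpret M: central_chain_maximal G N p e r ys zs a .
  have t: "t \<in> carrier G" "t \<notin> C" using nt by (auto simp: C_def)
  let ?zs = "replicate (length zs) t"
  interpret S: central_chain_slot G N p e ys ?zs
    by unfold_locales (use M.ys t in auto)
  have "left_normed_commutator G (ys @ a # ?zs) \<notin> N 1"
    using M.value_replicate[OF t, of "length zs"] by simp
  \<comment> \<open>Maximality refers to \<open>zs\<close> only through its length, so it survives
    the exchange for the constant list.\<close>
  then interpret M': central_chain_maximal G N p e r ys ?zs a
    by unfold_locales (use M.len M.a M.maximal in \<open>auto simp: S.slot_eq\<close>)
  have "\<forall>n\<in>N 0. \<exists>g\<in>carrier G. left_normed_commutator G (ys @ g # ?zs) = n"
    unfolding S.slot_eq using M'.surjective_odd[OF p e t _ pow triv] by simp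
  then show ?thesis using S.ys S.zs M'.len by blast
qed

end

section \<open>Chains with two-dimensional top quotient\<close>

text \<open>The condition \<open>rank_two\<close> bounds the length of subgroup chains between
  \<open>N 1\<close> and \<open>N 0\<close> by two, so \<open>N 0 / N 1\<close> behaves like a
  vector space of dimension at most two.\<close>

locale central_chain_rank_two = central_chain_commutators +
  assumes chain_1: "N 1 \<noteq> N 0"
    and rank_two: "\<And>J K. \<lbrakk>subgroup J G; subgroup K G; N 1 \<subset> J; J \<subset> K; K \<subseteq> N 0\<rbrakk> \<Longrightarrow> K = N 0"
begin

abbreviation (input) "val \<equiv> left_normed_commutator G"

lemma chain_1_subset: "N 1 \<subseteq> N 0"
  using chain_Suc_subset[of 0] by simp

text \<open>For nonempty \<open>xs\<close> this is \<open>slot_mult\<close>. A first entry is moved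
  to the second place by \<open>value_swap\<close>, and the two inverted factors commute modulo
  \<open>N 1\<close>.\<close>

lemma value_mult:
  assumes "set xs \<subseteq> carrier G" "set ws \<subseteq> carrier G" "length xs + length ws + 1 = r"
    and g: "g \<in> carrier G" "h \<in> carrier G"
  shows "N 1 #> val (xs @ (g \<otimes> h) # ws) = N 1 #> (val (xs @ g # ws) \<otimes> val (xs @ h # ws))"
proof -
  have *: "N 1 #> val (xs @ (g \<otimes> h) # ws) = N 1 #> (val (xs @ g # ws) \<otimes> val (xs @ h # ws))"
    if "set xs \<subseteq> carrier G" "set ws \<subseteq> carrier G" "length xs + length ws + 1 = r" "xs \<noteq> []" for xs ws
  proof -
    interpret central_chain_slot G N p e xs ws by unfold_locales (use that in auto)
    have "h \<in> level 0" using carrier_upper[OF g(2)] that(3) by (simp add: add.commute flip: that(3))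
    from slot_mult[OF g(1) this] show ?thesis by (simp add: slot_eq)
  qed
  show ?thesis
  proof (cases "xs = []")
    case True
    then obtain z zs where ws: "ws = z # zs" using assms r by (cases ws) auto
    have z: "z \<in> carrier G" "set zs \<subseteq> carrier G" "length zs + 2 = r" using assms ws True by auto
    note sw = value_swap[OF _ z]
    let ?A = "val ([z] @ g # zs)" and ?B = "val ([z] @ h # zs)"
    have c: "?A \<in> carrier G" "?B \<in> carrier G" using g z by auto
    have A: "?A \<in> N 0" by (rule value_in_chain) (use g z in auto)
    have "N 1 #> val (xs @ (g \<otimes> h) # ws) = N 1 #> inv (val ([z] @ (g \<otimes> h) # zs))"
      using sw[of "g \<otimes> h"] g by (simp add: True ws)
    also have "\<dots> = N 1 #> inv (?A \<otimes> ?B)"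
      by (rule coset_inv_cong[OF normal_chain _ _ *]) (use g z c in auto)
    also have "inv (?A \<otimes> ?B) = inv ?B \<otimes> inv ?A" using c by (simp add: inv_mult_group)
    also have "N 1 #> (inv ?B \<otimes> inv ?A) = N 1 #> (inv ?A \<otimes> inv ?B)"
    proof (rule coset_commute[OF normal_chain, symmetric])
      show "cm (inv ?A) (inv ?B) \<in> N 1"
        using commutator_chain[OF normal_inv_closed[OF normal_chain A], of "inv ?B"] c by simp
    qed (use c in auto)
    also have "\<dots> = N 1 #> (val (xs @ g # ws) \<otimes> val (xs @ h # ws))"
      using sw[OF g(1)] sw[OF g(2)] g z c
      by (intro coset_mult_cong[OF normal_chain]) (auto simp: True ws)
    finally show ?thesis .
  qed (use * assms in blast)
qed

definition slot_values :: "'a list \<Rightarrow> 'a list \<Rightarrow> 'a set" where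
  "slot_values xs ws = {n \<in> N 0. \<exists>g\<in>carrier G. N 1 #> val (xs @ g # ws) = N 1 #> n}"

text \<open>A value with \<open>g\<close> in the first place is, modulo \<open>N 1\<close>, the
  value with \<open>inv g\<close> in the second.\<close>

lemma slot_values_swap:
  assumes "z \<in> carrier G" "set zs \<subseteq> carrier G" "length zs + 2 = r"
  shows "slot_values [] (z # zs) \<subseteq> slot_values [z] zs"
proof
  fix n assume "n \<in> slot_values [] (z # zs)"
  then obtain g where g: "n \<in> N 0" "g \<in> carrier G" "N 1 #> val (g # z # zs) = N 1 #> n"
    unfolding slot_values_def by auto
  have l: "inv g \<in> carrier G" using g by simp
  have c: "val (z # g # zs) \<in> carrier G" "val (z # inv g # zs) \<in> carrier G" using g assms by auto
  have "N 1 #> val (z # (inv g \<otimes> g) # zs) = N 1 #> (val (z # inv g # zs) \<otimes> val (z # g # zs))"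
    using value_mult[of "[z]" zs "inv g" g] assms g by simp
  then have "N 1 #> \<one> = N 1 #> (val (z # inv g # zs) \<otimes> val (z # g # zs))"
    using g assms by simp
  then have "N 1 #> (\<one> \<otimes> inv (val (z # g # zs)))
      = N 1 #> (val (z # inv g # zs) \<otimes> val (z # g # zs) \<otimes> inv (val (z # g # zs)))"
    using c by (intro coset_mult_cong[OF normal_chain]) auto
  then have "N 1 #> inv (val (z # g # zs)) = N 1 #> val (z # inv g # zs)"
    using c by (simp only: m_assoc r_inv r_one l_one inv_closed)
  then have "N 1 #> val (z # inv g # zs) = N 1 #> n"
    using value_swap[OF g(2) assms] g by simp
  then show "n \<in> slot_values [z] zs" unfolding slot_values_def using g by auto
qed

lemma slot_values_contains:
  assumes "set xs \<subseteq> carrier G" "set ws \<subseteq> carrier G" "length xs + length ws + 1 = r" "g \<in> carrier G"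
  shows "val (xs @ g # ws) \<in> slot_values xs ws"
  unfolding slot_values_def using value_in_chain[of "xs @ g # ws"] assms by auto

lemma slot_values_subgroup:
  assumes "set xs \<subseteq> carrier G" "set ws \<subseteq> carrier G" "length xs + length ws + 1 = r"
  shows "subgroup (slot_values xs ws) G" and "N 1 \<subseteq> slot_values xs ws"
proof -
  let ?f = "\<lambda>g. val (xs @ g # ws)"
  have c: "?f g \<in> carrier G" if "g \<in> carrier G" for g using that assms by auto
  note mult = value_mult[OF assms]
  have "N 1 #> ?f (\<one> \<otimes> \<one>) = N 1 #> (?f \<one> \<otimes> ?f \<one>)" by (rule mult) auto
  then have "N 1 #> (inv (?f \<one>) \<otimes> ?f \<one>) = N 1 #> (inv (?f \<one>) \<otimes> (?f \<one> \<otimes> ?f \<one>))"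
    using c[OF one_closed] by (intro coset_mult_cong[OF normal_chain]) auto
  then have one: "N 1 #> ?f \<one> = N 1 #> \<one>"
    using c[OF one_closed] by (simp add: mult_inv_cancel)
  have inv: "N 1 #> ?f (inv g) = N 1 #> inv (?f g)" if g: "g \<in> carrier G" for g
  proof -
    have "N 1 #> (?f (inv g) \<otimes> ?f g) = N 1 #> \<one>"
      using mult[of "inv g" g] g one by simp
    then have "N 1 #> ((?f (inv g) \<otimes> ?f g) \<otimes> inv (?f g)) = N 1 #> (\<one> \<otimes> inv (?f g))"
      using c[OF g] c[of "inv g"] g by (intro coset_mult_cong[OF normal_chain]) auto
    then show ?thesis using c[OF g] c[of "inv g"] g by (simp add: m_assoc)
  qed
  show "N 1 \<subseteq> slot_values xs ws"
  proof
    fix m assume m: "m \<in> N 1"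
    have "N 1 #> ?f \<one> = N 1 #> m"
      unfolding one using m chain_carrier coset_eq_iff[OF normal_chain, of \<one> m] normal_inv_closed[OF normal_chain m]
      by simp
    then show "m \<in> slot_values xs ws" using m chain_1_subset unfolding slot_values_def by blast
  qed
  then have ne: "slot_values xs ws \<noteq> {}" using normal_one_closed[OF normal_chain] by blast
  show "subgroup (slot_values xs ws) G"
  proof (rule subgroupI[OF _ ne])
    show "slot_values xs ws \<subseteq> carrier G" unfolding slot_values_def using chain_carrier by auto
    fix n assume "n \<in> slot_values xs ws"
    then obtain g where g: "n \<in> N 0" "g \<in> carrier G" "N 1 #> ?f g = N 1 #> n"
      unfolding slot_values_def by blast
    have "N 1 #> ?f (inv g) = N 1 #> inv n"
      unfolding inv[OF g(2)] using g c chain_carrier by (intro coset_inv_cong[OF normal_chain]) auto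
    then show "inv n \<in> slot_values xs ws"
      unfolding slot_values_def using g normal_inv_closed[OF normal_chain] by blast
    fix m assume "m \<in> slot_values xs ws"
    then obtain h where h: "m \<in> N 0" "h \<in> carrier G" "N 1 #> ?f h = N 1 #> m"
      unfolding slot_values_def by blast
    have "N 1 #> ?f (g \<otimes> h) = N 1 #> (?f g \<otimes> ?f h)" using mult g h by blast
    also have "\<dots> = N 1 #> (n \<otimes> m)"
      using g h c chain_carrier by (intro coset_mult_cong[OF normal_chain]) auto
    finally show "n \<otimes> m \<in> slot_values xs ws"
      unfolding slot_values_def using g h normal_mult_closed[OF normal_chain] by blast
  qed
qed

text \<open>Two lines in a plane that share a nonzero vector coincide.\<close>

lemma subgroup_eq:
  assumes "subgroup J G" "subgroup K G" "N 1 \<subseteq> J" "N 1 \<subseteq> K" "J \<subset> N 0" "K \<subset> N 0"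
    and v: "v \<in> J" "v \<in> K" "v \<notin> N 1"
  shows "J = K"
proof -
  have JK: "subgroup (J \<inter> K) G" using assms subgroups_Inter_pair by blast
  have "N 1 \<subset> J \<inter> K" using assms by blast
  then have "\<not> J \<inter> K \<subset> J" "\<not> J \<inter> K \<subset> K"
    using rank_two[OF JK assms(1)] rank_two[OF JK assms(2)] assms by blast+
  then show ?thesis by blast
qed

definition span :: "'a list \<Rightarrow> 'a set" where
  "span xs = generate G (N 1 \<union> {val (xs @ ws) | ws. set ws \<subseteq> carrier G \<and> length xs + length ws = r})"

lemma span_props:
  assumes "set xs \<subseteq> carrier G"
  shows "subgroup (span xs) G" "N 1 \<subseteq> span xs" "span xs \<subseteq> N 0"
    "set ws \<subseteq> carrier G \<Longrightarrow> length xs + length ws = r \<Longrightarrow> val (xs @ ws) \<in> span xs"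
    "subgroup H G \<Longrightarrow> N 1 \<subseteq> H \<Longrightarrow>
      (\<And>ws. set ws \<subseteq> carrier G \<Longrightarrow> length xs + length ws = r \<Longrightarrow> val (xs @ ws) \<in> H) \<Longrightarrow> span xs \<subseteq> H"
proof -
  let ?S = "N 1 \<union> {val (xs @ ws) | ws. set ws \<subseteq> carrier G \<and> length xs + length ws = r}"
  have S: "?S \<subseteq> N 0"
    using chain_1_subset value_in_chain[of "xs @ _"] assms by auto
  then have "?S \<subseteq> carrier G" using chain_carrier by blast
  then show "subgroup (span xs) G" unfolding span_def by (rule generate_is_subgroup)
  show "N 1 \<subseteq> span xs" unfolding span_def by (auto intro: generate.incl)
  show "span xs \<subseteq> N 0" unfolding span_def by (rule generate_subgroup_incl[OF S chain_subgroup])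
  show "set ws \<subseteq> carrier G \<Longrightarrow> length xs + length ws = r \<Longrightarrow> val (xs @ ws) \<in> span xs"
    unfolding span_def by (auto intro: generate.incl)
  show "span xs \<subseteq> H" if "subgroup H G" "N 1 \<subseteq> H"
    "\<And>ws. set ws \<subseteq> carrier G \<Longrightarrow> length xs + length ws = r \<Longrightarrow> val (xs @ ws) \<in> H" for H
    unfolding span_def by (rule generate_subgroup_incl[OF _ that(1)]) (use that in auto)
qed

text \<open>
  If no slot is surjective modulo \<open>N 1\<close>, then values at \<open>x\<close> and at \<open>x'\<close> that are independent
  modulo \<open>N 1\<close> both occur, modulo \<open>N 1\<close>, at the common entry \<open>x \<otimes> x'\<close>.
\<close>

lemma span_proper:
  assumes no_slot: "\<And>xs ws. \<lbrakk>set xs \<subseteq> carrier G; set ws \<subseteq> carrier G; length xs + length ws + 1 = r\<rbrakk> \<Longrightarrow>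
      slot_values xs ws \<noteq> N 0"
  shows "set xs \<subseteq> carrier G \<Longrightarrow> length xs + k + 1 = r \<Longrightarrow> span xs \<noteq> N 0"
proof (induction k arbitrary: xs)
  case 0
  have "span xs \<subseteq> slot_values xs []"
  proof (rule span_props(5)[OF 0(1)])
    fix ws assume "set ws \<subseteq> carrier G" "length xs + length ws = r"
    then show "val (xs @ ws) \<in> slot_values xs []"
      using 0 slot_values_contains[of xs "[]" "hd ws"] by (cases ws) auto
  qed (use slot_values_subgroup[of xs "[]"] 0 in auto)
  moreover have "slot_values xs [] \<subset> N 0" using no_slot[of xs "[]"] 0 unfolding slot_values_def by auto
  ultimately show ?case by blast
next
  case (Suc k)
  show ?case
  proof
    assume full: "span xs = N 0"
    have xs: "set xs \<subseteq> carrier G" by fact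
    have sub: "subgroup (span (xs @ [x])) G" "N 1 \<subseteq> span (xs @ [x])" "span (xs @ [x]) \<subset> N 0"
      if "x \<in> carrier G" for x
      using Suc.IH[of "xs @ [x]"] Suc.prems that span_props(1-3)[of "xs @ [x]"] by auto
    have inS: "val (xs @ x # ws) \<in> span (xs @ [x])"
      if "x \<in> carrier G" "set ws \<subseteq> carrier G" "length xs + length ws + 1 = r" for x ws
      using span_props(4)[of "xs @ [x]" ws] that xs by auto
    have pick: "\<exists>x ws. x \<in> carrier G \<and> set ws \<subseteq> carrier G \<and> length xs + length ws + 1 = r \<and> val (xs @ x # ws) \<notin> H"
      if H: "subgroup H G" "N 1 \<subseteq> H" "H \<subset> N 0" for H
    proof (rule ccontr)
      assume no: "\<not> ?thesis"
      have "span xs \<subseteq> H"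
      proof (rule span_props(5)[OF xs H(1,2)])
        fix ws assume ws: "set ws \<subseteq> carrier G" "length xs + length ws = r"
        then obtain x us where "ws = x # us" using Suc.prems by (cases ws) auto
        then show "val (xs @ ws) \<in> H" using no ws by auto
      qed
      then show False using full H by blast
    qed
    have "N 1 \<subset> N 0" using chain_1 chain_1_subset by blast
    then obtain x ws where x: "x \<in> carrier G" "set ws \<subseteq> carrier G" "length xs + length ws + 1 = r"
      and v: "val (xs @ x # ws) \<notin> N 1"
      using pick[OF chain_subgroup] by blast
    let ?S = "span (xs @ [x])"
    obtain x' ws' where x': "x' \<in> carrier G" "set ws' \<subseteq> carrier G" "length xs + length ws' + 1 = r"
      and v': "val (xs @ x' # ws') \<notin> ?S"
      using pick[OF sub[OF x(1)]] by blast
    let ?S' = "span (xs @ [x'])" and ?T = "slot_values xs ws" and ?T' = "slot_values xs ws'"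
    have T: "subgroup ?T G" "N 1 \<subseteq> ?T" "?T \<subset> N 0"
      using slot_values_subgroup[OF xs x(2,3)] no_slot[OF xs x(2,3)] unfolding slot_values_def by auto
    have T': "subgroup ?T' G" "N 1 \<subseteq> ?T'" "?T' \<subset> N 0"
      using slot_values_subgroup[OF xs x'(2,3)] no_slot[OF xs x'(2,3)] unfolding slot_values_def by auto
    \<comment> \<open>Otherwise the line \<open>?T\<close> shares a nonzero value with
      \<open>?S\<close> and one with \<open>?S'\<close>, so all three coincide, contrary to
      \<open>v'\<close>.\<close>
    have w1: "val (xs @ x' # ws) \<in> N 1"
    proof (rule ccontr)
      assume "val (xs @ x' # ws) \<notin> N 1"
      then have "?T = ?S'"
        using T sub[OF x'(1)] slot_values_contains[OF xs x(2,3) x'(1)] inS[OF x'(1) x(2,3)] subgroup_eq by metis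
      moreover have "?T = ?S"
        using T sub[OF x(1)] slot_values_contains[OF xs x(2,3) x(1)] inS[OF x] v subgroup_eq by metis
      ultimately show False using inS[OF x'] v' by simp
    qed
    \<comment> \<open>Otherwise \<open>?T'\<close> and \<open>?S\<close> coincide, although the
      value in \<open>v'\<close> belongs to \<open>?T'\<close> and not to \<open>?S\<close>.\<close>
    have w2: "val (xs @ x # ws') \<in> N 1"
    proof (rule ccontr)
      assume "val (xs @ x # ws') \<notin> N 1"
      then have "?T' = ?S"
        using T' sub[OF x(1)] slot_values_contains[OF xs x'(2,3) x(1)] inS[OF x(1) x'(2,3)] subgroup_eq by metis
      then show False using slot_values_contains[OF xs x'(2,3) x'(1)] v' by simp
    qed
    \<comment> \<open>With both mixed values trivial, the single entry \<open>?y\<close> reproduces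
      both of the chosen values: the first forces its span to be \<open>?S\<close>, the second lies
      outside \<open>?S\<close>.\<close>
    let ?y = "x \<otimes> x'"
    have y: "?y \<in> carrier G" using x x' by simp
    have c: "val (xs @ g # us) \<in> carrier G" if "g \<in> carrier G" "set us \<subseteq> carrier G" for g us
      using that xs by auto
    have "N 1 #> val (xs @ ?y # ws) = N 1 #> (val (xs @ x # ws) \<otimes> val (xs @ x' # ws))"
      by (rule value_mult[OF xs x(2,3) x(1) x'(1)])
    also have "\<dots> = N 1 #> val (xs @ x # ws)"
      by (rule coset_absorb_right[OF normal_chain c[OF x(1,2)] w1])
    finally have 1: "N 1 #> val (xs @ x # ws) = N 1 #> val (xs @ ?y # ws)" by simp
    have "N 1 #> val (xs @ ?y # ws') = N 1 #> (val (xs @ x # ws') \<otimes> val (xs @ x' # ws'))"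
      by (rule value_mult[OF xs x'(2,3) x(1) x'(1)])
    also have "\<dots> = N 1 #> val (xs @ x' # ws')"
      by (rule coset_absorb_left[OF normal_chain c[OF x'(1,2)] w2])
    finally have 2: "N 1 #> val (xs @ x' # ws') = N 1 #> val (xs @ ?y # ws')" by simp
    let ?Y = "span (xs @ [?y])"
    have "val (xs @ x # ws) \<in> ?Y"
      using coset_mem_subgroup[OF normal_chain sub(1,2)[OF y] c[OF x(1,2)] 1 inS[OF y x(2,3)]] .
    then have "?Y = ?S" using sub[OF y] sub[OF x(1)] inS[OF x] v subgroup_eq by metis
    moreover have "val (xs @ x' # ws') \<in> ?Y"
      using coset_mem_subgroup[OF normal_chain sub(1,2)[OF y] c[OF x'(1,2)] 2 inS[OF y x'(2,3)]] .
    ultimately show False using v' by simp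
  qed
qed

text \<open>The empty prefix has span \<open>N 0\<close>, so by \<open>span_proper\<close> some slot
  covers \<open>N 0 / N 1\<close>; if it is the first one, it is traded for the second.\<close>

lemma obtain_surjective_slot:
  obtains ys zs where "set ys \<subseteq> carrier G" "set zs \<subseteq> carrier G" "length ys + length zs + 1 = r"
    "ys \<noteq> []" "slot_values ys zs = N 0"
proof -
  have "lower_central G r \<subseteq> span []"
    by (rule lower_central_subset) (use span_props[of "[]"] in auto)
  then have "span [] = N 0" using span_props(3)[of "[]"] chain_0 by auto
  then obtain xs ws where w: "set xs \<subseteq> carrier G" "set ws \<subseteq> carrier G" "length xs + length ws + 1 = r"
    "slot_values xs ws = N 0"
    using span_proper[of "[]" "r - 1"] r by fastforce
  show ?thesis
  proof (cases xs)
    case Nil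
    then obtain z zs where ws: "ws = z # zs" using w r by (cases ws) auto
    have "slot_values [z] zs = N 0"
      using slot_values_swap[of z zs] w ws Nil unfolding slot_values_def by auto
    then show ?thesis using that[of "[z]" zs] w ws Nil by simp
  qed (use that w in blast)
qed

theorem surjective_rank_two:
  assumes p: "odd p" and e: "e = 1"
    and pow: "\<And>i n. n \<in> N (i + e) \<Longrightarrow> \<exists>m\<in>N i. N (i + e + 1) #> n = N (i + e + 1) #> (m [^] p)"
    and triv: "N l = {\<one>}"
  shows "\<exists>ys zs. set ys \<subseteq> carrier G \<and> set zs \<subseteq> carrier G \<and> length ys + length zs + 1 = r \<and>
    (\<forall>n\<in>N 0. \<exists>g\<in>carrier G. left_normed_commutator G (ys @ g # zs) = n)"
proof -
  obtain ys zs where w: "set ys \<subseteq> carrier G" "set zs \<subseteq> carrier G" "length ys + length zs + 1 = r"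
    "ys \<noteq> []" "slot_values ys zs = N 0"
    using obtain_surjective_slot .
  interpret S: central_chain_slot G N p e ys zs by unfold_locales (use w in auto)
  have level: "h \<in> upper 0 (length zs + length ys)" if "h \<in> carrier G" for h
    using carrier_upper[OF that] w(3) by (simp add: add.commute flip: w(3))
  have "\<exists>g\<in>carrier G. S.slot g = n" if n: "n \<in> N 0" for n
  proof (rule S.slot_surjective[OF _ pow triv n])
    fix i n assume "i < e" and n: "n \<in> N i"
    then have i: "i = 0" using e by simp
    have "n \<in> slot_values ys zs" using n w(5) i by simp
    then obtain h where "h \<in> carrier G" "N 1 #> S.slot h = N 1 #> n"
      unfolding slot_values_def S.slot_eq by blast
    then show "\<exists>h\<in>upper i (length zs + length ys). N (Suc i) #> S.slot h = N (Suc i) #> n \<and> S.good i h"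
      using S.good_odd_step_one[OF p e] level i by auto
  qed
  then show ?thesis using w unfolding S.slot_eq[symmetric] by blast
qed

end

section \<open>Finite p-groups\<close>

context group
begin

text \<open>The class equation: if only \<open>\<one>\<close> were central, every other conjugacy
  class would have size divisible by \<open>p\<close>.\<close>

lemma p_group_center_nontrivial:
  assumes fin: "finite (carrier G)" and p: "Factorial_Ring.prime p" and ord: "order G = p ^ m" "m \<ge> 1"
  shows "\<exists>z\<in>carrier G. z \<noteq> \<one> \<and> (\<forall>x\<in>carrier G. cm z x = \<one>)"
proof (rule ccontr)
  assume no: "\<not> ?thesis"
  define \<phi> where "\<phi> = (\<lambda>g. \<lambda>h \<in> carrier G. g \<otimes> h \<otimes> inv g)"
  interpret A: group_action G "carrier G" \<phi> unfolding \<phi>_def by (rule action_by_conjugation)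
  let ?O = "orbits G (carrier G) \<phi>"
  have orb: "orbit G \<phi> x = {g \<otimes> x \<otimes> inv g | g. g \<in> carrier G}" if "x \<in> carrier G" for x
    using that by (auto simp: orbit_def \<phi>_def)
  have fO: "finite ?O" using fin by (auto simp: orbits_def)
  have one: "orbit G \<phi> \<one> = {\<one>}"
  proof -
    have "{g \<otimes> \<one> \<otimes> inv g | g. g \<in> carrier G} = (\<lambda>g. \<one>) ` carrier G" by (force simp: image_def)
    then show ?thesis using orb[OF one_closed] by auto
  qed
  have "p dvd card ob" if ob: "ob \<in> ?O - {{\<one>}}" for ob
  proof -
    obtain x where x: "x \<in> carrier G" "ob = orbit G \<phi> x" using ob unfolding orbits_def by blast
    have "x \<noteq> \<one>" using x one ob by blast
    then obtain g where g: "g \<in> carrier G" "cm x g \<noteq> \<one>" using no x by blast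
    have "card ob dvd p ^ m" using A.orbit_stabilizer_theorem[OF x(1)] ord x by (metis dvd_triv_left)
    then obtain k where k: "card ob = p ^ k" using p by (metis divides_primepow_nat)
    have "card ob \<noteq> 1"
    proof
      assume "card ob = 1"
      then obtain z where z: "ob = {z}" by (auto simp: card_1_singleton_iff)
      have "x \<in> ob" using A.orbit_refl x by blast
      moreover have "g \<otimes> x \<otimes> inv g \<in> ob" using orb x g by auto
      ultimately have "g \<otimes> x \<otimes> inv g = x" using z by auto
      then have "g \<otimes> x \<otimes> inv g \<otimes> g = x \<otimes> g" by simp
      then have "g \<otimes> x = x \<otimes> g" using x g by (simp add: m_assoc)
      then show False using g x commutator_eq_one_iff by simp
    qed
    then show ?thesis using k by (cases k) auto
  qed
  then have "p dvd (\<Sum>ob\<in>?O - {{\<one>}}. card ob)" by (rule dvd_sum)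
  moreover have "(\<Sum>ob\<in>?O. card ob) = order G"
    using A.disjoint_sum[OF fin, of "\<lambda>_. 1::nat"] by (simp add: order_def)
  moreover have "{\<one>} \<in> ?O" using one by (auto simp: orbits_def)
  then have "(\<Sum>ob\<in>?O. card ob) = card {\<one>} + (\<Sum>ob\<in>?O - {{\<one>}}. card ob)"
    using fO by (rule_tac sum.remove) auto
  ultimately have "p dvd order G \<and> order G = 1 + (\<Sum>ob\<in>?O - {{\<one>}}. card ob) \<and> p dvd (\<Sum>ob\<in>?O - {{\<one>}}. card ob)"
    using ord by (simp add: dvd_power)
  then have "p dvd 1" by (metis dvd_add_left_iff)
  then show False using p by (metis not_prime_unit)
qed

text \<open>The last nontrivial term among the iterated \<open>p\<close>-th powers of a central
  element.\<close>

lemma p_group_central_element: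
  assumes fin: "finite (carrier G)" and p: "Factorial_Ring.prime p" and ord: "order G = p ^ m" "m \<ge> 1"
  shows "\<exists>z\<in>carrier G. z \<noteq> \<one> \<and> z [^] p = \<one> \<and> (\<forall>x\<in>carrier G. cm z x = \<one>)"
proof -
  obtain z where z: "z \<in> carrier G" "z \<noteq> \<one>" "\<forall>x\<in>carrier G. cm z x = \<one>"
    using p_group_center_nontrivial[OF assms] by blast
  define j where "j = (LEAST j. z [^] (p ^ j) = \<one>)"
  have "z [^] (p ^ m) = \<one>" using pow_order_eq_1[OF z(1)] ord by simp
  then have j: "z [^] (p ^ j) = \<one>" unfolding j_def by (rule LeastI)
  then have "j \<noteq> 0" using z by (cases j) auto
  then obtain i where i: "j = Suc i" by (cases j) auto
  then have ne: "z [^] (p ^ i) \<noteq> \<one>" using not_less_Least[of i "\<lambda>j. z [^] (p ^ j) = \<one>"] j_def by auto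
  let ?w = "z [^] (p ^ i)"
  have 1: "?w [^] p = \<one>" using j z(1) i by (simp add: nat_pow_pow mult.commute)
  have 2: "cm ?w x = \<one>" if "x \<in> carrier G" for x
  proof -
    have "z \<otimes> x = x \<otimes> z" using that z commutator_eq_one_iff by blast
    from commute_pow_left[OF z(1) that this]
    show ?thesis using that z(1) commutator_eq_one_iff[of ?w x] by simp
  qed
  show ?thesis
    by (rule bexI[of _ ?w]) (use ne z(1) 1 2 in blast, use z(1) in simp)
qed

text \<open>Each step adds the elements that are central and of exponent \<open>p\<close> in the
  quotient by the previous term. This ascending series is the yardstick for showing that the
  descending chains become trivial.\<close>

primrec central_series :: "nat \<Rightarrow> nat \<Rightarrow> 'a set" where
  "central_series p 0 = {\<one>}"
| "central_series p (Suc k) = {g \<in> carrier G. g [^] p \<in> central_series p k} \<inter>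
     {g \<in> carrier G. \<forall>x\<in>carrier G. cm g x \<in> central_series p k}"

lemma central_series_normal: "central_series p k \<lhd> G"
proof (induction k)
  case 0
  then show ?case by (simp add: one_is_normal)
next
  case (Suc k)
  let ?Z = "central_series p k" and ?Y = "central_series p (Suc k)"
  have Y: "{g \<in> carrier G. \<forall>x\<in>carrier G. cm g x \<in> ?Z} \<lhd> G"
    by (rule normal_commutator_left) fact
  note Ysub = normal_imp_subgroup[OF Y]
  have "subgroup ?Y G"
  proof (rule subgroupI)
    show "?Y \<noteq> {}" using subgroup.one_closed[OF Ysub] normal_one_closed[OF Suc]
      by (auto intro!: exI[of _ \<one>])
    fix g assume g: "g \<in> ?Y"
    then show "inv g \<in> ?Y" using subgroup.m_inv_closed[OF Ysub] normal_inv_closed[OF Suc]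
      by (auto simp: nat_pow_inv)
    fix h assume h: "h \<in> ?Y"
    have c: "cm h g \<in> ?Z" using g h by simp
    note n = normal_commutator_closed[OF Suc c]
    have "?Z #> ((g \<otimes> h) [^] p) = ?Z #> (g [^] p \<otimes> h [^] p \<otimes> cm h g [^] (p choose 2))"
      by (rule coset_mult_pow_class_two[OF Suc]) (use g h n in auto)
    moreover have "g [^] p \<otimes> h [^] p \<otimes> cm h g [^] (p choose 2) \<in> ?Z"
      using g h normal_mult_closed[OF Suc] subgroup_pow_closed[OF normal_imp_subgroup[OF Suc] c] by simp
    ultimately have "(g \<otimes> h) [^] p \<in> ?Z"
      using g h coset_mem_subgroup[OF Suc normal_imp_subgroup[OF Suc] order_refl] by simp
    moreover have "g \<otimes> h \<in> {g \<in> carrier G. \<forall>x\<in>carrier G. cm g x \<in> ?Z}"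
      using g h subgroup.m_closed[OF Ysub] by simp
    ultimately show "g \<otimes> h \<in> ?Y" by simp
  qed auto
  moreover have "x \<otimes> h \<otimes> inv x \<in> ?Y" if x: "x \<in> carrier G" and h: "h \<in> ?Y" for x h
  proof -
    have hc: "h \<in> carrier G" using h by simp
    have "(x \<otimes> h \<otimes> inv x) [^] n = x \<otimes> h [^] n \<otimes> inv x" for n :: nat
      by (induction n) (use x hc in \<open>auto simp: word_simps\<close>)
    then show ?thesis using normal.inv_op_closed2[OF Y x] normal.inv_op_closed2[OF Suc x] h x by simp
  qed
  ultimately show ?case using normal_inv_iff by blast
qed

lemma central_series_mono: "central_series p k \<subseteq> central_series p (Suc k)"
  using normal_mem_carrier[OF central_series_normal]
    subgroup_pow_closed[OF normal_imp_subgroup[OF central_series_normal]]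
    normal_commutator_closed[OF central_series_normal] by auto

text \<open>The quotient is a nontrivial \<open>p\<close>-group and so has a central element of
  order \<open>p\<close>.\<close>

lemma central_series_strict:
  assumes fin: "finite (carrier G)" and p: "Factorial_Ring.prime p" and ord: "order G = p ^ m"
    and ne: "central_series p k \<noteq> carrier G"
  shows "central_series p k \<subset> central_series p (Suc k)"
proof -
  let ?Z = "central_series p k"
  note Z = central_series_normal[of p k]
  let ?Q = "G Mod ?Z"
  interpret Q: group ?Q by (rule normal.factorgroup_is_group[OF Z])
  have finQ: "finite (carrier ?Q)" using fin by (simp add: carrier_FactGroup)
  have "order ?Q * card ?Z = order G"
    using lagrange[OF normal_imp_subgroup[OF Z]] by (simp add: FactGroup_def order_def)
  then have "order ?Q dvd p ^ m" using ord by (metis dvd_triv_left)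
  then obtain l where l: "order ?Q = p ^ l" using p by (metis divides_primepow_nat)
  have "l \<noteq> 0"
  proof
    assume "l = 0"
    then have "card (carrier ?Q) = 1" using l by (simp add: order_def)
    then obtain q where q: "carrier ?Q = {q}" by (auto simp: card_1_singleton_iff)
    have "x \<in> ?Z" if x: "x \<in> carrier G" for x
    proof -
      have "?Z #> x = \<one>\<^bsub>?Q\<^esub>" using coset_carrier[OF x, of ?Z] Q.one_closed q by (metis singletonD)
      then show ?thesis using coset_eq_one_iff[OF Z x] by blast
    qed
    then show False using ne normal_mem_carrier[OF Z] by blast
  qed
  then obtain q where q: "q \<in> carrier ?Q" "q \<noteq> \<one>\<^bsub>?Q\<^esub>" "q [^]\<^bsub>?Q\<^esub> p = \<one>\<^bsub>?Q\<^esub>"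
    "\<forall>x\<in>carrier ?Q. commutator ?Q q x = \<one>\<^bsub>?Q\<^esub>"
    using Q.p_group_central_element[OF finQ p l] by auto
  obtain g where g: "g \<in> carrier G" "q = ?Z #> g" using q(1) by (auto simp: carrier_FactGroup)
  have "g \<notin> ?Z" using q(2) g coset_eq_one_iff[OF Z] by blast
  moreover have "g [^] p \<in> ?Z"
    using q(3) g coset_eq_one_iff[OF Z] coset_pow[OF Z] nat_pow_closed by metis
  moreover have "cm g x \<in> ?Z" if x: "x \<in> carrier G" for x
    using q(4) g x coset_eq_one_iff[OF Z] coset_commutator[OF Z] coset_carrier commutator_closed by metis
  ultimately have "g \<in> central_series p (Suc k) - ?Z" using g by simp
  then show ?thesis using central_series_mono by blast
qed

lemma central_series_top:
  assumes fin: "finite (carrier G)" and p: "Factorial_Ring.prime p" and ord: "order G = p ^ m"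
  shows "\<exists>k. central_series p k = carrier G"
proof (rule ccontr)
  assume no: "\<not> ?thesis"
  have sub: "central_series p k \<subseteq> carrier G" for k
    using normal_mem_carrier[OF central_series_normal] by blast
  have "k \<le> card (central_series p k)" for k
  proof (induction k)
    case (Suc k)
    have "card (central_series p k) < card (central_series p (Suc k))"
      using central_series_strict[OF assms, of k] no sub fin by (meson finite_subset psubset_card_mono)
    then show ?case using Suc by simp
  qed simp
  moreover have "card (central_series p k) \<le> card (carrier G)" for k
    using sub fin by (meson card_mono)
  ultimately show False by (metis le_trans not_less_eq_eq order_refl)
qed

section \<open>Orders of subgroups\<close>

lemma card_subgroup_step:
  assumes fin: "finite (carrier G)" and p: "Factorial_Ring.prime p" and ord: "order G = p ^ m"
    and A: "subgroup A G" and B: "subgroup B G" and AB: "A \<subset> B"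
  shows "p * card A \<le> card B"
proof -
  have pow: "\<exists>k. card H = p ^ k" if "subgroup H G" for H
    using lagrange[OF that] ord p by (metis divides_primepow_nat dvd_triv_right)
  obtain a b where a: "card A = p ^ a" and b: "card B = p ^ b" using pow A B by blast
  have "card A < card B"
    using AB subgroup.subset[OF B] fin by (meson finite_subset psubset_card_mono)
  then have "a < b" using a b p prime_gt_1_nat by (metis power_less_imp_less_exp)
  then have "p ^ Suc a \<le> p ^ b" using p prime_gt_0_nat[of p] by (intro power_increasing) auto
  then show ?thesis using a b by simp
qed

text \<open>Modulo \<open>F\<close> the generators commute and have orders dividing \<open>q\<close>
  and \<open>l\<close>, so every element is congruent to a power of \<open>a\<close> below
  \<open>q\<close> times a power of \<open>b\<close> below \<open>l\<close>.\<close>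

lemma card_generate_two:
  assumes fin: "finite (carrier G)" and F: "F \<lhd> G" and ab: "a \<in> carrier G" "b \<in> carrier G"
    and q: "q > 0" "l > 0" "a [^] (q::nat) \<in> F" "b [^] (l::nat) \<in> F" "cm a b \<in> F"
  shows "card (generate G {a, b}) \<le> q * l * card F"
proof -
  have ex: "\<exists>i j. F #> x = F #> (a [^] (i::nat) \<otimes> b [^] (j::nat))" if "x \<in> generate G {a, b}" for x
    using that
  proof (induction rule: generate.induct)
    case one
    then show ?case by (intro exI[of _ 0]) simp
  next
    case (incl h)
    then show ?case
    proof (elim insertE emptyE)
      show "h = a \<Longrightarrow> ?thesis" using ab by (intro exI[of _ 1] exI[of _ 0]) simp
      show "h = b \<Longrightarrow> ?thesis" using ab by (intro exI[of _ 0] exI[of _ 1]) simp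
    qed
  next
    case (inv h)
    \<comment> \<open>Exponents are natural numbers, so inverses of the generators are rewritten as
      powers modulo \<open>F\<close>.\<close>
    have *: "F #> inv x = F #> (x [^] (n - 1))" if "x \<in> carrier G" "n > 0" "x [^] n \<in> F" for x and n :: nat
    proof (subst coset_eq_iff[OF F])
      have "inv (x [^] (n - 1)) \<otimes> inv x = inv (x \<otimes> x [^] (n - 1))" using that by (simp add: inv_mult_group)
      also have "x \<otimes> x [^] (n - 1) = x [^] n"
        using that by (metis Suc_pred' nat_pow_Suc2)
      finally show "inv (x [^] (n - 1)) \<otimes> inv x \<in> F" using that normal_inv_closed[OF F] by simp
    qed (use that in auto)
    from inv show ?case
    proof (elim insertE emptyE)
      show "h = a \<Longrightarrow> ?thesis" using *[OF ab(1) q(1,3)] ab by (intro exI[of _ "q - 1"] exI[of _ 0]) simp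
      show "h = b \<Longrightarrow> ?thesis" using *[OF ab(2) q(2,4)] ab by (intro exI[of _ 0] exI[of _ "l - 1"]) simp
    qed
  next
    case (eng g h)
    then obtain i j i' j' :: nat where g: "F #> g = F #> (a [^] i \<otimes> b [^] j)"
      and h: "F #> h = F #> (a [^] i' \<otimes> b [^] j')" by blast
    have c: "g \<in> carrier G" "h \<in> carrier G" using eng generate_in_carrier[of "{a, b}"] ab by auto
    have sw: "F #> (b [^] j \<otimes> a [^] i') = F #> (a [^] i' \<otimes> b [^] j)"
    proof -
      interpret Q: group "G Mod F" by (rule normal.factorgroup_is_group[OF F])
      have "(F #> b) \<otimes>\<^bsub>G Mod F\<^esub> (F #> a) = (F #> a) \<otimes>\<^bsub>G Mod F\<^esub> (F #> b)"
        using coset_commute_Mod[OF F ab q(5)] by simp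
      from Q.commute_pow_pow[OF coset_carrier[OF ab(2)] coset_carrier[OF ab(1)] this]
      show ?thesis using ab by (simp only: coset_mult[OF F] coset_pow[OF F] nat_pow_closed)
    qed
    have "F #> (g \<otimes> h) = F #> ((a [^] i \<otimes> b [^] j) \<otimes> (a [^] i' \<otimes> b [^] j'))"
      using c g h ab by (intro coset_mult_cong[OF F]) auto
    also have "\<dots> = F #> ((a [^] i \<otimes> (b [^] j \<otimes> a [^] i')) \<otimes> b [^] j')"
      using ab by (simp add: m_assoc)
    also have "\<dots> = F #> ((a [^] i \<otimes> (a [^] i' \<otimes> b [^] j)) \<otimes> b [^] j')"
      by (rule coset_mult_cong[OF F _ _ _ _ coset_mult_cong[OF F _ _ _ _ refl sw] refl]) (use ab in auto)
    also have "(a [^] i \<otimes> (a [^] i' \<otimes> b [^] j)) \<otimes> b [^] j' = (a [^] i \<otimes> a [^] i') \<otimes> (b [^] j \<otimes> b [^] j')"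
      using ab by (simp add: m_assoc)
    also have "\<dots> = a [^] (i + i') \<otimes> b [^] (j + j')" using ab by (simp add: nat_pow_mult)
    finally show ?case by blast
  qed
  have red: "F #> (x [^] i) = F #> (x [^] (i mod n))" if "x \<in> carrier G" "x [^] n \<in> F" for x and i n :: nat
  proof -
    have "x [^] i = x [^] (i mod n) \<otimes> (x [^] n) [^] (i div n)"
      using that by (simp add: nat_pow_pow nat_pow_mult)
    then show ?thesis
      using that coset_absorb_right[OF F] subgroup_pow_closed[OF normal_imp_subgroup[OF F]] by simp
  qed
  let ?I = "{..<q} \<times> {..<l}" and ?c = "\<lambda>(i, j). F #> (a [^] (i::nat) \<otimes> b [^] (j::nat))"
  have Fc: "F \<subseteq> carrier G" using normal_mem_carrier[OF F] by blast
  have "generate G {a, b} \<subseteq> (\<Union>ij\<in>?I. ?c ij)"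
  proof
    fix x assume x: "x \<in> generate G {a, b}"
    then have xc: "x \<in> carrier G" using generate_in_carrier[of "{a, b}"] ab by auto
    from ex[OF x] obtain i j :: nat where ij: "F #> x = F #> (a [^] i \<otimes> b [^] j)"
      by (elim exE)
    note ij
    also have "\<dots> = F #> (a [^] (i mod q) \<otimes> b [^] (j mod l))"
      by (rule coset_mult_cong[OF F _ _ _ _ red[OF ab(1) q(3)] red[OF ab(2) q(4)]]) (use ab in auto)
    finally have "x \<in> F #> (a [^] (i mod q) \<otimes> b [^] (j mod l))"
      using rcos_self[OF xc normal_imp_subgroup[OF F]] by simp
    moreover have "(i mod q, j mod l) \<in> ?I" using q by simp
    ultimately show "x \<in> (\<Union>ij\<in>?I. ?c ij)" by fastforce
  qed
  moreover have "finite (\<Union>ij\<in>?I. ?c ij)"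
    using fin Fc ab by (intro finite_UN_I) (auto intro!: finite_subset[OF r_coset_subset_G])
  ultimately have "card (generate G {a, b}) \<le> card (\<Union>ij\<in>?I. ?c ij)" by (rule_tac card_mono)
  also have "\<dots> \<le> (\<Sum>ij\<in>?I. card (?c ij))" by (rule card_UN_le) simp
  also have "\<dots> = (\<Sum>ij\<in>?I. card F)"
    using ab Fc by (intro sum.cong) (auto intro!: card_rcosets_equal[symmetric] rcosetsI)
  also have "\<dots> = q * l * card F" by simp
  finally show ?thesis .
qed

end

section \<open>Power images and the chains generated by powers and commutators\<close>

context central_chain
begin

lemma chain_in_derived: "x \<in> N i \<Longrightarrow> x \<in> lower_central G 2"
  using chain_antimono[of 0 i] chain_derived by auto

text \<open>Both elements are derived, so \<open>cm y x\<close> lies two steps further down and the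
  class-two correction vanishes.\<close>

lemma chain_pow_mult:
  assumes "x \<in> N i" "y \<in> N i"
  shows "N (i + e + 1) #> ((x \<otimes> y) [^] p) = N (i + e + 1) #> (x [^] p \<otimes> y [^] p)"
proof -
  let ?M = "N (i + e + 1)"
  have c: "x \<in> carrier G" "y \<in> carrier G" using assms chain_carrier by auto
  have yx: "cm y x \<in> upper (i + 2) 0"
    using upper_commutator_derived[of y i 0 x] assms chain_in_derived by simp
  have le: "N (Suc (i + 2)) \<subseteq> ?M" by (rule chain_antimono) (use exponent_step in auto)
  have n: "cm (cm y x) g \<in> ?M" if "g \<in> carrier G" for g
    using commutator_chain[of "cm y x" "i + 2" g] yx that le by auto
  have b: "cm y x [^] (p choose 2) \<in> ?M"
    using binomial_pow_upper[OF yx upper_pow_prime] by simp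
  have "?M #> ((x \<otimes> y) [^] p) = ?M #> (x [^] p \<otimes> y [^] p \<otimes> cm y x [^] (p choose 2))"
    by (rule coset_mult_pow_class_two[OF normal_chain c n[OF c(1)] n[OF c(2)]])
  also have "\<dots> = ?M #> (x [^] p \<otimes> y [^] p)"
    by (rule coset_absorb_right[OF normal_chain _ b]) (use c in simp)
  finally show ?thesis .
qed

lemma power_image_subgroup:
  "subgroup {n \<in> N (i + e). \<exists>m\<in>N i. N (i + e + 1) #> n = N (i + e + 1) #> (m [^] p)} G"
    (is "subgroup ?K G")
proof (rule subgroupI)
  show "?K \<subseteq> carrier G" using chain_carrier by auto
  have "\<one> \<in> ?K" using normal_one_closed[OF normal_chain]
    by (auto intro!: bexI[of _ \<one>])
  then show "?K \<noteq> {}" by blast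
next
  fix n assume "n \<in> ?K"
  then obtain m where m: "n \<in> N (i + e)" "m \<in> N i" "N (i + e + 1) #> n = N (i + e + 1) #> (m [^] p)"
    by blast
  have c: "n \<in> carrier G" "m \<in> carrier G" using m chain_carrier by auto
  have "N (i + e + 1) #> inv n = N (i + e + 1) #> inv (m [^] p)"
    by (rule coset_inv_cong[OF normal_chain _ _ m(3)]) (use c in auto)
  then have "N (i + e + 1) #> inv n = N (i + e + 1) #> (inv m [^] p)"
    using c by (simp add: nat_pow_inv)
  then show "inv n \<in> ?K" using m normal_inv_closed[OF normal_chain] by blast
next
  fix n n' assume "n \<in> ?K" "n' \<in> ?K"
  then obtain m m' where m: "n \<in> N (i + e)" "m \<in> N i" "N (i + e + 1) #> n = N (i + e + 1) #> (m [^] p)"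
    and m': "n' \<in> N (i + e)" "m' \<in> N i" "N (i + e + 1) #> n' = N (i + e + 1) #> (m' [^] p)"
    by blast
  have c: "n \<in> carrier G" "m \<in> carrier G" "n' \<in> carrier G" "m' \<in> carrier G"
    using m m' chain_carrier by auto
  have "N (i + e + 1) #> (n \<otimes> n') = N (i + e + 1) #> (m [^] p \<otimes> m' [^] p)"
    by (rule coset_mult_cong[OF normal_chain _ _ _ _ m(3) m'(3)]) (use c in auto)
  also have "\<dots> = N (i + e + 1) #> ((m \<otimes> m') [^] p)"
    by (rule chain_pow_mult[OF m(2) m'(2), symmetric])
  finally show "n \<otimes> n' \<in> ?K" using m m' normal_mult_closed[OF normal_chain] by blast
qed

lemma power_image_if_generated:
  assumes gen: "N (i + e) \<subseteq> generate G ({x [^] p | x. x \<in> N i} \<union> S)"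
    and S: "\<And>x. x \<in> S \<Longrightarrow> x \<in> N (i + e) \<and> (\<exists>m\<in>N i. N (i + e + 1) #> x = N (i + e + 1) #> (m [^] p))"
    and n: "n \<in> N (i + e)"
  shows "\<exists>m\<in>N i. N (i + e + 1) #> n = N (i + e + 1) #> (m [^] p)"
proof -
  let ?K = "{n \<in> N (i + e). \<exists>m\<in>N i. N (i + e + 1) #> n = N (i + e + 1) #> (m [^] p)}"
  have "generate G ({x [^] p | x. x \<in> N i} \<union> S) \<subseteq> ?K"
    by (rule generate_subgroup_incl[OF _ power_image_subgroup]) (use S pow_chain in auto)
  then show ?thesis using gen n by blast
qed

text \<open>Surjectivity of the power map propagates down the chain: if \<open>x\<close> is
  congruent to \<open>m [^] p\<close>, then the generator \<open>cm x g\<close> is congruent to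
  \<open>cm m g [^] p\<close>.\<close>

lemma power_image:
  assumes gen: "\<And>i. N (Suc i + e) \<subseteq> generate G ({x [^] p | x. x \<in> N (Suc i)} \<union> {cm x g | x g. x \<in> N (i + e) \<and> g \<in> carrier G})"
    and base: "N e \<subseteq> generate G ({x [^] p | x. x \<in> N 0} \<union> N (Suc e))"
  shows "n \<in> N (i + e) \<Longrightarrow> \<exists>m\<in>N i. N (i + e + 1) #> n = N (i + e + 1) #> (m [^] p)"
proof (induction i arbitrary: n)
  case 0
  have "x \<in> N (0 + e) \<and> (\<exists>m\<in>N 0. N (0 + e + 1) #> x = N (0 + e + 1) #> (m [^] p))" if x: "x \<in> N (Suc e)" for x
  proof -
    have "N (Suc e) #> x = N (Suc e) #> (\<one> [^] p)"
      using x chain_carrier[OF x] coset_eq_iff[OF normal_chain, of x \<one>] by simp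
    then show ?thesis using x chain_Suc_subset[of e] normal_one_closed[OF normal_chain]
      by (auto intro!: bexI[of _ \<one>])
  qed
  then show ?case using power_image_if_generated[of 0 "N (Suc e)" n] base 0 by simp
next
  case (Suc i)
  show ?case
  proof (rule power_image_if_generated[OF gen _ Suc.prems])
    fix z assume "z \<in> {cm x g | x g. x \<in> N (i + e) \<and> g \<in> carrier G}"
    then obtain x g where z: "z = cm x g" and x: "x \<in> N (i + e)" and g: "g \<in> carrier G" by blast
    let ?j = "Suc i + e + 1"
    obtain m where m: "m \<in> N i" "N (i + e + 1) #> x = N (i + e + 1) #> (m [^] p)"
      using Suc.IH[OF x] by blast
    have c: "x \<in> carrier G" "m \<in> carrier G" using x m chain_carrier by auto
    have sub: "N (i + e + 1) \<subseteq> upper ?j 1"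
      using upper_subset_Suc_Suc[of "i + e + 1" 0] by simp
    have "upper ?j 1 #> x = upper ?j 1 #> (m [^] p)"
      by (rule coset_mono[OF normal_chain upper_normal sub _ _ m(2)]) (use c in auto)
    \<comment> \<open>Written over a one-element list, the commutator falls under the lemmas on
      iterated commutators.\<close>
    then have "N ?j #> fc x [g] = N ?j #> fc (m [^] p) [g]"
      using c g by (intro foldl_commutator_cong) auto
    also have "\<dots> = N ?j #> (fc m [g] [^] p)"
    proof -
      have "m \<in> upper (Suc i) (length [g])" using m upper_subset_Suc_Suc[of i 0] by auto
      from foldl_commutator_prime_pow[OF chain_in_derived[OF m(1)] this] show ?thesis using g by simp
    qed
    finally have "N ?j #> z = N ?j #> (cm m g [^] p)" by (simp add: z)
    moreover have "cm m g \<in> N (Suc i)" using commutator_chain m g by blast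
    moreover have "z \<in> N (Suc i + e)" using commutator_chain[OF x g] by (simp add: z)
    ultimately show "z \<in> N (Suc i + e) \<and> (\<exists>m\<in>N (Suc i). N ?j #> z = N ?j #> (m [^] p))" by blast
  qed
qed

text \<open>The \<open>p\<close>-th power map induces a homomorphism from \<open>N 0 / N 1\<close>
  onto \<open>N 1 / N 2\<close>, and intermediate subgroups pull back along it.\<close>

lemma no_intermediate_step:
  assumes e: "e = 1" and min: "no_intermediate (N 1) (N 0)"
    and pow: "\<And>n. n \<in> N 1 \<Longrightarrow> \<exists>m\<in>N 0. N 2 #> n = N 2 #> (m [^] p)"
  shows "no_intermediate (N 2) (N 1)"
  unfolding no_intermediate_def
proof (intro allI impI)
  fix K assume K: "subgroup K G" "N 2 \<subseteq> K" "K \<subseteq> N 1"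
  have pm: "N 2 #> ((x \<otimes> y) [^] p) = N 2 #> (x [^] p \<otimes> y [^] p)" if "x \<in> N 0" "y \<in> N 0" for x y
    using chain_pow_mult[OF that] by (simp add: e numeral_2_eq_2)
  have mem: "x \<in> K" if "x \<in> carrier G" "N 2 #> x = N 2 #> y" "y \<in> K" for x y
    using coset_mem_subgroup[OF normal_chain K(1,2) that] .
  let ?J = "{n \<in> N 0. n [^] p \<in> K}"
  have "subgroup ?J G"
  proof (rule subgroupI)
    show "?J \<subseteq> carrier G" using chain_carrier by auto
    have "\<one> \<in> ?J" using normal_one_closed[OF normal_chain] subgroup.one_closed[OF K(1)] by simp
    then show "?J \<noteq> {}" by blast
    fix n assume n: "n \<in> ?J"
    then show "inv n \<in> ?J" using normal_inv_closed[OF normal_chain] subgroup.m_inv_closed[OF K(1)] chain_carrier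
      by (auto simp: nat_pow_inv)
    fix m assume m: "m \<in> ?J"
    have "(n \<otimes> m) [^] p \<in> K"
      by (rule mem[OF _ pm]) (use n m chain_carrier subgroup.m_closed[OF K(1)] in auto)
    then show "n \<otimes> m \<in> ?J" using n m normal_mult_closed[OF normal_chain] by simp
  qed
  moreover have p1: "n [^] p \<in> N 2" if "n \<in> N 1" for n
    using pow_chain[OF that] by (simp add: e numeral_2_eq_2)
  then have "N 1 \<subseteq> ?J" using K(2) chain_Suc_subset[of 0] by auto
  ultimately have "?J = N 1 \<or> ?J = N 0" using min unfolding no_intermediate_def by blast
  then show "K = N 2 \<or> K = N 1"
  proof
    assume J: "?J = N 0"
    have "N 1 \<subseteq> K"
    proof
      fix n assume n: "n \<in> N 1"
      obtain m where "m \<in> N 0" "N 2 #> n = N 2 #> (m [^] p)" using pow[OF n] by blast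
      then show "n \<in> K" using mem[of n "m [^] p"] J n chain_carrier by blast
    qed
    then show ?thesis using K by blast
  next
    assume J: "?J = N 1"
    have "K \<subseteq> N 2"
    proof
      fix k assume k: "k \<in> K"
      then have k1: "k \<in> N 1" using K by blast
      then obtain m where m: "m \<in> N 0" "N 2 #> k = N 2 #> (m [^] p)" using pow by blast
      have mc: "m [^] p \<in> carrier G" using m chain_carrier by simp
      have "m [^] p \<in> K" using mem[OF mc m(2)[symmetric] k] .
      then have "m \<in> N 1" using J m by blast
      then have "m [^] p \<in> N 2" by (rule p1)
      then show "k \<in> N 2" using coset_chain_mem_iff[OF _ mc m(2)] k1 chain_carrier by blast
    qed
    then show ?thesis using K by blast
  qed
qed

end

section \<open>Chains descending from \<open>lower_central G r\<close>\<close>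

context group
begin

text \<open>
  The \<open>p\<close>-th powers of term \<open>i\<close> enter at term \<open>i + e\<close>; for the first terms the subtraction
  truncates and reads term \<open>0\<close>.
\<close>

fun exponent_chain :: "nat \<Rightarrow> nat \<Rightarrow> nat \<Rightarrow> nat \<Rightarrow> 'a set" where
  "exponent_chain p e r 0 = lower_central G r"
| "exponent_chain p e r (Suc i) = generate G ({x [^] p | x. x \<in> exponent_chain p e r (i - (e - 1))} \<union>
    {cm x g | x g. x \<in> exponent_chain p e r i \<and> g \<in> carrier G})"

lemma conj_left_normed_commutator:
  assumes "set xs \<subseteq> carrier G" "g \<in> carrier G"
  shows "g \<otimes> left_normed_commutator G xs \<otimes> inv g
    = left_normed_commutator G (map (\<lambda>x. g \<otimes> x \<otimes> inv g) xs)"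
  using assms
proof (induction xs rule: rev_induct)
  case (snoc x xs)
  show ?case
  proof (cases "xs = []")
    case False
    let ?w = "left_normed_commutator G xs"
    have "?w \<in> carrier G" using snoc.prems by auto
    then have "g \<otimes> cm ?w x \<otimes> inv g = cm (g \<otimes> ?w \<otimes> inv g) (g \<otimes> x \<otimes> inv g)"
      using snoc.prems by (simp add: word_simps)
    then show ?thesis using snoc False by (simp add: left_normed_commutator_snoc)
  qed simp
qed simp

lemma conj_nat_pow:
  "x \<in> carrier G \<Longrightarrow> g \<in> carrier G \<Longrightarrow> g \<otimes> x [^] (n::nat) \<otimes> inv g = (g \<otimes> x \<otimes> inv g) [^] n"
proof (induction n)
  case (Suc n)
  have "g \<otimes> x [^] Suc n \<otimes> inv g = (g \<otimes> x [^] n \<otimes> inv g) \<otimes> (g \<otimes> x \<otimes> inv g)"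
    using Suc.prems by (simp add: word_simps)
  then show ?case using Suc by simp
qed simp

lemma lower_central_normal: "lower_central G r \<lhd> G"
  unfolding lower_central_def
proof (rule normal_generateI)
  fix h g assume "h \<in> {left_normed_commutator G gs | gs. length gs = r \<and> set gs \<subseteq> carrier G}" and g: "g \<in> carrier G"
  then obtain gs where "h = left_normed_commutator G gs" "length gs = r" "set gs \<subseteq> carrier G" by blast
  then show "g \<otimes> h \<otimes> inv g \<in> {left_normed_commutator G gs | gs. length gs = r \<and> set gs \<subseteq> carrier G}"
    using g conj_left_normed_commutator[of gs g]
    by (auto intro!: exI[of _ "map (\<lambda>x. g \<otimes> x \<otimes> inv g) gs"] simp: subset_iff)
qed auto

text \<open>The generating set is itself closed under conjugation.\<close>

lemma generate_powers_commutators_normal: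
  assumes A: "A \<lhd> G" and B: "B \<lhd> G" and C: "C \<lhd> G"
  shows "generate G ({x [^] (p::nat) | x. x \<in> A} \<union> {cm x y | x y. x \<in> B \<and> y \<in> C}) \<lhd> G"
proof (rule normal_generateI)
  note c = A[THEN normal_mem_carrier] B[THEN normal_mem_carrier] C[THEN normal_mem_carrier]
  show "{x [^] p | x. x \<in> A} \<union> {cm x y | x y. x \<in> B \<and> y \<in> C} \<subseteq> carrier G" using c by auto
  fix h g assume h: "h \<in> {x [^] p | x. x \<in> A} \<union> {cm x y | x y. x \<in> B \<and> y \<in> C}" and g: "g \<in> carrier G"
  note cl = normal.inv_op_closed2[OF A g] normal.inv_op_closed2[OF B g] normal.inv_op_closed2[OF C g]
  from h show "g \<otimes> h \<otimes> inv g \<in> {x [^] p | x. x \<in> A} \<union> {cm x y | x y. x \<in> B \<and> y \<in> C}"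
  proof
    assume "h \<in> {x [^] p | x. x \<in> A}"
    then obtain x where x: "x \<in> A" "h = x [^] p" by blast
    then have "g \<otimes> h \<otimes> inv g = (g \<otimes> x \<otimes> inv g) [^] p" using c g by (simp add: conj_nat_pow)
    then show ?thesis using cl(1)[OF x(1)] by blast
  next
    assume "h \<in> {cm x y | x y. x \<in> B \<and> y \<in> C}"
    then obtain x y where x: "x \<in> B" "y \<in> C" "h = cm x y" by blast
    then have "g \<otimes> h \<otimes> inv g = cm (g \<otimes> x \<otimes> inv g) (g \<otimes> y \<otimes> inv g)"
      using c g by (simp add: word_simps)
    then show ?thesis using cl(2)[OF x(1)] cl(3)[OF x(2)] by blast
  qed
qed

lemma exponent_chain_normal: "exponent_chain p e r i \<lhd> G"
proof (induction i rule: less_induct)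
  case (less i)
  show ?case
  proof (cases i)
    case (Suc j)
    then show ?thesis
      using generate_powers_commutators_normal[OF less.IH less.IH normal_self, of "j - (e - 1)" j] by simp
  qed (simp add: lower_central_normal)
qed

lemma exponent_chain_pow:
  assumes "e \<ge> 1" "x \<in> exponent_chain p e r i"
  shows "x [^] p \<in> exponent_chain p e r (i + e)"
proof -
  obtain k where k: "e = Suc k" using assms by (cases e) auto
  show ?thesis using assms(2) unfolding k by (auto intro!: generate.incl)
qed

lemma exponent_chain_commutator:
  "x \<in> exponent_chain p e r i \<Longrightarrow> g \<in> carrier G \<Longrightarrow> cm x g \<in> exponent_chain p e r (Suc i)"
  by (auto intro!: generate.incl)

lemma exponent_chain_Suc_subset:
  assumes "e = 1 \<or> e = 2"
  shows "exponent_chain p e r (Suc i) \<subseteq> exponent_chain p e r i"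
proof (induction i rule: less_induct)
  case (less i)
  note sub = normal_imp_subgroup[OF exponent_chain_normal]
  have "x [^] p \<in> exponent_chain p e r i" if x: "x \<in> exponent_chain p e r (i - (e - 1))" for x
  proof (cases "e = 1 \<or> i = 0")
    case True
    then show ?thesis using x subgroup_pow_closed[OF sub] subgroup_pow_closed[OF lower_central_subgroup] by auto
  next
    case False
    then obtain j where j: "i = Suc j" and e: "e = 2" using assms by (cases i) auto
    have xj: "x \<in> exponent_chain p e r j" using x j e by simp
    \<comment> \<open>Term \<open>i\<close> contains the powers of term \<open>j - 1\<close>,
      whereas \<open>x\<close> is given in term \<open>j\<close>. The induction hypothesis bridges
      the gap; for \<open>j = 0\<close> the subtraction truncates.\<close>
    have "x \<in> exponent_chain p e r (j - (e - 1))"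
    proof (cases j)
      case (Suc l)
      then show ?thesis using less.IH[of l] xj j e by auto
    qed (use xj in simp)
    then show ?thesis unfolding j by (auto intro!: generate.incl)
  qed
  moreover have "cm x g \<in> exponent_chain p e r i" if "x \<in> exponent_chain p e r i" "g \<in> carrier G" for x g
    using that normal_commutator_closed[OF exponent_chain_normal] by blast
  ultimately show ?case
    unfolding exponent_chain.simps(2) by (intro generate_subgroup_incl[OF _ sub]) auto
qed

lemma exponent_chain_central:
  assumes "Factorial_Ring.prime p" "r \<ge> 2" "e = 1 \<or> e = 2 \<and> odd p"
  shows "central_chain_commutators G (exponent_chain p e r) p e r"
proof (intro central_chain_commutators.intro central_chain.intro central_chain_axioms.intro
    central_chain_commutators_axioms.intro group_axioms)
  show "exponent_chain p e r i \<lhd> G" for i by (rule exponent_chain_normal)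
  show "cm x g \<in> exponent_chain p e r (Suc i)" if "x \<in> exponent_chain p e r i" "g \<in> carrier G" for x g i
    using that by (rule exponent_chain_commutator)
  show "exponent_chain p e r (Suc i) \<subseteq> exponent_chain p e r i" for i
    by (rule exponent_chain_Suc_subset) (use assms in blast)
  show "x [^] p \<in> exponent_chain p e r (i + e)" if "x \<in> exponent_chain p e r i" for x i
    by (rule exponent_chain_pow[OF _ that]) (use assms in auto)
qed (use assms lower_central_subset_2 in auto)

text \<open>Both kinds of generators of term \<open>i + e\<close> drop one step in the ascending
  series; for the commutators, term \<open>i + e - 1\<close> is contained in term
  \<open>i\<close>.\<close>

lemma exponent_chain_in_central_series:
  assumes e: "e = 1 \<or> e = 2" and N: "exponent_chain p e r i \<subseteq> central_series p (Suc k)"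
  shows "exponent_chain p e r (i + e) \<subseteq> central_series p k"
proof -
  have eq: "exponent_chain p e r (i + e) = generate G ({x [^] p | x. x \<in> exponent_chain p e r i} \<union>
    {cm x g | x g. x \<in> exponent_chain p e r (i + e - 1) \<and> g \<in> carrier G})"
    using e by auto
  have "exponent_chain p e r (i + e - 1) \<subseteq> exponent_chain p e r i"
    using e exponent_chain_Suc_subset[OF e, of p r i]
    by (elim disjE) (simp_all del: exponent_chain.simps)
  then show ?thesis unfolding eq
    by (intro generate_subgroup_incl[OF _ normal_imp_subgroup[OF central_series_normal]])
      (use N in \<open>auto simp del: exponent_chain.simps\<close>)
qed

text \<open>Every \<open>e\<close> steps of the chain drop one step in the ascending series, which
  reaches all of \<open>G\<close>.\<close>

lemma exponent_chain_trivial: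
  assumes fin: "finite (carrier G)" and p: "Factorial_Ring.prime p" and ord: "order G = p ^ m"
    and e: "e = 1 \<or> e = 2"
  shows "\<exists>l. exponent_chain p e r l = {\<one>}"
proof -
  obtain k where k: "central_series p k = carrier G" using central_series_top[OF fin p ord] by blast
  have "\<exists>l. exponent_chain p e r l \<subseteq> central_series p (k - j)" for j
  proof (induction j)
    case 0
    show ?case using k normal_mem_carrier[OF lower_central_normal] by (intro exI[of _ 0]) auto
  next
    case (Suc j)
    then obtain l where l: "exponent_chain p e r l \<subseteq> central_series p (k - j)" by blast
    show ?case
    proof (cases "k - j")
      case (Suc i)
      then have "k - Suc j = i" by simp
      then show ?thesis using exponent_chain_in_central_series[OF e, of p r l i] l Suc by metis
    next
      case 0
      then have "k - Suc j = k - j" by simp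
      then show ?thesis using l by metis
    qed
  qed
  from this[of k] obtain l where "exponent_chain p e r l \<subseteq> {\<one>}" by auto
  then show ?thesis using normal_one_closed[OF exponent_chain_normal] by blast
qed

text \<open>Term \<open>1\<close> is the same for every \<open>e\<close>. If it equalled term
  \<open>0\<close>, the chain for \<open>e = 1\<close> would be constant and could not become
  trivial.\<close>

lemma exponent_chain_1_proper:
  assumes fin: "finite (carrier G)" and p: "Factorial_Ring.prime p" and ord: "order G = p ^ m"
    and ne: "lower_central G r \<noteq> {\<one>}"
  shows "exponent_chain p e r 1 \<noteq> lower_central G r"
proof
  assume eq: "exponent_chain p e r 1 = lower_central G r"
  have "exponent_chain p 1 r 1 = exponent_chain p e r 1" by simp
  then have eq1: "exponent_chain p 1 r 1 = exponent_chain p 1 r 0" using eq by simp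
  have "exponent_chain p 1 r l = lower_central G r" for l
  proof (induction l)
    case (Suc l)
    have "exponent_chain p 1 r (Suc l) = exponent_chain p 1 r 1" using Suc by simp
    then show ?case using eq1 by simp
  qed simp
  then show False using exponent_chain_trivial[OF fin p ord, of 1 r] ne by simp
qed

end

lemma (in central_chain) commutator_chain_0:
  "x \<in> N i \<Longrightarrow> w \<in> N 0 \<Longrightarrow> cm x w \<in> N (i + 2)"
  using upper_commutator_derived[of x i 0 w] chain_in_derived[of w 0] by simp

section \<open>Index bounds and the choice of the chain\<close>

context group
begin

lemma no_intermediate_if_card:
  assumes fin: "finite (carrier G)" and p: "Factorial_Ring.prime p" and ord: "order G = p ^ m"
    and A: "subgroup A G" and B: "subgroup B G" and card: "card A \<le> p * card B"
  shows "no_intermediate B A"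
  unfolding no_intermediate_def
proof (intro allI impI)
  fix K assume K: "subgroup K G" "B \<subseteq> K" "K \<subseteq> A"
  show "K = B \<or> K = A"
  proof (rule ccontr)
    assume "\<not> (K = B \<or> K = A)"
    then have "B \<subset> K" "K \<subset> A" using K by auto
    then have "p * card B \<le> card K" "p * card K \<le> card A"
      using card_subgroup_step[OF fin p ord] K(1) A B by blast+
    then have "p * card K \<le> card K" using card by linarith
    moreover have "card K > 0" using subgroup.finite_imp_card_positive[OF K(1) fin] .
    ultimately show False using prime_gt_1_nat[OF p] by simp
  qed
qed

text \<open>In a finite \<open>p\<close>-group this is the Frattini subgroup of
  \<open>lower_central G r\<close>, whose index is controlled by the number of generators.\<close>

definition power_commutator_subgroup :: "nat \<Rightarrow> nat \<Rightarrow> 'a set" where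
  "power_commutator_subgroup p r = generate G ({x [^] p | x. x \<in> lower_central G r} \<union>
    {cm x y | x y. x \<in> lower_central G r \<and> y \<in> lower_central G r})"

lemma power_commutator_subgroup_normal: "power_commutator_subgroup p r \<lhd> G"
  unfolding power_commutator_subgroup_def
  by (intro generate_powers_commutators_normal lower_central_normal)

text \<open>With \<open>N = lower_central G r\<close>, the three subgroups lemma puts
  \<open>[N, N] \<le> [N, [G, G]]\<close> inside \<open>[N, G, G]\<close>, which lies in term
  \<open>2\<close>.\<close>

lemma power_commutator_subgroup_subset:
  assumes r: "r \<ge> 2"
  shows "power_commutator_subgroup p r \<subseteq> exponent_chain p 2 r 2"
proof -
  let ?N = "exponent_chain p 2 r"
  have eq: "?N 2 = generate G ({x [^] p | x. x \<in> lower_central G r} \<union> {cm x g | x g. x \<in> ?N 1 \<and> g \<in> carrier G})"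
    by (simp add: numeral_2_eq_2)
  have "cm x y \<in> ?N 2" if "x \<in> lower_central G r" "y \<in> lower_central G r" for x y
  proof (rule commutator_lower_central_2_closed)
    show "cm x g \<in> ?N 1" if "x \<in> lower_central G r" "g \<in> carrier G" for x g
      using exponent_chain_commutator[of x p 2 r 0 g] that by (simp del: exponent_chain.simps(2))
    show "cm x g \<in> ?N 2" if "x \<in> ?N 1" "g \<in> carrier G" for x g
      using exponent_chain_commutator[of x p 2 r 1 g] that by (simp add: numeral_2_eq_2 del: exponent_chain.simps(2))
    show "y \<in> lower_central G 2" using that lower_central_subset_2[OF r] by blast
  qed (use that exponent_chain_normal lower_central_normal in \<open>auto simp del: exponent_chain.simps\<close>)
  moreover have "x [^] p \<in> ?N 2" if "x \<in> lower_central G r" for x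
    unfolding eq using that by (auto intro!: generate.incl)
  ultimately show ?thesis unfolding power_commutator_subgroup_def
    by (intro generate_subgroup_incl[OF _ normal_imp_subgroup[OF exponent_chain_normal]]) auto
qed

lemma exponent_chain_power_image:
  assumes "Factorial_Ring.prime p" "r \<ge> 2" "e = 1 \<or> e = 2 \<and> odd p"
    and base: "exponent_chain p e r e \<subseteq> generate G ({x [^] p | x. x \<in> exponent_chain p e r 0} \<union> exponent_chain p e r (Suc e))"
    and n: "n \<in> exponent_chain p e r (i + e)"
  shows "\<exists>m\<in>exponent_chain p e r i. exponent_chain p e r (i + e + 1) #> n = exponent_chain p e r (i + e + 1) #> (m [^] p)"
proof -
  interpret central_chain_commutators G "exponent_chain p e r" p e r
    by (rule exponent_chain_central) fact+
  have "exponent_chain p e r (Suc i + e) = generate G ({x [^] p | x. x \<in> exponent_chain p e r (Suc i)} \<union>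
      {cm x g | x g. x \<in> exponent_chain p e r (i + e) \<and> g \<in> carrier G})" for i
    using assms(3) by (auto simp del: exponent_chain.simps(2) simp add: exponent_chain.simps(2)[of p _ r "i + _"])
  then show ?thesis using base n by (intro power_image) simp_all
qed

text \<open>The index bound squeezes \<open>?F \<le> ?M \<le> ?N 1 < ?N 0\<close>, so the first
  three agree and \<open>?N 1\<close> is generated by squares from \<open>?N 0\<close> together with
  \<open>?N 2\<close>. The term \<open>?M\<close> of the chain for \<open>e = 2\<close> serves only
  as a set, since central chains with \<open>e = 2\<close> require an odd prime.\<close>

lemma lower_central_slot_prime_two:
  assumes fin: "finite (carrier G)" and ord: "order G = 2 ^ m" and r: "r \<ge> 2"
    and ne: "lower_central G r \<noteq> {\<one>}"
    and card: "card (lower_central G r) \<le> 2 * card (power_commutator_subgroup 2 r)"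
  shows "\<exists>ys zs. set ys \<subseteq> carrier G \<and> set zs \<subseteq> carrier G \<and> length ys + length zs + 1 = r \<and>
    (\<forall>n\<in>lower_central G r. \<exists>g\<in>carrier G. left_normed_commutator G (ys @ g # zs) = n)"
proof -
  let ?N = "exponent_chain 2 1 r" and ?F = "power_commutator_subgroup 2 r" and ?M = "exponent_chain 2 2 r 2"
  note p = two_is_prime_nat
  interpret K: central_chain_commutators G ?N 2 1 r by (rule exponent_chain_central) (use r in auto)
  have N1: "exponent_chain 2 2 r 1 = ?N 1" by simp
  have M1: "?M \<subseteq> ?N 1"
    using exponent_chain_Suc_subset[of 2 2 r 1] unfolding N1[symmetric]
    by (simp add: numeral_2_eq_2 del: exponent_chain.simps)
  have FM: "?F \<subseteq> ?M" by (rule power_commutator_subgroup_subset[OF r])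
  have proper: "?N 1 \<noteq> lower_central G r" by (rule exponent_chain_1_proper[OF fin p ord ne])
  have N10: "?N 1 \<subset> lower_central G r" using K.chain_Suc_subset[of 0] proper by auto
  have fN1: "finite (?N 1)" using fin K.chain_carrier by (meson finite_subset subsetI)
  have "2 * card (?N 1) \<le> card (lower_central G r)"
    by (rule card_subgroup_step[OF fin p ord K.chain_subgroup lower_central_subgroup N10])
  then have "card (?N 1) \<le> card ?F" using card by linarith
  then have FN1: "?F = ?N 1" using card_seteq[OF fN1 order_trans[OF FM M1]] by blast
  then have M: "?M = ?N 1" using FM M1 by blast
  have comm: "{cm x g | x g. x \<in> ?N 1 \<and> g \<in> carrier G} \<subseteq> ?N (Suc 1)"
    using K.commutator_chain[of _ 1] by blast
  have M_eq: "?M = generate G ({x [^] (2::nat) | x. x \<in> ?N 0} \<union> {cm x g | x g. x \<in> ?N 1 \<and> g \<in> carrier G})"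
    by (simp add: numeral_2_eq_2)
  have base: "?N 1 \<subseteq> generate G ({x [^] (2::nat) | x. x \<in> ?N 0} \<union> ?N (Suc 1))"
  proof -
    have "?M \<subseteq> generate G ({x [^] (2::nat) | x. x \<in> ?N 0} \<union> ?N (Suc 1))"
      unfolding M_eq by (intro mono_generate Un_mono order_refl comm)
    then show ?thesis using M by simp
  qed
  note pow = exponent_chain_power_image[OF p r _ base]
  have min0: "no_intermediate (?N 1) (?N 0)"
    using no_intermediate_if_card[OF fin p ord lower_central_subgroup K.chain_subgroup] card FN1
    by (simp del: exponent_chain.simps(2))
  have min1: "no_intermediate (?N 2) (?N 1)"
  proof (rule K.no_intermediate_step[OF refl min0])
    fix n assume "n \<in> ?N 1"
    then show "\<exists>m\<in>?N 0. ?N 2 #> n = ?N 2 #> (m [^] (2::nat))"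
      using pow[of n 0] by (simp add: numeral_2_eq_2 del: exponent_chain.simps)
  qed
  interpret P: central_chain_position G ?N 2 1 r
    by unfold_locales (use proper min0 min1 in auto)
  obtain l where l: "?N l = {\<one>}" using exponent_chain_trivial[OF fin p ord] by blast
  show ?thesis using P.surjective_two[OF refl _ l] pow by (simp del: exponent_chain.simps(2))
qed

text \<open>The split is whether \<open>[N 0, G]\<close> lies in \<open>?N 2\<close>. If so, the
  chain for \<open>e = 1\<close> works and its top quotient has order at most \<open>p * p\<close>.
  If not, the index bound forces \<open>?F = ?N 2\<close> and two steps of index
  \<open>p\<close>.\<close>

lemma lower_central_slot_prime_odd:
  assumes fin: "finite (carrier G)" and p: "Factorial_Ring.prime p" "odd p" and ord: "order G = p ^ m"
    and r: "r \<ge> 2" and ne: "lower_central G r \<noteq> {\<one>}"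
    and card: "card (lower_central G r) \<le> p * p * card (power_commutator_subgroup p r)"
  shows "\<exists>ys zs. set ys \<subseteq> carrier G \<and> set zs \<subseteq> carrier G \<and> length ys + length zs + 1 = r \<and>
    (\<forall>n\<in>lower_central G r. \<exists>g\<in>carrier G. left_normed_commutator G (ys @ g # zs) = n)"
proof -
  let ?N = "exponent_chain p 2 r" and ?F = "power_commutator_subgroup p r"
  interpret K: central_chain_commutators G ?N p 2 r by (rule exponent_chain_central) (use r p in auto)
  have N0: "?N 0 = lower_central G r" by simp
  have M1: "?N 2 \<subseteq> ?N 1"
    using K.chain_Suc_subset[of 1] by (simp add: numeral_2_eq_2 del: exponent_chain.simps)
  have FM: "?F \<subseteq> ?N 2" by (rule power_commutator_subgroup_subset[OF r])
  have proper: "?N 1 \<noteq> lower_central G r" by (rule exponent_chain_1_proper[OF fin p(1) ord ne])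
  have N10: "?N 1 \<subset> lower_central G r" using K.chain_Suc_subset[of 0] proper by auto
  have fN: "finite (?N i)" for i using fin K.chain_carrier by (meson finite_subset subsetI)
  note step = card_subgroup_step[OF fin p(1) ord]
  have pp: "p > 1" using p prime_gt_1_nat by blast
  have s1: "p * card (?N 1) \<le> card (lower_central G r)"
    by (rule step[OF K.chain_subgroup lower_central_subgroup N10])
  have M_eq: "?N 2 = generate G ({x [^] p | x. x \<in> ?N 0} \<union> {cm x g | x g. x \<in> ?N 1 \<and> g \<in> carrier G})"
    by (simp add: numeral_2_eq_2)
  show ?thesis
  proof (cases "?N 2 = ?N 1")
    case True
    let ?L = "exponent_chain p 1 r"
    interpret L: central_chain_commutators G ?L p 1 r by (rule exponent_chain_central) (use r p in auto)
    have L1: "?N 1 = ?L 1" by simp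
    have base: "?L 1 \<subseteq> generate G ({x [^] p | x. x \<in> ?L 0} \<union> ?L (Suc 1))"
    proof -
      have "{cm x g | x g. x \<in> ?L 1 \<and> g \<in> carrier G} \<subseteq> ?L (Suc 1)"
        using L.commutator_chain[of _ 1] by (auto simp del: exponent_chain.simps)
      then have "?N 2 \<subseteq> generate G ({x [^] p | x. x \<in> ?L 0} \<union> ?L (Suc 1))"
        unfolding M_eq L1 by (intro mono_generate) auto
      then show ?thesis using True L1 by simp
    qed
    note pow = exponent_chain_power_image[OF p(1) r _ base]
    interpret R: central_chain_rank_two G ?L p 1 r
    proof unfold_locales
      show "?L 1 \<noteq> ?L 0" using proper L1 by simp
      fix A B assume A: "subgroup A G" and B: "subgroup B G" and AB: "?L 1 \<subset> A" "A \<subset> B" "B \<subseteq> ?L 0"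
      show "B = ?L 0"
      proof (rule ccontr)
        assume "B \<noteq> ?L 0"
        then have "B \<subset> lower_central G r" using AB by auto
        then have 3: "p * card B \<le> card (lower_central G r)" using step[OF B lower_central_subgroup] by blast
        have 2: "p * card A \<le> card B" by (rule step[OF A B AB(2)])
        have 1: "p * card (?L 1) \<le> card A" by (rule step[OF L.chain_subgroup A AB(1)])
        have 0: "card ?F \<le> card (?L 1)" using FM True L1 card_mono[OF fN[of 1]] by simp
        have "p * (p * card A) \<le> p * p * card (?L 1)"
          using mult_le_mono2[OF 2, of p] 3 card mult_le_mono2[OF 0, of "p * p"] by linarith
        then have "card A \<le> card (?L 1)" using pp by simp
        then have "p * card (?L 1) \<le> card (?L 1)" using 1 by linarith
        moreover have "card (?L 1) > 0" using subgroup.finite_imp_card_positive[OF L.chain_subgroup fin] .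
        ultimately show False using pp by simp
      qed
    qed
    obtain l where l: "?L l = {\<one>}" using exponent_chain_trivial[OF fin p(1) ord] by blast
    show ?thesis using R.surjective_rank_two[OF p(2) refl _ l] pow by (simp del: exponent_chain.simps(2))
  next
    case False
    then have M1': "?N 2 \<subset> ?N 1" using M1 by blast
    have s2: "p * card (?N 2) \<le> card (?N 1)"
      by (rule step[OF K.chain_subgroup K.chain_subgroup M1'])
    have F2: "card ?F \<le> card (?N 2)" by (rule card_mono[OF fN FM])
    have "p * (p * card (?N 2)) \<le> p * (p * card ?F)"
      using mult_le_mono2[OF s2, of p] s1 card unfolding mult.assoc by linarith
    then have "card (?N 2) \<le> card ?F" using pp by simp
    then have FN2: "?F = ?N 2" using card_seteq[OF fN FM] by blast
    have "p * card (?N 1) \<le> p * (p * card (?N 2))"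
      using s1 card unfolding FN2 mult.assoc by linarith
    then have c1: "card (?N 1) \<le> p * card (?N 2)" using pp by (simp del: exponent_chain.simps)
    have c0: "card (?N 0) \<le> p * card (?N 1)"
      using card mult_le_mono2[OF s2, of p] unfolding FN2 mult.assoc N0 by linarith
    have min0: "no_intermediate (?N 1) (?N 0)"
      by (rule no_intermediate_if_card[OF fin p(1) ord K.chain_subgroup K.chain_subgroup c0])
    have min1: "no_intermediate (?N 2) (?N 1)"
      by (rule no_intermediate_if_card[OF fin p(1) ord K.chain_subgroup K.chain_subgroup c1])
    interpret P: central_chain_position G ?N p 2 r
      by unfold_locales (use proper min0 min1 in auto)
    \<comment> \<open>The base of the power argument requires \<open>[N 0, N 0]\<close> inside
      \<open>?N 3\<close>. This holds since \<open>?N 0\<close> is generated by \<open>?N 1\<close>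
      and the single element \<open>n0\<close>, and \<open>[N 1, N 0]\<close> lies in
      \<open>?N 3\<close>.\<close>
    obtain n0 where n0: "n0 \<in> ?N 0" "n0 \<notin> ?N 1" using N10 by auto
    have der: "cm t x \<in> ?N 3" if "t \<in> ?N 1" "x \<in> ?N 0" for t x
    proof -
      have "(1::nat) + 2 = 3" by simp
      then show ?thesis using K.commutator_chain_0[OF that] by metis
    qed
    have sym: "cm x t \<in> ?N 3 \<longleftrightarrow> cm t x \<in> ?N 3" if "t \<in> ?N 0" "x \<in> ?N 0" for t x
      using normal_commutator_sym[OF K.normal_chain] that K.chain_carrier by blast
    have full: "cm y x \<in> ?N 3" if y: "y \<in> ?N 0" "cm y n0 \<in> ?N 3" and x: "x \<in> ?N 0" for x y
    proof -
      let ?A = "?N 0 \<inter> {w \<in> carrier G. \<forall>a\<in>{y}. cm a w \<in> ?N 3}"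
      have yc: "y \<in> carrier G" using y K.chain_carrier by blast
      have "subgroup {w \<in> carrier G. \<forall>a\<in>{y}. cm a w \<in> ?N 3} G"
        using subgroup_commutator_right[OF K.normal_chain, of "{y}" 3] yc by simp
      then have A: "subgroup ?A G" using subgroups_Inter_pair[OF K.chain_subgroup] by blast
      have "?N 1 \<subseteq> ?A"
      proof
        fix t assume t: "t \<in> ?N 1"
        then have t0: "t \<in> ?N 0" using K.chain_Suc_subset[of 0] by (auto simp del: exponent_chain.simps)
        have "cm y t \<in> ?N 3" using der[OF t y(1)] sym[OF t0 y(1)] by blast
        then show "t \<in> ?A" using t0 K.chain_carrier by blast
      qed
      moreover have "n0 \<in> ?A" using n0 y K.chain_carrier by blast
      ultimately have "?A = ?N 0" using min0 n0(2) A unfolding no_intermediate_def by blast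
      then show ?thesis using x by blast
    qed
    have "cm n0 n0 \<in> ?N 3"
      using n0 K.chain_carrier[of n0 0] normal_one_closed[OF K.normal_chain] by (simp del: exponent_chain.simps)
    then have "cm n0 x \<in> ?N 3" if "x \<in> ?N 0" for x using full n0(1) that by blast
    then have NN: "cm x y \<in> ?N 3" if "x \<in> ?N 0" "y \<in> ?N 0" for x y
      using full sym n0(1) that by blast
    have base: "?N 2 \<subseteq> generate G ({x [^] p | x. x \<in> ?N 0} \<union> ?N (Suc 2))"
      unfolding FN2[symmetric] power_commutator_subgroup_def
      by (intro mono_generate) (use NN in \<open>auto simp: eval_nat_numeral simp del: exponent_chain.simps(2)\<close>)
    note pow = exponent_chain_power_image[OF p(1) r _ base]
    \<comment> \<open>Otherwise all generators of \<open>?N 1\<close> would lie in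
      \<open>?N 2\<close>. The element \<open>t\<close> found here is the one outside the
      centralizer of \<open>?N 0\<close> modulo \<open>?N 2\<close>.\<close>
    have "\<exists>n\<in>?N 0. \<exists>t\<in>carrier G. cm n t \<notin> ?N 2"
    proof (rule ccontr)
      assume no: "\<not> ?thesis"
      have "?N 1 = generate G ({x [^] p | x. x \<in> ?N 0} \<union> {cm x g | x g. x \<in> ?N 0 \<and> g \<in> carrier G})"
        by simp
      also have "\<dots> \<subseteq> ?N 2"
        using K.pow_chain[of _ 0, unfolded add_0] no
        by (intro generate_subgroup_incl[OF _ K.chain_subgroup]) blast
      finally show False using M1' by blast
    qed
    then obtain n t where nt: "n \<in> ?N 0" "t \<in> carrier G" "cm n t \<notin> ?N 2" by blast
    obtain l where l: "?N l = {\<one>}" using exponent_chain_trivial[OF fin p(1) ord] by blast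
    show ?thesis using P.surjective_odd[OF p(2) refl nt _ l] pow p(2) by (simp del: exponent_chain.simps(2))
  qed
qed

lemma card_lower_central_le:
  assumes fin: "finite (carrier G)" and ab: "a \<in> lower_central G r" "b \<in> lower_central G r"
    and gen: "lower_central G r = generate G {a, b}" and p: "p > 0"
  shows "card (lower_central G r) \<le> p * p * card (power_commutator_subgroup p r)"
proof -
  have c: "x \<in> carrier G" if "x \<in> lower_central G r" for x
    using that lower_central_subgroup subgroup.mem_carrier by metis
  show ?thesis unfolding gen
    by (rule card_generate_two[OF fin power_commutator_subgroup_normal])
      (use ab c p in \<open>auto simp: power_commutator_subgroup_def intro!: generate.incl\<close>)
qed

text \<open>The two-generator bound is applied with second generator \<open>\<one>\<close> and
  exponent \<open>1\<close>.\<close>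

lemma card_cyclic_lower_central_le:
  assumes fin: "finite (carrier G)" and a: "a \<in> lower_central G r"
    and gen: "lower_central G r = generate G {a}" and p: "p > 0"
  shows "card (lower_central G r) \<le> p * card (power_commutator_subgroup p r)"
proof -
  have ac: "a \<in> carrier G" using a lower_central_subgroup subgroup.mem_carrier by metis
  have "card (generate G {a}) \<le> card (generate G {a, \<one>})"
    using ac by (intro card_mono mono_generate finite_subset[OF generate_incl fin]) auto
  also have "\<dots> \<le> p * 1 * card (power_commutator_subgroup p r)"
    by (rule card_generate_two[OF fin power_commutator_subgroup_normal])
      (use ac a p normal_one_closed[OF power_commutator_subgroup_normal, of p r] in
        \<open>auto simp: power_commutator_subgroup_def intro!: generate.incl\<close>)
  finally show ?thesis unfolding gen by simp
qed

end

theorem theoremA: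
  fixes G :: "('a, 'b) monoid_scheme" (structure) and p r :: nat
  assumes "Factorial_Ring.prime p"
    and "group G"
    and "finite (carrier G)"
    and "\<exists>n. order G = p ^ n"
    and "r \<ge> 2"
    and "cyclic_group (G\<lparr>carrier := lower_central G r\<rparr>) \<or>
         (odd p \<and> (\<exists>a\<in>lower_central G r. \<exists>b\<in>lower_central G r.
            lower_central G r = generate G {a, b}))"
  shows "\<exists>j\<in>{1..r}. \<exists>xs ys.
           length xs = j - 1 \<and> length ys = r - j \<and>
           set xs \<subseteq> carrier G \<and> set ys \<subseteq> carrier G \<and>
           lower_central G r =
             {left_normed_commutator G (xs @ g # ys) | g. g \<in> carrier G}"
proof -
  interpret group G by fact
  note p = assms(1) and fin = assms(3) and r = assms(5)
  obtain m where ord: "order G = p ^ m" using assms(4) by blast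
  have p0: "p > 0" using p prime_gt_0_nat by blast
  let ?N = "lower_central G r" and ?F = "power_commutator_subgroup p r"
  have cyc: "card ?N \<le> p * card ?F" if c: "cyclic_group (G\<lparr>carrier := ?N\<rparr>)"
  proof -
    obtain a where a: "a \<in> ?N" "subgroup_generated (G\<lparr>carrier := ?N\<rparr>) {a} = G\<lparr>carrier := ?N\<rparr>"
      using c unfolding cyclic_group_def by auto
    have "?N = carrier (subgroup_generated (G\<lparr>carrier := ?N\<rparr>) {a})" using a(2) by simp
    also have "\<dots> = generate (G\<lparr>carrier := ?N\<rparr>) {a}"
      using a(1) by (simp add: carrier_subgroup_generated)
    also have "\<dots> = generate G {a}"
      using a(1) by (intro generate_consistent[OF _ lower_central_subgroup]) simp
    finally show ?thesis using card_cyclic_lower_central_le[OF fin a(1) _ p0] by blast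
  qed
  have "\<exists>ys zs. set ys \<subseteq> carrier G \<and> set zs \<subseteq> carrier G \<and> length ys + length zs + 1 = r \<and>
    (\<forall>n\<in>?N. \<exists>g\<in>carrier G. left_normed_commutator G (ys @ g # zs) = n)"
  proof (cases "?N = {\<one>}")
    case True
    \<comment> \<open>The chains require \<open>N 1 \<noteq> N 0\<close>, so the trivial subgroup is
      treated separately, with every fixed entry equal to \<open>\<one>\<close>.\<close>
    have "left_normed_commutator G ([] @ \<one> # replicate (r - 1) \<one>) \<in> ?N"
      by (rule left_normed_commutator_in_lower_central) (use r in auto)
    then show ?thesis using r True
      by (intro exI[of _ "[]"] exI[of _ "replicate (r - 1) \<one>"]) (auto intro!: bexI[of _ \<one>])
  next
    case False
    show ?thesis
    proof (cases "odd p")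
      case True
      have "card ?N \<le> p * p * card ?F" using assms(6)
      proof
        assume "cyclic_group (G\<lparr>carrier := ?N\<rparr>)"
        then have "card ?N \<le> p * card ?F" by (rule cyc)
        also have "\<dots> \<le> p * p * card ?F" using p0 by simp
        finally show ?thesis .
      qed (use card_lower_central_le[OF fin _ _ _ p0] in blast)
      then show ?thesis using lower_central_slot_prime_odd[OF fin p True ord r False] by blast
    next
      case even: False
      then have p2: "p = 2" using p primes_dvd_imp_eq two_is_prime_nat by blast
      have "card ?N \<le> p * card ?F" using assms(6) even cyc by blast
      then show ?thesis using lower_central_slot_prime_two[OF fin _ r False] ord p2 by blast
    qed
  qed
  then obtain ys zs where w: "set ys \<subseteq> carrier G" "set zs \<subseteq> carrier G" "length ys + length zs + 1 = r"
    and sur: "\<forall>n\<in>?N. \<exists>g\<in>carrier G. left_normed_commutator G (ys @ g # zs) = n" by blast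
  have val: "left_normed_commutator G (ys @ g # zs) \<in> ?N" if "g \<in> carrier G" for g
    by (rule left_normed_commutator_in_lower_central) (use w that in auto)
  have eq: "?N = {left_normed_commutator G (ys @ g # zs) | g. g \<in> carrier G}"
  proof (intro equalityI subsetI)
    fix n assume "n \<in> ?N"
    then show "n \<in> {left_normed_commutator G (ys @ g # zs) | g. g \<in> carrier G}" using sur by fastforce
  qed (use val in blast)
  show ?thesis
  proof (intro bexI exI conjI)
    show "length ys = (length ys + 1) - 1" "length zs = r - (length ys + 1)" "length ys + 1 \<in> {1..r}"
      using w(3) by auto
  qed (rule w(1) w(2) eq)+
qed

end
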